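(* Let $\mathcal{D}$ be an open disk centred at the origin with radius $r_0>0$, let $\varphi,\widetilde\varphi$ be the cut-off functions described in the context, let $\mathcal{G}_n$ be the $n$-dimensional Ginibre ensemble and $\mathcal{G}$ the infinite Ginibre ensemble. Then: (i) The random variables $$S_l(n):=\int\frac{\widetilde\varphi(z)}{z^l}\,d[\mathcal{G}_n](z)+\sum_{j=1}^\infty\int\frac{\varphi_{2^j}(z)}{z^l}\,d[\mathcal{G}_n](z)=\sum_{\omega\in\mathcal{G}_n\cap\mathcal{D}^c}\frac1{\omega^l}\qquad(l\ge1)$$ and $$\widetilde S_l(n):=\int\frac{\widetilde\varphi(z)}{|z|^l}\,d[\mathcal{G}_n](z)+\sum_{j=1}^\infty\int\frac{\varphi_{2^j}(z)}{|z|^l}\,d[\mathcal{G}_n](z)=\sum_{\omega\in\mathcal{G}_n\cap\mathcal{D}^c}\frac1{|\omega|^l}\qquad(l\ge3)$$ have finite first moments which, for every fixed $l$, are bounded above by quantities which do not depend on $n$. (ii) There exists $k_0=k_0(\varphi)\ge1$, not depending on $n$ or $l$, such that for $k\ge k_0$ the tails $$\tau_l^n(2^k):=\sum_{j=k}^\infty\int\frac{\varphi_{2^j}(z)}{z^l}\,d[\mathcal{G}_n](z)\ \ (l\ge1),\qquad \widetilde\tau_l^n(2^k):=\sum_{j=k}^\infty\int\frac{\varphi_{2^j}(z)}{|z|^l}\,d[\mathcal{G}_n](z)\ \ (l\ge3)$$ satisfy $$\mathbb{E}\big[|\tau_l^n(2^k)|\big]\le C_1(\varphi,l)/2^{kl},\qquad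 \mathbb{E}\big[|\widetilde\tau_l^n(2^k)|\big]\le C_2(\varphi,l)/2^{k(l-2)},$$ with $C_1(\varphi,l),C_2(\varphi,l)$ not depending on $n$ or $k$. The same holds for the infinite Ginibre ensemble $\mathcal{G}$: the random variables $$S_l:=\int\frac{\widetilde\varphi(z)}{z^l}\,d[\mathcal{G}](z)+\sum_{j=1}^\infty\int\frac{\varphi_{2^j}(z)}{z^l}\,d[\mathcal{G}](z)\ \ (l\ge1),\qquad \widetilde S_l:=\int\frac{\widetilde\varphi(z)}{|z|^l}\,d[\mathcal{G}](z)+\sum_{j=1}^\infty\int\frac{\varphi_{2^j}(z)}{|z|^l}\,d[\mathcal{G}](z)=\sum_{\omega\in\mathcal{G}\cap\mathcal{D}^c}\frac1{|\omega|^l}\ \ (l\ge3)$$ have finite first moments, and for $k\ge k_0$ the tails $$\tau_l(2^k):=\sum_{j=k}^\infty\int\frac{\varphi_{2^j}(z)}{z^l}\,d[\mathcal{G}](z)\ \ (l\ge1),\qquad \widetilde\tau_l(2^k):=\sum_{j=k}^\infty\int\frac{\varphi_{2^j}(z)}{|z|^l}\,d[\mathcal{G}](z)\ \ (l\ge3)$$ satisfy $$\mathbb{E}\big[|\tau_l(2^k)|\big]\le C_1(\varphi,l)/2^{kl},\qquad \mathbb{E}\big[|\widetilde\tau_l(2^k)|\big]\le C_2(\varphi,l)/2^{k(l-2)};$$ here, for $\mathcal{G}$, the symbol $\sum_{\omega\in\mathcal{G}\cap\mathcal{D}^c}\omega^{-l}$ denotes by definition the quantity $S_l=\int\frac{\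widetilde\varphi(z)}{z^l}d[\mathcal{G}](z)+\sum_{j\ge1}\int\frac{\varphi_{2^j}(z)}{z^l}d[\mathcal{G}](z)$.
   Context: $\mathcal{G}_n$ is the set of eigenvalues of an $n\times n$ matrix with i.i.d. standard complex Gaussian entries; equivalently the determinantal point process with kernel $K_n(z,w)=\sum_{k=0}^{n-1}\frac{(z\overline w)^k}{k!}$ with respect to $\frac1\pi e^{-|z|^2}d\mathcal{L}(z)$ ($\mathcal{L}$ = Lebesgue measure on $\mathbb{C}$). $\mathcal{G}$ is the determinantal point process with kernel $e^{z\overline w}$ with respect to the same measure. For a point process $\Pi$, $[\Pi]=\sum_{z\in\Pi}\delta_z$. $\varphi$ is a non-negative radial $C_c^\infty$ function on $\mathbb{C}$ supported on $\{r_0\le|z|\le3r_0\}$, with (writing $\varphi$ as a function of $|z|$) $\varphi=1$ on $[\frac{3r_0}2,2r_0]$ and $\varphi(r_0+r)=1-\varphi(2r_0+2r)$ for $0\le r\le\frac12r_0$. $\widetilde\varphi$ is the radial function with $\widetilde\varphi(z)=1$ for $r_0\le|z|\le\frac{3r_0}2$ and $\widetilde\varphi=\varphi$ otherwise. For $L>0$, $\psi_L(z):=\psi(z/L)$. The functions $\widetilde\varphi$ and $\varphi_{2^j}$, $j\ge1$, form a partition of unity on $\mathcal{D}^c$. *)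

theory Defs
  imports "HOL-Probability.Probability" "Jordan_Normal_Form.Determinant"
begin

section \<open>Point processes on the complex plane\<close>

text \<open>The counting measure \<open>\<Sum>z\<in>X. \<delta>\<^sub>z\<close> of a set of points, written \<open>[X]\<close> on paper, as a Borel
  measure on the complex plane.\<close>

definition pts_measure :: "complex set \<Rightarrow> complex measure" where
  "pts_measure X = distr (count_space X) borel (\<lambda>z. z)"

text \<open>A (simple) point process is a random locally finite set of points.\<close>

definition point_process :: "'a measure \<Rightarrow> ('a \<Rightarrow> complex set) \<Rightarrow> bool" where
  "point_process M X \<longleftrightarrow> prob_space M \<and>
     (\<forall>x\<in>space M. \<forall>B. bounded B \<longrightarrow> finite (X x \<inter> B)) \<and>
     (\<forall>A\<in>sets borel. (\<lambda>x. emeasure (pts_measure (X x)) A) \<in> borel_measurable M)"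

text \<open>The correlation functions with respect to \<open>\<mu>\<close> are \<open>det (K (z i) (z j))\<close>. As \<open>X\<close> is simple,
  it suffices to prescribe the joint intensities on pairwise disjoint sets. For the positive
  semidefinite Hermitian kernels below the determinant is a non-negative real, so that neither
  \<^const>\<open>Re\<close> nor \<^const>\<open>ennreal\<close> loses information.\<close>

definition determinantal_process ::
    "'a measure \<Rightarrow> ('a \<Rightarrow> complex set) \<Rightarrow> complex measure \<Rightarrow> (complex \<Rightarrow> complex \<Rightarrow> complex) \<Rightarrow> bool" where
  "determinantal_process M X \<mu> K \<longleftrightarrow> point_process M X \<and>
     (\<forall>k. \<forall>A :: nat \<Rightarrow> complex set.
        (\<forall>i<k. A i \<in> sets borel) \<longrightarrow> disjoint_family_on A {..<k} \<longrightarrow>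
        (\<integral>\<^sup>+x. (\<Prod>i<k. emeasure (pts_measure (X x)) (A i)) \<partial>M) =
        (\<integral>\<^sup>+z. ennreal (Re (Determinant.det (mat k k (\<lambda>(i, j). K (z i) (z j)))))
             * indicator (Pi\<^sub>E {..<k} A) z \<partial>(Pi\<^sub>M {..<k} (\<lambda>_. \<mu>))))"


section \<open>The Ginibre ensembles\<close>

definition gaussian_measure :: "complex measure" where
  "gaussian_measure = density lborel (\<lambda>z. ennreal (exp (- (norm z)\<^sup>2) / pi))"

text \<open>The \<open>n\<close>-dimensional Ginibre ensemble (the eigenvalues of an \<open>n \<times> n\<close> matrix with i.i.d.
  standard complex Gaussian entries) is specified by its determinantal description.\<close>

definition ginibre_kernel :: "nat \<Rightarrow> complex \<Rightarrow> complex \<Rightarrow> complex" where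
  "ginibre_kernel n z w = (\<Sum>k<n. (z * cnj w) ^ k / fact k)"

definition ginibre_ensemble :: "nat \<Rightarrow> 'a measure \<Rightarrow> ('a \<Rightarrow> complex set) \<Rightarrow> bool" where
  "ginibre_ensemble n M G \<longleftrightarrow> determinantal_process M G gaussian_measure (ginibre_kernel n)"

definition infinite_ginibre_ensemble :: "'a measure \<Rightarrow> ('a \<Rightarrow> complex set) \<Rightarrow> bool" where
  "infinite_ginibre_ensemble M G \<longleftrightarrow>
     determinantal_process M G gaussian_measure (\<lambda>z w. exp (z * cnj w))"


section \<open>The cut-off functions\<close>

primrec times_cont_diff ::
    "nat \<Rightarrow> ('a::real_normed_vector \<Rightarrow> 'b::real_normed_vector) \<Rightarrow> bool" where
  "times_cont_diff 0 f \<longleftrightarrow> continuous_on UNIV f"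
| "times_cont_diff (Suc m) f \<longleftrightarrow> (\<forall>x. f differentiable (at x)) \<and>
     (\<forall>v. times_cont_diff m (\<lambda>x. frechet_derivative f (at x) v))"

text \<open>Smoothness on the complex plane is that of the underlying real plane.\<close>

definition smooth :: "('a::real_normed_vector \<Rightarrow> 'b::real_normed_vector) \<Rightarrow> bool" where
  "smooth f \<longleftrightarrow> (\<forall>m. times_cont_diff m f)"

definition radial :: "(complex \<Rightarrow> real) \<Rightarrow> bool" where
  "radial f \<longleftrightarrow> (\<forall>z w. norm z = norm w \<longrightarrow> f z = f w)"

definition cutoff :: "real \<Rightarrow> (complex \<Rightarrow> real) \<Rightarrow> bool" where
  "cutoff r0 \<phi> \<longleftrightarrow> smooth \<phi> \<and> radial \<phi> \<and> (\<forall>z. 0 \<le> \<phi> z) \<and>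
     closure {z. \<phi> z \<noteq> 0} \<subseteq> {z. r0 \<le> norm z \<and> norm z \<le> 3 * r0} \<and>
     (\<forall>z. 3 * r0 / 2 \<le> norm z \<and> norm z \<le> 2 * r0 \<longrightarrow> \<phi> z = 1) \<and>
     (\<forall>r. 0 \<le> r \<and> r \<le> r0 / 2 \<longrightarrow>
        \<phi> (complex_of_real (r0 + r)) = 1 - \<phi> (complex_of_real (2 * r0 + 2 * r)))"

definition cutoff_tilde :: "real \<Rightarrow> (complex \<Rightarrow> real) \<Rightarrow> complex \<Rightarrow> real" where
  "cutoff_tilde r0 \<phi> z = (if r0 \<le> norm z \<and> norm z \<le> 3 * r0 / 2 then 1 else \<phi> z)"

definition dilate :: "real \<Rightarrow> (complex \<Rightarrow> real) \<Rightarrow> complex \<Rightarrow> real" where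
  "dilate L \<psi> z = \<psi> (z / complex_of_real L)"


section \<open>Inverse power sums\<close>

definition lin_stat :: "(complex \<Rightarrow> real) \<Rightarrow> nat \<Rightarrow> complex set \<Rightarrow> complex" where
  "lin_stat \<psi> l X = (\<integral>z. complex_of_real (\<psi> z) / z ^ l \<partial>(pts_measure X))"

definition abs_lin_stat :: "(complex \<Rightarrow> real) \<Rightarrow> nat \<Rightarrow> complex set \<Rightarrow> real" where
  "abs_lin_stat \<psi> l X = (\<integral>z. \<psi> z / norm z ^ l \<partial>(pts_measure X))"

text \<open>The series below are meaningful only where they converge, since \<^const>\<open>suminf\<close> is
  total; convergence has to be asserted separately.\<close>

definition inv_power_tail :: "(complex \<Rightarrow> real) \<Rightarrow> nat \<Rightarrow> nat \<Rightarrow> complex set \<Rightarrow> complex" where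
  "inv_power_tail \<phi> l k X = (\<Sum>j. lin_stat (dilate (2 ^ (k + j)) \<phi>) l X)"

definition abs_inv_power_tail :: "(complex \<Rightarrow> real) \<Rightarrow> nat \<Rightarrow> nat \<Rightarrow> complex set \<Rightarrow> real" where
  "abs_inv_power_tail \<phi> l k X = (\<Sum>j. abs_lin_stat (dilate (2 ^ (k + j)) \<phi>) l X)"

definition inv_power_sum :: "real \<Rightarrow> (complex \<Rightarrow> real) \<Rightarrow> nat \<Rightarrow> complex set \<Rightarrow> complex" where
  "inv_power_sum r0 \<phi> l X = lin_stat (cutoff_tilde r0 \<phi>) l X + inv_power_tail \<phi> l 1 X"

definition abs_inv_power_sum :: "real \<Rightarrow> (complex \<Rightarrow> real) \<Rightarrow> nat \<Rightarrow> complex set \<Rightarrow> real" where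
  "abs_inv_power_sum r0 \<phi> l X =
     abs_lin_stat (cutoff_tilde r0 \<phi>) l X + abs_inv_power_tail \<phi> l 1 X"

end

theory Submission
  imports Defs
begin

text \<open>Let \<open>K\<^sub>n\<close> and \<open>K\<close> be the Ginibre kernels and \<open>f\<^sub>L(z) = \<phi>(z/L) / z\<^sup>l\<close>. Rotating by \<open>u\<close> multiplies
  \<open>f\<^sub>L\<close> by \<open>u^(-l)\<close>, so its linear statistic has mean zero and second moment
  \<open>\<integral>\<bar>f\<^sub>L\<bar>\<^sup>2 K\<^sub>n(z,z) - \<integral>\<integral> f\<^sub>L(z) cnj (f\<^sub>L(w)) \<bar>K\<^sub>n(z,w)\<bar>\<^sup>2\<close>.
  Multiplication by \<open>f\<^sub>L\<close> lowers the degree of a monomial by \<open>l\<close>, so this is a sum over \<open>k < n\<close> of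
  terms independent of \<open>n\<close>, which are non-negative by Cauchy-Schwarz. Hence it increases in \<open>n\<close> to
  the value for \<open>K\<close>, where it equals \<open>(1/2) \<integral>\<integral> \<bar>f\<^sub>L(z) - f\<^sub>L(w)\<bar>\<^sup>2 exp (- \<bar>z - w\<bar>\<^sup>2) / \<pi>\<^sup>2\<close> and is at most the
  squared Lipschitz constant of \<open>f\<^sub>L\<close>, of order \<open>L^(-2l-2)\<close>, times the area \<open>O(L\<^sup>2)\<close> of its support.
  The first moment at scale \<open>2\<^sup>j\<close> is therefore \<open>O(2^(-jl))\<close> uniformly in \<open>n\<close>, and the tails are
  geometric series; so \<open>k\<^sub>0 = 1\<close> works. For \<open>\<bar>z\<bar>^(-l)\<close> the bound \<open>K\<^sub>n(z,z) \<le> exp \<bar>z\<bar>\<^sup>2\<close> on the intensity suffices.\<close>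

section \<open>Lebesgue and Gaussian measure on the complex plane\<close>

text \<open>For \<open>l \<le> 2\<close> intensities alone cannot suffice: the annulus at scale
  \<open>2 ^ j\<close> can carry about \<open>4 ^ j\<close> points, each contributing
  \<open>2 ^ (- j * l)\<close> in modulus, so absolute values do not sum. Cancellation between
  points is visible in second moments, but these are not part of the definition of a determinantal
  process, which prescribes joint intensities on products of pairwise disjoint sets only. The
  formula for \<open>E |sum f|^2\<close> is therefore recovered by rounding points to a grid, where
  it is a finite combination of products of counts in disjoint cells. The other obstacle is
  uniformity in \<open>n\<close>: only for the infinite kernel is \<open>|K(z,w)|^2\<close>, with
  its Gaussian weights, a function of \<open>z - w\<close>, so that smoothness of the test function
  can be used directly. The comparison works because a monomial of degree \<open>k < n\<close> is
  coupled only to degree \<open>k - l\<close>, which is again below \<open>n\<close>: the truncation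
  at \<open>n\<close> cuts off no coupling. What both ensembles share is collected in one locale,
  which is why they get identical constants.\<close>

lemma nn_integral_lborel_translate:
  fixes F :: "'a::euclidean_space \<Rightarrow> ennreal"
  assumes [measurable]: "F \<in> borel_measurable borel"
  shows "(\<integral>\<^sup>+x. F (c + x) \<partial>lborel) = (\<integral>\<^sup>+x. F x \<partial>lborel)"
proof -
  have "(\<integral>\<^sup>+x. F x \<partial>lborel) = (\<integral>\<^sup>+x. F x \<partial>distr lborel borel ((+) c))"
    by (subst lborel_distr_plus) simp
  then show ?thesis
    by (simp add: nn_integral_distr)
qed

lemma emeasure_lborel_ball_complex:
  "r \<ge> 0 \<Longrightarrow> emeasure lborel (ball (c::complex) r) = ennreal (pi * r\<^sup>2)"
  by (simp add: emeasure_ball eval_unit_ball_vol)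

text \<open>Averaging reduces this to translation invariance. The integral times \<open>pi\<close>
  is spread over \<open>y\<close> in the unit disc, \<open>x\<close> is shifted by
  \<open>y / u\<close>, and Fubini leaves at each point \<open>y\<close> the area of the unit disc
  about \<open>y / u\<close>, which is \<open>pi\<close> again because
  \<open>|u| = 1\<close>.\<close>

lemma nn_integral_lborel_rotate:
  fixes F :: "complex \<Rightarrow> ennreal"
  assumes [measurable]: "F \<in> borel_measurable borel" and u: "norm u = 1"
  shows "(\<integral>\<^sup>+x. F (u * x) \<partial>lborel) = (\<integral>\<^sup>+x. F x \<partial>lborel)"
proof -
  let ?B = "indicator (ball 0 1) :: complex \<Rightarrow> ennreal"
  have [simp]: "u \<noteq> 0" using u by auto
  have measB [measurable]: "?B \<in> borel_measurable borel"
    by (intro borel_measurable_indicator) auto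
  have B: "(\<integral>\<^sup>+y. ?B y \<partial>lborel) = ennreal pi"
    using emeasure_lborel_ball_complex[of 1 0] by simp
  have "(\<integral>\<^sup>+x. F (u * x) \<partial>lborel) * ennreal pi
      = (\<integral>\<^sup>+y. (\<integral>\<^sup>+x. F (u * x) \<partial>lborel) * ?B y \<partial>lborel)"
    by (subst nn_integral_cmult) (simp_all only: B measB measurable_lborel1 measurable_lborel2)
  also have "\<dots> = (\<integral>\<^sup>+y. (\<integral>\<^sup>+x. F (u * x + y) * ?B y \<partial>lborel) \<partial>lborel)"
  proof (rule nn_integral_cong)
    fix y :: complex
    have "(\<integral>\<^sup>+x. F (u * x) \<partial>lborel) = (\<integral>\<^sup>+x. F (u * (y / u + x)) \<partial>lborel)"
      by (rule nn_integral_lborel_translate[symmetric]) measurable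
    then show "(\<integral>\<^sup>+x. F (u * x) \<partial>lborel) * ?B y = (\<integral>\<^sup>+x. F (u * x + y) * ?B y \<partial>lborel)"
      by (simp add: nn_integral_multc distrib_left add.commute)
  qed
  also have "\<dots> = (\<integral>\<^sup>+x. (\<integral>\<^sup>+y. F (u * x + y) * ?B y \<partial>lborel) \<partial>lborel)"
    by (rule lborel_pair.Fubini') (measurable)
  also have "\<dots> = (\<integral>\<^sup>+x. (\<integral>\<^sup>+y. F y * ?B (y - u * x) \<partial>lborel) \<partial>lborel)"
  proof (rule nn_integral_cong)
    fix x :: complex
    have "(\<integral>\<^sup>+y. F y * ?B (y - u * x) \<partial>lborel)
        = (\<integral>\<^sup>+y. F (u * x + y) * ?B ((u * x + y) - u * x) \<partial>lborel)"
      by (rule nn_integral_lborel_translate[symmetric]) measurable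
    then show "(\<integral>\<^sup>+y. F (u * x + y) * ?B y \<partial>lborel) = (\<integral>\<^sup>+y. F y * ?B (y - u * x) \<partial>lborel)"
      by simp
  qed
  also have "\<dots> = (\<integral>\<^sup>+y. (\<integral>\<^sup>+x. F y * ?B (y - u * x) \<partial>lborel) \<partial>lborel)"
    by (rule lborel_pair.Fubini') (measurable)
  also have "\<dots> = (\<integral>\<^sup>+y. F y * ennreal pi \<partial>lborel)"
  proof (rule nn_integral_cong)
    fix y :: complex
    have "?B (y - u * x) = indicator (ball (y / u) 1) x" for x
    proof -
      have "norm (y - u * x) = norm (u * (y / u - x))"
        by (simp add: right_diff_distrib)
      also have "\<dots> = norm (y / u - x)"
        using u by (simp add: norm_mult)
      finally show ?thesis by (simp add: dist_norm indicator_def norm_minus_commute)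
    qed
    then show "(\<integral>\<^sup>+x. F y * ?B (y - u * x) \<partial>lborel) = F y * ennreal pi"
      using emeasure_lborel_ball_complex[of 1 "y / u"] by (simp add: nn_integral_cmult_indicator)
  qed
  also have "\<dots> = (\<integral>\<^sup>+y. F y \<partial>lborel) * ennreal pi"
    by (simp add: nn_integral_multc)
  finally show ?thesis
    by (simp add: ennreal_mult_cancel_left mult.commute[of _ "ennreal pi"])
qed

text \<open>Polar coordinates without a Jacobian: the disc \<open>|z|^2 \<le> a\<close> has area
  \<open>pi * a\<close>, so the two measures agree on the half-lines \<open>{..a}\<close>, an
  intersection-stable generator.\<close>

lemma distr_norm_squared_lborel_complex:
  "distr (lborel :: complex measure) borel (\<lambda>z. (norm z)\<^sup>2)
     = density lborel (\<lambda>s. ennreal pi * indicator {0..} s)" (is "?M = ?N")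
proof (rule measure_eqI_generator_eq[where E = "range atMost" and A = "\<lambda>i. {..real i}" and \<Omega> = UNIV])
  show "Int_stable (range (atMost :: real \<Rightarrow> _))"
    by (auto simp: Int_stable_def)
  show "sets ?M = sigma_sets UNIV (range atMost)" "sets ?N = sigma_sets UNIV (range atMost)"
    by (simp_all add: borel_eq_atMost sets_measure_of)
  have M: "emeasure ?M {..a} = ennreal (pi * max 0 a)" for a :: real
  proof -
    have "(\<lambda>z::complex. (norm z)\<^sup>2) -` {..a} = (if a \<ge> 0 then cball 0 (sqrt a) else {})"
      by (auto simp: real_le_rsqrt sqrt_ge_absD dest: order_trans[OF zero_le_power2])
    then show ?thesis
      by (auto simp: emeasure_distr emeasure_cball eval_unit_ball_vol max_def)
  qed
  have N: "emeasure ?N {..a} = ennreal (pi * max 0 a)" for a :: real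
  proof -
    have "emeasure ?N {..a} = (\<integral>\<^sup>+s. ennreal pi * indicator {0..a} s \<partial>lborel)"
      by (auto simp: emeasure_density indicator_def intro!: nn_integral_cong)
    also have "\<dots> = ennreal pi * emeasure lborel {0..a}"
      by (simp add: nn_integral_cmult)
    finally show ?thesis
      by (cases "a \<ge> 0") (auto simp: max_def ennreal_mult')
  qed
  show "emeasure ?M X = emeasure ?N X" if "X \<in> range atMost" for X
    using that M N by auto
  show "(\<Union>i. {..real i}) = UNIV"
    by (auto intro: real_arch_simple)
  show "emeasure ?M {..real i} \<noteq> \<infinity>" for i
    unfolding M by simp
qed auto

lemma nn_integral_lborel_norm_squared:
  assumes [measurable]: "g \<in> borel_measurable borel"
  shows "(\<integral>\<^sup>+z. g ((norm (z::complex))\<^sup>2) \<partial>lborel) = ennreal pi * (\<integral>\<^sup>+s. g s * indicator {0..} s \<partial>lborel)"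
proof -
  have "(\<integral>\<^sup>+z. g ((norm (z::complex))\<^sup>2) \<partial>lborel)
      = (\<integral>\<^sup>+s. g s \<partial>distr (lborel :: complex measure) borel (\<lambda>z. (norm z)\<^sup>2))"
    by (simp add: nn_integral_distr)
  also have "\<dots> = (\<integral>\<^sup>+s. ennreal pi * (g s * indicator {0..} s) \<partial>lborel)"
    by (simp add: distr_norm_squared_lborel_complex nn_integral_density mult_ac)
  finally show ?thesis by (simp add: nn_integral_cmult)
qed

lemma sets_gaussian_measure [simp, measurable_cong]: "sets gaussian_measure = sets borel"
  by (simp add: gaussian_measure_def)

lemma space_gaussian_measure [simp]: "space gaussian_measure = UNIV"
  by (simp add: gaussian_measure_def)

lemma nn_integral_gaussian_measure:
  assumes [measurable]: "F \<in> borel_measurable borel"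
  shows "(\<integral>\<^sup>+z. F z \<partial>gaussian_measure) = (\<integral>\<^sup>+z. ennreal (exp (- (norm z)\<^sup>2) / pi) * F z \<partial>lborel)"
  by (simp add: gaussian_measure_def nn_integral_density)

text \<open>Under the Gaussian measure \<open>|z|^2\<close> is exponentially distributed with rate
  1, so the moments are Gamma integrals. The case \<open>m = 0\<close> is the total mass,
  \<open>m = 1\<close> the second moment, and general \<open>m\<close> normalises the
  monomials.\<close>

lemma nn_integral_gaussian_power:
  "(\<integral>\<^sup>+z. ennreal (norm z ^ (2 * m)) \<partial>gaussian_measure) = ennreal (fact m)"
proof -
  have "(\<integral>\<^sup>+z. ennreal (norm z ^ (2 * m)) \<partial>gaussian_measure)
      = (\<integral>\<^sup>+z. ennreal (1 / pi * (((norm (z::complex))\<^sup>2) ^ m * exp (- (norm z)\<^sup>2))) \<partial>lborel)"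
    by (subst nn_integral_gaussian_measure)
       (auto simp: power_mult[symmetric] ennreal_mult'[symmetric] intro!: nn_integral_cong)
  also have "\<dots> = ennreal pi * (\<integral>\<^sup>+s. ennreal (1 / pi * (s ^ m * exp (- s))) * indicator {0..} s \<partial>lborel)"
    by (rule nn_integral_lborel_norm_squared[where g = "\<lambda>s. ennreal (1 / pi * (s ^ m * exp (- s)))"]) measurable
  also have "(\<integral>\<^sup>+s. ennreal (1 / pi * (s ^ m * exp (- s))) * indicator {0..} s \<partial>lborel)
      = (\<integral>\<^sup>+s. ennreal (1 / pi) * (ennreal (s ^ m * exp (- s)) * indicator {0..} s) \<partial>lborel)"
    by (intro nn_integral_cong) (auto simp: ennreal_mult'[symmetric] indicator_def)
  also have "\<dots> = ennreal (1 / pi) * ennreal (fact m)"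
    using nn_intergal_power_times_exp_Ici[of m] by (simp add: nn_integral_cmult)
  finally show ?thesis by (simp add: ennreal_mult'[symmetric])
qed

lemma prob_space_gaussian_measure: "prob_space gaussian_measure"
  using nn_integral_gaussian_power[of 0] by (intro prob_spaceI) simp

interpretation gaussian: prob_space gaussian_measure
  by (rule prob_space_gaussian_measure)

interpretation gaussian_pair: pair_prob_space gaussian_measure gaussian_measure ..

lemma distr_gaussian_rotate:
  assumes "norm u = 1"
  shows "distr gaussian_measure borel ((*) u) = gaussian_measure"
proof (rule measure_eqI)
  fix A assume "A \<in> sets (distr gaussian_measure borel ((*) u))"
  then have [measurable]: "A \<in> sets borel" by simp
  let ?F = "\<lambda>z. ennreal (exp (- (norm z)\<^sup>2) / pi) * indicator A z"
  have "emeasure (distr gaussian_measure borel ((*) u)) A = (\<integral>\<^sup>+z. indicator A (u * z) \<partial>gaussian_measure)"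
  proof -
    have "emeasure (distr gaussian_measure borel ((*) u)) A
        = (\<integral>\<^sup>+z. indicator A z \<partial>distr gaussian_measure borel ((*) u))"
      by simp
    then show ?thesis by (simp only:) (subst nn_integral_distr, auto)
  qed
  also have "\<dots> = (\<integral>\<^sup>+z. ?F (u * z) \<partial>lborel)"
    using assms by (simp add: nn_integral_gaussian_measure norm_mult)
  also have "\<dots> = (\<integral>\<^sup>+z. ?F z \<partial>lborel)"
    by (rule nn_integral_lborel_rotate) (use assms in auto)
  also have "\<dots> = emeasure gaussian_measure A"
    by (simp add: gaussian_measure_def emeasure_density)
  finally show "emeasure (distr gaussian_measure borel ((*) u)) A = emeasure gaussian_measure A" .
qed simp

lemma exists_root_of_minus_one:
  assumes "m \<noteq> (0::int)"
  obtains u :: complex where "norm u = 1" "u powi m = -1"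
proof
  show "norm (cis (pi / real_of_int m)) = 1" by simp
  show "cis (pi / real_of_int m) powi m = -1"
    using assms by (simp add: cis_power_int)
qed

text \<open>Rotate by some \<open>u\<close> with \<open>u powi m = -1\<close>.\<close>

lemma gaussian_integral_angular_zero:
  fixes F :: "complex \<Rightarrow> complex"
  assumes [measurable]: "F \<in> borel_measurable borel" and m: "m \<noteq> (0::int)"
    and F: "\<And>u z. norm u = 1 \<Longrightarrow> F (u * z) = u powi m * F z"
  shows "(\<integral>z. F z \<partial>gaussian_measure) = 0"
proof -
  obtain u :: complex where u: "norm u = 1" "u powi m = -1"
    using exists_root_of_minus_one[OF m] .
  have "(\<integral>z. F z \<partial>gaussian_measure) = (\<integral>z. F z \<partial>distr gaussian_measure borel ((*) u))"
    by (simp add: distr_gaussian_rotate u)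
  also have "\<dots> = (\<integral>z. F (u * z) \<partial>gaussian_measure)"
    by (simp add: integral_distr)
  also have "\<dots> = - (\<integral>z. F z \<partial>gaussian_measure)"
    by (simp add: F u)
  finally show ?thesis by (simp add: eq_neg_iff_add_eq_0)
qed

section \<open>Counting measures of point sets\<close>

lemma sets_pts_measure [simp, measurable_cong]: "sets (pts_measure X) = sets borel"
  by (simp add: pts_measure_def)

lemma space_pts_measure [simp]: "space (pts_measure X) = UNIV"
  by (simp add: pts_measure_def)

lemma nn_integral_pts_measure:
  assumes "f \<in> borel_measurable borel"
  shows "(\<integral>\<^sup>+z. f z \<partial>pts_measure X) = (\<integral>\<^sup>+z. f z \<partial>count_space X)"
  unfolding pts_measure_def using assms by (subst nn_integral_distr) auto

lemma emeasure_pts_measure: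
  assumes "A \<in> sets borel"
  shows "emeasure (pts_measure X) A = emeasure (count_space X) (X \<inter> A)"
  using assms by (simp add: pts_measure_def emeasure_distr Int_commute)

lemma emeasure_pts_measure_finite:
  assumes "A \<in> sets borel" "finite (X \<inter> A)"
  shows "emeasure (pts_measure X) A = ennreal (real (card (X \<inter> A)))"
  using assms by (simp add: emeasure_pts_measure ennreal_of_nat_eq_real_of_nat)

lemma nn_integral_pts_measure_finite:
  assumes f: "f \<in> borel_measurable borel" and A: "finite (X \<inter> A)"
    and supp: "\<And>z. z \<notin> A \<Longrightarrow> f z = 0"
  shows "(\<integral>\<^sup>+z. f z \<partial>pts_measure X) = (\<Sum>z\<in>X \<inter> A. f z)"
proof -
  have fin: "finite {z \<in> X. f z > 0}"
    by (rule finite_subset[OF _ A]) (use supp in force)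
  have "(\<integral>\<^sup>+z. f z \<partial>pts_measure X) = (\<Sum>z | z \<in> X \<and> f z > 0. f z)"
    by (simp add: nn_integral_pts_measure[OF f] nn_integral_count_space[OF fin])
  also have "\<dots> = (\<Sum>z\<in>X \<inter> A. f z)"
    by (rule sum.mono_neutral_left[OF A]) (use supp in \<open>force+\<close>)
  finally show ?thesis .
qed

lemma integral_pts_measure_finite:
  fixes f :: "complex \<Rightarrow> 'b::{banach, second_countable_topology}"
  assumes f: "f \<in> borel_measurable borel" and A: "finite (X \<inter> A)"
    and supp: "\<And>z. z \<notin> A \<Longrightarrow> f z = 0"
  shows "(\<integral>z. f z \<partial>pts_measure X) = (\<Sum>z\<in>X \<inter> A. f z)"
proof -
  have fin: "finite {z \<in> X. f z \<noteq> 0}"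
    by (rule finite_subset[OF _ A]) (use supp in force)
  have "(\<integral>z. f z \<partial>pts_measure X) = (\<integral>z. f z \<partial>count_space X)"
    unfolding pts_measure_def using f by (subst integral_distr) auto
  also have "\<dots> = (\<Sum>z | z \<in> X \<and> f z \<noteq> 0. f z)"
    by (rule lebesgue_integral_count_space_finite_support[OF fin])
  also have "\<dots> = (\<Sum>z\<in>X \<inter> A. f z)"
    by (rule sum.mono_neutral_left[OF A]) (use supp in \<open>force+\<close>)
  finally show ?thesis .
qed

lemma point_process_finite:
  "point_process M X \<Longrightarrow> x \<in> space M \<Longrightarrow> bounded B \<Longrightarrow> finite (X x \<inter> B)"
  by (simp add: point_process_def)

lemma measurable_emeasure_pts_measure:
  "point_process M X \<Longrightarrow> A \<in> sets borel \<Longrightarrow> (\<lambda>x. emeasure (pts_measure (X x)) A) \<in> borel_measurable M"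
  by (simp add: point_process_def)

text \<open>A point process is only required to have measurable counts of Borel sets; linear
  combinations and monotone limits extend this to all non-negative integrands.\<close>

lemma measurable_nn_integral_pts_measure:
  assumes X: "point_process M X" and f: "f \<in> borel_measurable borel"
  shows "(\<lambda>x. \<integral>\<^sup>+z. f z \<partial>pts_measure (X x)) \<in> borel_measurable M"
  using f
proof (induction rule: borel_measurable_induct)
  case (cong f g)
  then show ?case by (auto cong: nn_integral_cong)
next
  case (set A)
  then show ?case by (simp add: measurable_emeasure_pts_measure[OF X])
next
  case (mult u c)
  then show ?case by (simp add: nn_integral_cmult)
next
  case (add u v)
  then show ?case by (simp add: nn_integral_add)
next
  case (seq U)
  have "(\<integral>\<^sup>+z. (SUP i. U i) z \<partial>pts_measure (X x)) = (SUP i. \<integral>\<^sup>+z. U i z \<partial>pts_measure (X x))" for x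
    unfolding SUP_apply using seq by (intro nn_integral_monotone_convergence_SUP) auto
  then show ?case using seq by simp
qed

text \<open>A bounded support meets only finitely many points, so the integral is a difference of
  two finite non-negative ones, each of them measurable.\<close>

lemma measurable_integral_pts_measure_real:
  fixes f :: "complex \<Rightarrow> real"
  assumes X: "point_process M X" and f [measurable]: "f \<in> borel_measurable borel"
    and A: "bounded A" "\<And>z. z \<notin> A \<Longrightarrow> f z = 0"
  shows "(\<lambda>x. \<integral>z. f z \<partial>pts_measure (X x)) \<in> borel_measurable M"
proof -
  have *: "(\<integral>z. f z \<partial>pts_measure (X x)) =
      enn2real (\<integral>\<^sup>+z. ennreal (f z) \<partial>pts_measure (X x)) - enn2real (\<integral>\<^sup>+z. ennreal (- f z) \<partial>pts_measure (X x))"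
    if "x \<in> space M" for x
  proof -
    have fin: "finite (X x \<inter> A)" using point_process_finite[OF X that A(1)] .
    have integ: "integrable (pts_measure (X x)) f"
    proof (rule integrableI_bounded)
      show "(\<integral>\<^sup>+z. ennreal (norm (f z)) \<partial>pts_measure (X x)) < \<infinity>"
        using fin A(2) by (subst nn_integral_pts_measure_finite[where A = A]) auto
    qed simp
    show ?thesis by (rule real_lebesgue_integral_def[OF integ])
  qed
  show ?thesis
    by (subst measurable_cong[OF *]) (use measurable_nn_integral_pts_measure[OF X] in auto)
qed

lemma measurable_integral_pts_measure:
  fixes f :: "complex \<Rightarrow> complex"
  assumes X: "point_process M X" and f [measurable]: "f \<in> borel_measurable borel"
    and A: "bounded A" "\<And>z. z \<notin> A \<Longrightarrow> f z = 0"
  shows "(\<lambda>x. \<integral>z. f z \<partial>pts_measure (X x)) \<in> borel_measurable M"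
proof -
  have *: "(\<integral>z. f z \<partial>pts_measure (X x)) =
      Complex (\<integral>z. Re (f z) \<partial>pts_measure (X x)) (\<integral>z. Im (f z) \<partial>pts_measure (X x))"
    if "x \<in> space M" for x
  proof -
    have fin: "finite (X x \<inter> A)" using point_process_finite[OF X that A(1)] .
    show ?thesis
      using fin A(2) by (simp add: integral_pts_measure_finite[where A = A] complex_eq_iff)
  qed
  show ?thesis
    unfolding borel_measurable_complex_iff
    by (subst (1 2) measurable_cong[OF arg_cong[OF *]])
       (use A in \<open>auto intro!: measurable_integral_pts_measure_real[OF X]\<close>)
qed

section \<open>Determinantal processes with Gaussian reference measure\<close>

lemma det_2x2:
  fixes f :: "nat \<times> nat \<Rightarrow> complex"
  shows "Determinant.det (mat 2 2 f) = f (0, 0) * f (1, 1) - f (0, 1) * f (1, 0)"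
proof -
  have "Determinant.det (mat 2 2 f) = (\<Sum>i<2. mat 2 2 f $$ (i, 0) * cofactor (mat 2 2 f) i 0)"
    by (rule laplace_expansion_column) auto
  also have "\<dots> = f (0, 0) * f (1, 1) - f (1, 0) * f (0, 1)"
    by (simp add: numeral_2_eq_2 cofactor_def mat_delete_def det_single)
  finally show ?thesis by simp
qed

text \<open>The common interface of the Ginibre kernels and their limit. \<open>K_diag_le\<close>
  compares the intensity with that of the limit, whose exponential exactly cancels the Gaussian
  density; \<open>K_Cauchy_Schwarz\<close> says that the 2 by 2 determinants are
  non-negative.\<close>

locale gaussian_kernel =
  fixes K :: "complex \<Rightarrow> complex \<Rightarrow> complex"
  assumes K_measurable: "case_prod K \<in> borel_measurable (borel \<Otimes>\<^sub>M borel)"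
    and K_hermitian: "K w z = cnj (K z w)"
    and K_diag_nonneg: "0 \<le> Re (K z z)"
    and K_diag_le: "Re (K z z) \<le> exp ((norm z)\<^sup>2)"
    and K_Cauchy_Schwarz: "(norm (K z w))\<^sup>2 \<le> Re (K z z) * Re (K w w)"
begin

definition intensity :: "complex \<Rightarrow> real" where
  "intensity z = Re (K z z)"

text \<open>The 2 by 2 determinant of the kernel, that is, the two-point intensity with respect to
  the product Gaussian measure.\<close>

definition pair_intensity :: "complex \<times> complex \<Rightarrow> real" where
  "pair_intensity p = intensity (fst p) * intensity (snd p) - (norm (K (fst p) (snd p)))\<^sup>2"

lemma K_measurable' [measurable (raw)]:
  assumes [measurable]: "f \<in> borel_measurable N" "g \<in> borel_measurable N"
  shows "(\<lambda>x. K (f x) (g x)) \<in> borel_measurable N"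
  using measurable_compose[OF measurable_Pair[OF assms] K_measurable] by simp

lemma intensity_measurable [measurable]: "intensity \<in> borel_measurable borel"
  unfolding intensity_def by measurable

lemma pair_intensity_measurable [measurable]: "pair_intensity \<in> borel_measurable (borel \<Otimes>\<^sub>M borel)"
  unfolding pair_intensity_def by measurable

lemma intensity_nonneg: "0 \<le> intensity z"
  by (simp add: intensity_def K_diag_nonneg)

lemma intensity_le: "intensity z \<le> exp ((norm z)\<^sup>2)"
  by (simp add: intensity_def K_diag_le)

lemma pair_intensity_nonneg: "0 \<le> pair_intensity p"
  by (simp add: pair_intensity_def intensity_def K_Cauchy_Schwarz)

lemma K_diag: "K z z = of_real (intensity z)"
  using K_hermitian[of z z] by (simp add: intensity_def complex_eq_iff)

text \<open>Repulsion at coinciding points. It allows the restriction \<open>z \<noteq> w\<close> to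
  be dropped under the double integral.\<close>

lemma pair_intensity_diag: "pair_intensity (z, z) = 0"
  by (simp add: pair_intensity_def K_diag power2_eq_square)

lemma intensity_le_cball: "z \<in> cball 0 R \<Longrightarrow> intensity z \<le> exp (R\<^sup>2)"
  by (rule order_trans[OF intensity_le]) (auto intro!: power_mono)

lemma pair_intensity_le_cball:
  assumes "p \<in> cball 0 R \<times> cball 0 R"
  shows "pair_intensity p \<le> exp (R\<^sup>2) * exp (R\<^sup>2)"
proof -
  have "intensity (fst p) * intensity (snd p) \<le> exp (R\<^sup>2) * exp (R\<^sup>2)"
    using assms by (intro mult_mono intensity_le_cball) (auto simp: intensity_nonneg)
  then show ?thesis
    unfolding pair_intensity_def using zero_le_power2[of "norm (K (fst p) (snd p))"] by linarith
qed

text \<open>The bound \<open>exp (|z|^2)\<close> cancels the Gaussian density and leaves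
  \<open>1 / pi\<close>, so mean counts are controlled by area alone.\<close>

lemma nn_integral_intensity_le:
  assumes [measurable]: "A \<in> sets borel"
  shows "(\<integral>\<^sup>+z\<in>A. ennreal (intensity z) \<partial>gaussian_measure) \<le> ennreal (1 / pi) * emeasure lborel A"
proof -
  have "(\<integral>\<^sup>+z\<in>A. ennreal (intensity z) \<partial>gaussian_measure)
      \<le> (\<integral>\<^sup>+z. ennreal (1 / pi) * indicator A z \<partial>lborel)"
  proof (subst nn_integral_gaussian_measure, measurable, rule nn_integral_mono)
    fix z :: complex
    have "exp (- (norm z)\<^sup>2) / pi * intensity z \<le> exp (- (norm z)\<^sup>2) / pi * exp ((norm z)\<^sup>2)"
      by (intro mult_left_mono intensity_le) auto
    also have "\<dots> = 1 / pi"
      by (simp add: exp_minus field_simps)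
    finally have "ennreal (exp (- (norm z)\<^sup>2) / pi) * ennreal (intensity z) \<le> ennreal (1 / pi)"
      by (simp add: ennreal_mult'[symmetric] intensity_nonneg ennreal_leI)
    then show "ennreal (exp (- (norm z)\<^sup>2) / pi) * (ennreal (intensity z) * indicator A z)
        \<le> ennreal (1 / pi) * indicator A z"
      by (auto simp: indicator_def)
  qed
  then show ?thesis by (simp add: nn_integral_cmult_indicator)
qed

end

locale gaussian_determinantal = gaussian_kernel K + determinantal: prob_space M
  for M :: "'a measure" and X :: "'a \<Rightarrow> complex set" and K :: "complex \<Rightarrow> complex \<Rightarrow> complex" +
  assumes determinantal: "determinantal_process M X gaussian_measure K"
begin

lemma process: "point_process M X"
  using determinantal by (simp add: determinantal_process_def)

lemma intensities:
  assumes "\<And>i. i < k \<Longrightarrow> A i \<in> sets borel" "disjoint_family_on A {..<k}"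
  shows "(\<integral>\<^sup>+x. (\<Prod>i<k. emeasure (pts_measure (X x)) (A i)) \<partial>M) =
        (\<integral>\<^sup>+z. ennreal (Re (Determinant.det (mat k k (\<lambda>(i, j). K (z i) (z j)))))
             * indicator (Pi\<^sub>E {..<k} A) z \<partial>(Pi\<^sub>M {..<k} (\<lambda>_. gaussian_measure)))"
  using determinantal assms by (simp add: determinantal_process_def)

interpretation gaussian_product: product_sigma_finite "\<lambda>_. gaussian_measure"
  by standard

lemma first_intensity:
  assumes [measurable]: "A \<in> sets borel"
  shows "(\<integral>\<^sup>+x. emeasure (pts_measure (X x)) A \<partial>M) = (\<integral>\<^sup>+z\<in>A. ennreal (intensity z) \<partial>gaussian_measure)"
proof -
  have eq: "{..<1} = {0::nat}" by auto
  have "(\<integral>\<^sup>+x. emeasure (pts_measure (X x)) A \<partial>M) =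
        (\<integral>\<^sup>+z. ennreal (Re (Determinant.det (mat 1 1 (\<lambda>(i, j). K (z i) (z j)))))
             * indicator (Pi\<^sub>E {..<1} (\<lambda>_. A)) z \<partial>(Pi\<^sub>M {..<1} (\<lambda>_. gaussian_measure)))"
    using intensities[of 1 "\<lambda>_. A"] by (simp add: disjoint_family_on_def)
  also have "\<dots> = (\<integral>\<^sup>+z. ennreal (intensity (z 0)) * indicator A (z 0) \<partial>(Pi\<^sub>M {0::nat} (\<lambda>_. gaussian_measure)))"
    unfolding eq
    by (intro nn_integral_cong)
       (auto simp: det_single intensity_def indicator_def space_PiM PiE_iff)
  also have "\<dots> = (\<integral>\<^sup>+z\<in>A. ennreal (intensity z) \<partial>gaussian_measure)"
    by (rule gaussian_product.product_nn_integral_singleton[where f = "\<lambda>z. ennreal (intensity z) * indicator A z"])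
       measurable
  finally show ?thesis .
qed

lemma second_intensity:
  assumes [measurable]: "A \<in> sets borel" "B \<in> sets borel" and disj: "A \<inter> B = {}"
  shows "(\<integral>\<^sup>+x. emeasure (pts_measure (X x)) A * emeasure (pts_measure (X x)) B \<partial>M)
    = (\<integral>\<^sup>+p\<in>A \<times> B. ennreal (pair_intensity p) \<partial>(gaussian_measure \<Otimes>\<^sub>M gaussian_measure))"
proof -
  define F where "F = (\<lambda>i::nat. if i = 0 then A else B)"
  have eq: "{..<2} = {0::nat, 1}" by auto
  have "(\<integral>\<^sup>+x. emeasure (pts_measure (X x)) A * emeasure (pts_measure (X x)) B \<partial>M) =
        (\<integral>\<^sup>+x. (\<Prod>i<2. emeasure (pts_measure (X x)) (F i)) \<partial>M)"
    by (simp add: eq F_def)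
  also have "\<dots> = (\<integral>\<^sup>+z. ennreal (Re (Determinant.det (mat 2 2 (\<lambda>(i, j). K (z i) (z j)))))
             * indicator (Pi\<^sub>E {..<2} F) z \<partial>(Pi\<^sub>M {..<2} (\<lambda>_. gaussian_measure)))"
    by (rule intensities) (use disj in \<open>auto simp: F_def disjoint_family_on_def\<close>)
  also have "\<dots> = (\<integral>\<^sup>+z. ennreal (pair_intensity (z 0, z 1)) * indicator (A \<times> B) (z 0, z 1)
      \<partial>(Pi\<^sub>M {0::nat, 1} (\<lambda>_. gaussian_measure)))"
    unfolding eq
  proof (intro nn_integral_cong)
    fix z :: "nat \<Rightarrow> complex" assume z: "z \<in> space (Pi\<^sub>M {0::nat, 1} (\<lambda>_. gaussian_measure))"
    \<comment> \<open>Hermitian symmetry turns the product of the off-diagonal entries into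
      \<open>|K(z,w)|^2\<close>.\<close>
    have "K (z 0) (z 1) * K (z 1) (z 0) = of_real ((norm (K (z 0) (z 1)))\<^sup>2)"
      unfolding K_hermitian[of "z 1" "z 0"] by (rule complex_norm_square[symmetric])
    then have "Re (Determinant.det (mat 2 2 (\<lambda>(i, j). K (z i) (z j)))) = pair_intensity (z 0, z 1)"
      by (simp add: det_2x2 pair_intensity_def K_diag)
    moreover have "z \<in> Pi\<^sub>E {0, 1} F \<longleftrightarrow> (z 0, z 1) \<in> A \<times> B"
      using z by (auto simp: F_def space_PiM PiE_iff)
    ultimately show "ennreal (Re (Determinant.det (mat 2 2 (\<lambda>(i, j). K (z i) (z j))))) * indicator (Pi\<^sub>E {0, 1} F) z
        = ennreal (pair_intensity (z 0, z 1)) * indicator (A \<times> B) (z 0, z 1)"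
      by (auto simp: indicator_def)
  qed
  also have "\<dots> = (\<integral>\<^sup>+p\<in>A \<times> B. ennreal (pair_intensity p) \<partial>(gaussian_measure \<Otimes>\<^sub>M gaussian_measure))"
    by (subst gaussian_product.product_nn_integral_pair[where f =
          "\<lambda>z w. ennreal (pair_intensity (z, w)) * indicator (A \<times> B) (z, w)"]) auto
  finally show ?thesis .
qed

text \<open>The one-point identity for sets, extended to functions by linearity and monotone
  convergence.\<close>

lemma Campbell:
  assumes "f \<in> borel_measurable borel"
  shows "(\<integral>\<^sup>+x. (\<integral>\<^sup>+z. f z \<partial>pts_measure (X x)) \<partial>M) = (\<integral>\<^sup>+z. f z * ennreal (intensity z) \<partial>gaussian_measure)"
  using assms
proof (induction rule: borel_measurable_induct)
  case (cong f g)
  then show ?case by (auto cong: nn_integral_cong)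
next
  case (set A)
  then show ?case by (simp add: first_intensity mult.commute)
next
  case (mult u c)
  then show ?case
    by (simp add: nn_integral_cmult measurable_nn_integral_pts_measure[OF process] mult.assoc)
next
  case (add u v)
  then show ?case
    by (simp add: nn_integral_add measurable_nn_integral_pts_measure[OF process] distrib_right)
next
  case (seq U)
  have [measurable]: "U i \<in> borel_measurable borel" for i using seq by simp
  have 1: "(\<integral>\<^sup>+z. (SUP i. U i) z \<partial>pts_measure Y) = (SUP i. \<integral>\<^sup>+z. U i z \<partial>pts_measure Y)" for Y
    unfolding SUP_apply using seq by (intro nn_integral_monotone_convergence_SUP) auto
  have "(\<integral>\<^sup>+x. (\<integral>\<^sup>+z. (SUP i. U i) z \<partial>pts_measure (X x)) \<partial>M)
      = (SUP i. \<integral>\<^sup>+x. (\<integral>\<^sup>+z. U i z \<partial>pts_measure (X x)) \<partial>M)"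
    unfolding 1 using seq
    by (intro nn_integral_monotone_convergence_SUP measurable_nn_integral_pts_measure[OF process])
       (auto simp: incseq_def le_fun_def intro!: nn_integral_mono)
  also have "\<dots> = (SUP i. \<integral>\<^sup>+z. U i z * ennreal (intensity z) \<partial>gaussian_measure)"
    using seq by simp
  also have "\<dots> = (\<integral>\<^sup>+z. (SUP i. U i z * ennreal (intensity z)) \<partial>gaussian_measure)"
    using seq by (intro nn_integral_monotone_convergence_SUP[symmetric])
      (auto simp: incseq_def le_fun_def intro!: mult_right_mono)
  also have "\<dots> = (\<integral>\<^sup>+z. (SUP i. U i) z * ennreal (intensity z) \<partial>gaussian_measure)"
    unfolding SUP_apply by (simp add: SUP_mult_right_ennreal)
  finally show ?case .
qed

end

section \<open>Second moments of linear statistics\<close>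

text \<open>Rounding to the lower left corner of a cell in the square lattice of mesh
  \<open>1 / (i + 1)\<close>; \<open>Suc\<close> keeps the mesh meaningful at \<open>i = 0\<close>.
  The cells are the fibres of this map, hence Borel and pairwise disjoint.\<close>

definition grid_round :: "nat \<Rightarrow> complex \<Rightarrow> complex" where
  "grid_round i z = Complex (\<lfloor>real (Suc i) * Re z\<rfloor> / real (Suc i)) (\<lfloor>real (Suc i) * Im z\<rfloor> / real (Suc i))"

lemma grid_round_measurable [measurable]: "grid_round i \<in> borel_measurable borel"
  unfolding grid_round_def borel_measurable_complex_iff by simp

lemma floor_div_error: "\<bar>\<lfloor>real (Suc i) * t\<rfloor> / real (Suc i) - t\<bar> \<le> 1 / real (Suc i)"
proof -
  have "\<lfloor>real (Suc i) * t\<rfloor> / real (Suc i) - t = (\<lfloor>real (Suc i) * t\<rfloor> - real (Suc i) * t) / real (Suc i)"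
    by (simp add: diff_divide_distrib)
  moreover have "\<bar>\<lfloor>real (Suc i) * t\<rfloor> - real (Suc i) * t\<bar> \<le> 1" by linarith
  ultimately show ?thesis by (simp add: abs_divide divide_right_mono)
qed

lemma grid_round_error: "norm (grid_round i z - z) \<le> 2 / real (Suc i)"
proof -
  have "norm (grid_round i z - z) \<le> \<bar>Re (grid_round i z - z)\<bar> + \<bar>Im (grid_round i z - z)\<bar>"
    by (rule cmod_le)
  also have "\<dots> \<le> 1 / real (Suc i) + 1 / real (Suc i)"
    by (rule add_mono) (simp_all add: grid_round_def floor_div_error del: of_nat_Suc)
  finally show ?thesis by simp
qed

lemma grid_round_tendsto: "(\<lambda>i. grid_round i z) \<longlonglongrightarrow> z"
proof (rule LIM_zero_cancel, rule Lim_null_comparison)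
  show "\<forall>\<^sub>F i in sequentially. norm (grid_round i z - z) \<le> 2 / real (Suc i)"
    using grid_round_error by (intro always_eventually) blast
  show "(\<lambda>i. 2 / real (Suc i)) \<longlonglongrightarrow> 0"
    by (intro LIMSEQ_Suc[where f = "\<lambda>i. 2 / real i"] lim_const_over_n)
qed

lemma finite_grid_round:
  assumes "bounded S"
  shows "finite (grid_round i ` S)"
proof -
  obtain R where R: "norm z \<le> R" if "z \<in> S" for z
    using assms by (auto simp: bounded_iff)
  let ?n = "real (Suc i)"
  let ?J = "{- \<lceil>?n * R\<rceil> - 1 .. \<lceil>?n * R\<rceil> + 1}"
  have "grid_round i ` S \<subseteq> (\<lambda>(a, b). Complex (of_int a / ?n) (of_int b / ?n)) ` (?J \<times> ?J)"
  proof
    fix p assume "p \<in> grid_round i ` S"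
    then obtain z where z: "z \<in> S" "p = grid_round i z" by auto
    have *: "\<lfloor>?n * t\<rfloor> \<in> ?J" if "\<bar>t\<bar> \<le> R" for t
    proof -
      have "\<bar>?n * t\<bar> \<le> ?n * R"
        using that by (simp add: abs_mult mult_left_mono del: of_nat_Suc)
      then show ?thesis unfolding atLeastAtMost_iff by linarith
    qed
    have "\<lfloor>?n * Re z\<rfloor> \<in> ?J" "\<lfloor>?n * Im z\<rfloor> \<in> ?J"
      using R[OF z(1)] abs_Re_le_cmod[of z] abs_Im_le_cmod[of z] by (intro *; linarith)+
    then show "p \<in> (\<lambda>(a, b). Complex (of_int a / ?n) (of_int b / ?n)) ` (?J \<times> ?J)"
      unfolding z(2) grid_round_def by (intro image_eqI[where x = "(\<lfloor>?n * Re z\<rfloor>, \<lfloor>?n * Im z\<rfloor>)"]) auto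
  qed
  then show ?thesis by (rule finite_subset) auto
qed

text \<open>The off-diagonal indicator is discontinuous, yet distinct points eventually fall into
  distinct cells while equal points always share one, so the convergence holds everywhere.\<close>

lemma tendsto_grid_round_off_diagonal:
  fixes G :: "complex \<Rightarrow> complex \<Rightarrow> complex"
  assumes "continuous_on UNIV (case_prod G)"
  shows "(\<lambda>i. if grid_round i z \<noteq> grid_round i w then G (grid_round i z) (grid_round i w) else 0)
           \<longlonglongrightarrow> (if z \<noteq> w then G z w else 0)"
proof (cases "z = w")
  case False
  have "(\<lambda>i. grid_round i z - grid_round i w) \<longlonglongrightarrow> z - w"
    by (intro tendsto_intros grid_round_tendsto)
  then have "\<forall>\<^sub>F i in sequentially. grid_round i z - grid_round i w \<noteq> 0"
    using False by (intro tendsto_imp_eventually_ne) auto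
  then have ev: "\<forall>\<^sub>F i in sequentially. G (grid_round i z) (grid_round i w) =
      (if grid_round i z \<noteq> grid_round i w then G (grid_round i z) (grid_round i w) else 0)"
    by eventually_elim auto
  have "isCont (case_prod G) (z, w)"
    using assms by (simp add: continuous_on_eq_continuous_at)
  then have "(\<lambda>i. case_prod G (grid_round i z, grid_round i w)) \<longlonglongrightarrow> case_prod G (z, w)"
    by (rule isCont_tendsto_compose) (intro tendsto_intros grid_round_tendsto)
  then show ?thesis
    using False tendsto_cong[OF ev] by simp
qed simp

section \<open>Expectations of grid-rounded pair sums\<close>

context gaussian_determinantal
begin

lemma card_measurable:
  assumes "A \<in> sets borel" "bounded A"
  shows "(\<lambda>x. real (card (X x \<inter> A))) \<in> borel_measurable M"
proof -
  have "(\<lambda>x. enn2real (emeasure (pts_measure (X x)) A)) \<in> borel_measurable M"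
    by (intro measurable_compose[OF measurable_emeasure_pts_measure[OF process assms(1)]]) simp
  moreover have "enn2real (emeasure (pts_measure (X x)) A) = real (card (X x \<inter> A))" if "x \<in> space M" for x
    using point_process_finite[OF process that assms(2)] assms(1) by (simp add: emeasure_pts_measure_finite)
  ultimately show ?thesis by (simp cong: measurable_cong)
qed

lemma pair_intensity_integrable:
  fixes h :: "complex \<times> complex \<Rightarrow> complex"
  assumes [measurable]: "h \<in> borel_measurable (borel \<Otimes>\<^sub>M borel)" and B: "\<And>p. norm (h p) \<le> B"
    and [measurable]: "S \<in> sets borel" and R: "S \<subseteq> cball 0 R"
  shows "integrable (gaussian_measure \<Otimes>\<^sub>M gaussian_measure)
    (\<lambda>p. indicator (S \<times> S) p * h p * of_real (pair_intensity p))"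
proof (rule gaussian_pair.integrable_const_bound[where B = "B * (exp (R\<^sup>2) * exp (R\<^sup>2))"])
  have B0: "0 \<le> B" using B[of undefined] norm_ge_zero order_trans by blast
  show "AE p in gaussian_measure \<Otimes>\<^sub>M gaussian_measure.
    norm (indicator (S \<times> S) p * h p * of_real (pair_intensity p)) \<le> B * (exp (R\<^sup>2) * exp (R\<^sup>2))"
  proof (rule AE_I2)
    fix p
    show "norm (indicator (S \<times> S) p * h p * of_real (pair_intensity p)) \<le> B * (exp (R\<^sup>2) * exp (R\<^sup>2))"
    proof (cases "p \<in> S \<times> S")
      case True
      then have "p \<in> cball 0 R \<times> cball 0 R" using R by auto
      then show ?thesis
        using True B[of p] B0 pair_intensity_le_cball[of p R] pair_intensity_nonneg[of p]
        by (simp add: norm_mult mult_mono)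
    qed (use B0 in auto)
  qed
qed measurable

text \<open>The two-point identity for disjoint sets, carried over from extended non-negative to
  Bochner integrals; the bounded window makes both sides finite.\<close>

lemma pair_count:
  assumes [measurable]: "A \<in> sets borel" "B \<in> sets borel" and disj: "A \<inter> B = {}"
    and bdd: "A \<subseteq> cball 0 R" "B \<subseteq> cball 0 R"
  shows "integrable M (\<lambda>x. real (card (X x \<inter> A)) * real (card (X x \<inter> B)))"
    and "(\<integral>x. real (card (X x \<inter> A)) * real (card (X x \<inter> B)) \<partial>M)
      = (\<integral>p. indicator (A \<times> B) p * pair_intensity p \<partial>(gaussian_measure \<Otimes>\<^sub>M gaussian_measure))"
proof -
  have bd: "bounded A" "bounded B" using bdd bounded_cball bounded_subset by blast+
  note [measurable] = card_measurable[OF assms(1) bd(1)] card_measurable[OF assms(2) bd(2)]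
  let ?I = "\<integral>p. indicator (A \<times> B) p * pair_intensity p \<partial>(gaussian_measure \<Otimes>\<^sub>M gaussian_measure)"
  have int: "integrable (gaussian_measure \<Otimes>\<^sub>M gaussian_measure) (\<lambda>p. indicator (A \<times> B) p * pair_intensity p)"
  proof (rule gaussian_pair.integrable_const_bound[where B = "exp (R\<^sup>2) * exp (R\<^sup>2)"])
    show "AE p in gaussian_measure \<Otimes>\<^sub>M gaussian_measure.
        norm (indicator (A \<times> B) p * pair_intensity p) \<le> exp (R\<^sup>2) * exp (R\<^sup>2)"
      using pair_intensity_le_cball[of _ R] bdd pair_intensity_nonneg
      by (intro AE_I2) (fastforce simp: indicator_def)
  qed measurable
  have "(\<integral>\<^sup>+x. ennreal (real (card (X x \<inter> A)) * real (card (X x \<inter> B))) \<partial>M)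
      = (\<integral>\<^sup>+x. emeasure (pts_measure (X x)) A * emeasure (pts_measure (X x)) B \<partial>M)"
    using point_process_finite[OF process _ bd(1)] point_process_finite[OF process _ bd(2)]
    by (intro nn_integral_cong) (simp add: emeasure_pts_measure_finite ennreal_mult')
  also have "\<dots> = (\<integral>\<^sup>+p. ennreal (indicator (A \<times> B) p * pair_intensity p) \<partial>(gaussian_measure \<Otimes>\<^sub>M gaussian_measure))"
    by (subst second_intensity[OF assms(1-3)]) (auto intro!: nn_integral_cong simp: indicator_def)
  also have "\<dots> = ennreal ?I"
    by (rule nn_integral_eq_integral[OF int]) (simp add: pair_intensity_nonneg)
  finally have eq: "(\<integral>\<^sup>+x. ennreal (real (card (X x \<inter> A)) * real (card (X x \<inter> B))) \<partial>M) = ennreal ?I" .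
  show 1: "integrable M (\<lambda>x. real (card (X x \<inter> A)) * real (card (X x \<inter> B)))"
    by (rule integrableI_nonneg) (auto simp: eq)
  show "(\<integral>x. real (card (X x \<inter> A)) * real (card (X x \<inter> B)) \<partial>M) = ?I"
    by (rule integral_eq_nn_integral[THEN trans])
       (auto simp: eq pair_intensity_nonneg intro!: integral_nonneg_AE)
qed

text \<open>Grouping points by cell writes the rounded sum as a finite combination of products of
  counts in two cells. Pairs within one cell carry weight 0, so only disjoint cells occur and the
  prescribed intensities apply.\<close>

lemma rounded_pair_sum:
  fixes G :: "complex \<Rightarrow> complex \<Rightarrow> complex"
  assumes S [measurable]: "S \<in> sets borel" and R: "S \<subseteq> cball 0 R"
  shows "integrable M (\<lambda>x. \<Sum>z\<in>X x \<inter> S. \<Sum>w\<in>X x \<inter> S.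
            if grid_round i z \<noteq> grid_round i w then G (grid_round i z) (grid_round i w) else 0)" (is "integrable M ?T")
    and "(\<integral>x. (\<Sum>z\<in>X x \<inter> S. \<Sum>w\<in>X x \<inter> S.
            if grid_round i z \<noteq> grid_round i w then G (grid_round i z) (grid_round i w) else 0) \<partial>M)
      = (\<integral>p. indicator (S \<times> S) p *
           (if grid_round i (fst p) \<noteq> grid_round i (snd p)
            then G (grid_round i (fst p)) (grid_round i (snd p)) else 0) *
           of_real (pair_intensity p) \<partial>(gaussian_measure \<Otimes>\<^sub>M gaussian_measure))" (is "_ = (\<integral>p. ?h p \<partial>_)")
proof -
  let ?I = "grid_round i ` S"
  define Q where "Q p = S \<inter> grid_round i -` {p}" for p
  define H where "H p q = (if p \<noteq> q then G p q else 0)" for p q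
  have bS: "bounded S" using R bounded_cball bounded_subset by blast
  have finI: "finite ?I" by (rule finite_grid_round[OF bS])
  have [measurable]: "grid_round i -` {p} \<in> sets borel" for p
    using measurable_sets[OF grid_round_measurable, of "{p}" i] by simp
  have [measurable]: "Q p \<in> sets borel" for p unfolding Q_def by measurable
  have QR: "Q p \<subseteq> cball 0 R" for p using R by (auto simp: Q_def)
  have fiber: "(\<Sum>z\<in>Y. h (grid_round i z)) = (\<Sum>p\<in>?I. of_nat (card {z \<in> Y. grid_round i z = p}) * h p)"
    if "finite Y" "Y \<subseteq> S" for Y and h :: "complex \<Rightarrow> complex"
  proof -
    have "(\<Sum>z\<in>Y. h (grid_round i z)) = (\<Sum>p\<in>?I. \<Sum>z | z \<in> Y \<and> grid_round i z = p. h (grid_round i z))"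
      by (rule sum.group[symmetric]) (use that finI in auto)
    then show ?thesis by simp
  qed
  have T: "?T x = (\<Sum>p\<in>?I. \<Sum>q\<in>?I. H p q * of_real (real (card (X x \<inter> Q p)) * real (card (X x \<inter> Q q))))"
    if "x \<in> space M" for x
  proof -
    have fin: "finite (X x \<inter> S)" by (rule point_process_finite[OF process that bS])
    have Q: "X x \<inter> Q p = {z \<in> X x. z \<in> S \<and> grid_round i z = p}" for p
      by (auto simp: Q_def)
    have "?T x = (\<Sum>z\<in>X x \<inter> S. \<Sum>w\<in>X x \<inter> S. H (grid_round i z) (grid_round i w))"
      by (simp add: H_def)
    also have "\<dots> = (\<Sum>p\<in>?I. of_nat (card (X x \<inter> Q p)) * (\<Sum>q\<in>?I. of_nat (card (X x \<inter> Q q)) * H p q))"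
      using fiber[of "X x \<inter> S" "\<lambda>p. \<Sum>w\<in>X x \<inter> S. H p (grid_round i w)"]
        fiber[of "X x \<inter> S" "H p" for p] fin
      by (simp add: Q)
    finally show ?thesis by (simp add: sum_distrib_left mult_ac)
  qed
  have int: "integrable M (\<lambda>x. H p q * of_real (real (card (X x \<inter> Q p)) * real (card (X x \<inter> Q q))))"
    and val: "(\<integral>x. H p q * of_real (real (card (X x \<inter> Q p)) * real (card (X x \<inter> Q q))) \<partial>M)
      = (\<integral>w. H p q * of_real (indicator (Q p \<times> Q q) w * pair_intensity w)
          \<partial>(gaussian_measure \<Otimes>\<^sub>M gaussian_measure))" for p q
  proof -
    have "p \<noteq> q \<Longrightarrow> Q p \<inter> Q q = {}" by (auto simp: Q_def)
    note pc = pair_count[OF _ _ this QR QR]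
    show "integrable M (\<lambda>x. H p q * of_real (real (card (X x \<inter> Q p)) * real (card (X x \<inter> Q q))))"
      by (cases "p = q")
         (simp add: H_def, intro integrable_mult_right integrable_of_real pc(1), auto)
    show "(\<integral>x. H p q * of_real (real (card (X x \<inter> Q p)) * real (card (X x \<inter> Q q))) \<partial>M)
      = (\<integral>w. H p q * of_real (indicator (Q p \<times> Q q) w * pair_intensity w)
          \<partial>(gaussian_measure \<Otimes>\<^sub>M gaussian_measure))"
      by (cases "p = q")
         (simp add: H_def, simp only: integral_mult_right_zero integral_complex_of_real, subst pc(2), auto)
  qed
  have int': "integrable (gaussian_measure \<Otimes>\<^sub>M gaussian_measure)
      (\<lambda>w. H p q * of_real (indicator (Q p \<times> Q q) w * pair_intensity w))" for p q
  proof (intro integrable_mult_right integrable_of_real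
      gaussian_pair.integrable_const_bound[where B = "exp (R\<^sup>2) * exp (R\<^sup>2)"] AE_I2)
    show "norm (indicator (Q p \<times> Q q) w * pair_intensity w) \<le> exp (R\<^sup>2) * exp (R\<^sup>2)" for w
      using pair_intensity_le_cball[of w R] QR[of p] QR[of q] pair_intensity_nonneg[of w]
      by (cases "w \<in> Q p \<times> Q q") (auto simp: subset_iff)
  qed measurable
  show "integrable M ?T"
    by (subst Bochner_Integration.integrable_cong[OF refl T]) (assumption, intro Bochner_Integration.integrable_sum int)
  \<comment> \<open>The same grouping on the integral side: exactly one pair of cells contains a
    given point of \<open>S \<times> S\<close>.\<close>
  have h: "?h w = (\<Sum>p\<in>?I. \<Sum>q\<in>?I. H p q * of_real (indicator (Q p \<times> Q q) w * pair_intensity w))" for w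
  proof (cases "w \<in> S \<times> S")
    case True
    have "(\<Sum>p\<in>?I. \<Sum>q\<in>?I. H p q * of_real (indicator (Q p \<times> Q q) w * pair_intensity w))
       = (\<Sum>p\<in>?I. \<Sum>q\<in>?I. if q = grid_round i (snd w) then
            (if p = grid_round i (fst w) then H p q * of_real (pair_intensity w) else 0) else 0)"
      using True by (intro sum.cong refl) (auto simp: Q_def indicator_def mem_Times_iff)
    also have "\<dots> = H (grid_round i (fst w)) (grid_round i (snd w)) * of_real (pair_intensity w)"
      using True finI by (simp add: sum.delta mem_Times_iff)
    finally show ?thesis using True by (simp add: H_def)
  next
    case False
    then have "indicator (Q p \<times> Q q) w = (0::real)" for p q
      by (auto simp: Q_def indicator_def mem_Times_iff)
    then show ?thesis using False by simp
  qed
  show "(\<integral>x. ?T x \<partial>M) = (\<integral>p. ?h p \<partial>(gaussian_measure \<Otimes>\<^sub>M gaussian_measure))"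
  proof -
    have "(\<integral>x. ?T x \<partial>M) = (\<integral>x. (\<Sum>p\<in>?I. \<Sum>q\<in>?I.
        H p q * of_real (real (card (X x \<inter> Q p)) * real (card (X x \<inter> Q q)))) \<partial>M)"
      by (rule Bochner_Integration.integral_cong[OF refl T])
    also have "\<dots> = (\<Sum>p\<in>?I. \<Sum>q\<in>?I.
        \<integral>x. H p q * of_real (real (card (X x \<inter> Q p)) * real (card (X x \<inter> Q q))) \<partial>M)"
      by (subst Bochner_Integration.integral_sum, intro Bochner_Integration.integrable_sum int,
          intro sum.cong refl Bochner_Integration.integral_sum int)
    also have "\<dots> = (\<Sum>p\<in>?I. \<Sum>q\<in>?I. \<integral>w. H p q * of_real (indicator (Q p \<times> Q q) w * pair_intensity w)
        \<partial>(gaussian_measure \<Otimes>\<^sub>M gaussian_measure))"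
      by (intro sum.cong refl val)
    also have "\<dots> = (\<integral>p. ?h p \<partial>(gaussian_measure \<Otimes>\<^sub>M gaussian_measure))"
      unfolding h
      by (subst Bochner_Integration.integral_sum, intro Bochner_Integration.integrable_sum int',
          intro sum.cong refl Bochner_Integration.integral_sum[symmetric] int')
    finally show ?thesis .
  qed
qed

end

section \<open>Square-integrable counts and the second-order formula\<close>

context gaussian_determinantal
begin

text \<open>The weight \<open>G = 1\<close> bootstraps integrability: rounded pair counts have means
  bounded uniformly in the mesh, and Fatou's lemma passes the bound to the limit. Dominated
  convergence is not yet available, as no majorant is known to be integrable.\<close>

lemma nn_integral_off_diagonal_pairs_finite:
  assumes S [measurable]: "S \<in> sets borel" and R: "S \<subseteq> cball 0 R"
  shows "(\<integral>\<^sup>+x. ennreal (\<Sum>z\<in>X x \<inter> S. \<Sum>w\<in>X x \<inter> S. if z \<noteq> w then 1 else 0) \<partial>M) < \<infinity>"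
proof -
  have bS: "bounded S" using R bounded_cball bounded_subset by blast
  define D :: "nat \<Rightarrow> 'a \<Rightarrow> real" where
    "D i x = (\<Sum>z\<in>X x \<inter> S. \<Sum>w\<in>X x \<inter> S. if grid_round i z \<noteq> grid_round i w then 1 else 0)" for i x
  have D: "(\<Sum>z\<in>X x \<inter> S. \<Sum>w\<in>X x \<inter> S. if grid_round i z \<noteq> grid_round i w then 1 else 0) = complex_of_real (D i x)"
    for i x by (simp add: D_def of_real_sum if_distrib[of complex_of_real] cong: if_cong)
  let ?h = "\<lambda>i p. indicator (S \<times> S) p *
      (if grid_round i (fst p) \<noteq> grid_round i (snd p) then 1 else 0) * complex_of_real (pair_intensity p)"
  note rps = rounded_pair_sum[OF S R, where G = "\<lambda>_ _. 1", unfolded D]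
  have Dint: "integrable M (D i)" for i
    using integrable_Re[OF rps(1)[of i]] by simp
  have D0: "0 \<le> D i x" for i x
    by (auto simp: D_def intro!: sum_nonneg)
  let ?C = "exp (R\<^sup>2) * exp (R\<^sup>2)"
  have "(\<integral>x. D i x \<partial>M) \<le> ?C" for i
  proof -
    have "(\<integral>x. D i x \<partial>M) = Re (\<integral>x. complex_of_real (D i x) \<partial>M)"
      by (simp only: integral_complex_of_real Re_complex_of_real)
    also have "\<dots> \<le> norm (\<integral>p. ?h i p \<partial>(gaussian_measure \<Otimes>\<^sub>M gaussian_measure))"
      unfolding rps(2) by (rule complex_Re_le_cmod)
    also have "\<dots> \<le> (\<integral>p. ?C \<partial>(gaussian_measure \<Otimes>\<^sub>M gaussian_measure))"
    proof (rule Bochner_Integration.integral_norm_bound_integral)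
      show "integrable (gaussian_measure \<Otimes>\<^sub>M gaussian_measure) (?h i)"
        by (rule pair_intensity_integrable[where B = 1, OF _ _ S R]) auto
      show "norm (?h i p) \<le> ?C" for p
        using pair_intensity_le_cball[of p R] pair_intensity_nonneg[of p] R
        by (cases "p \<in> S \<times> S") (auto simp: norm_mult subset_iff)
    qed simp
    also have "\<dots> = ?C" by (simp add: gaussian_pair.prob_space)
    finally show ?thesis .
  qed
  then have DC: "(\<integral>\<^sup>+x. ennreal (D i x) \<partial>M) \<le> ennreal ?C" for i
    by (subst nn_integral_eq_integral[OF Dint]) (auto intro: D0 ennreal_leI)
  have lim: "(\<lambda>i. D i x) \<longlonglongrightarrow> (\<Sum>z\<in>X x \<inter> S. \<Sum>w\<in>X x \<inter> S. if z \<noteq> w then 1 else 0)" for x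
  proof -
    have "(\<lambda>i. complex_of_real (D i x)) \<longlonglongrightarrow> (\<Sum>z\<in>X x \<inter> S. \<Sum>w\<in>X x \<inter> S. if z \<noteq> w then 1 else 0)"
      unfolding D[symmetric]
      by (intro tendsto_sum tendsto_grid_round_off_diagonal[where G = "\<lambda>_ _. 1"]) (simp add: case_prod_unfold)
    from tendsto_Re[OF this] show ?thesis
      by (simp add: if_distrib[of Re] cong: if_cong)
  qed
  have "(\<integral>\<^sup>+x. ennreal (\<Sum>z\<in>X x \<inter> S. \<Sum>w\<in>X x \<inter> S. if z \<noteq> w then 1 else 0) \<partial>M)
      = (\<integral>\<^sup>+x. liminf (\<lambda>i. ennreal (D i x)) \<partial>M)"
    by (intro nn_integral_cong lim_imp_Liminf[symmetric] tendsto_ennrealI lim) simp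
  also have "\<dots> \<le> liminf (\<lambda>i. \<integral>\<^sup>+x. ennreal (D i x) \<partial>M)"
    using Dint by (intro nn_integral_liminf) auto
  also have "\<dots> \<le> ennreal ?C"
    by (intro Liminf_le always_eventually allI DC) simp
  also have "\<dots> < \<infinity>" by simp
  finally show ?thesis .
qed

lemma integrable_card:
  assumes S [measurable]: "S \<in> sets borel" and R: "S \<subseteq> cball 0 R"
  shows "integrable M (\<lambda>x. real (card (X x \<inter> S)))"
proof (rule integrableI_nonneg)
  have bS: "bounded S" using R bounded_cball bounded_subset by blast
  show "(\<lambda>x. real (card (X x \<inter> S))) \<in> borel_measurable M"
    by (rule card_measurable[OF S bS])
  have "(\<integral>\<^sup>+x. ennreal (real (card (X x \<inter> S))) \<partial>M) = (\<integral>\<^sup>+x. emeasure (pts_measure (X x)) S \<partial>M)"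
    using point_process_finite[OF process _ bS] by (intro nn_integral_cong) (simp add: emeasure_pts_measure_finite)
  also have "\<dots> \<le> ennreal (1 / pi) * emeasure lborel S"
    unfolding first_intensity[OF S] by (rule nn_integral_intensity_le[OF S])
  also have "\<dots> < \<infinity>"
    using emeasure_bounded_finite[OF bS] by (simp add: ennreal_mult_less_top)
  finally show "(\<integral>\<^sup>+x. ennreal (real (card (X x \<inter> S))) \<partial>M) < \<infinity>" .
qed simp

text \<open>With \<open>N\<close> points in \<open>S\<close>, \<open>N^2 - N\<close> counts ordered
  pairs of distinct points. The resulting \<open>N^2\<close> is the majorant for the passage from
  rounded to true pair sums.\<close>

lemma integrable_card_squared:
  assumes S [measurable]: "S \<in> sets borel" and R: "S \<subseteq> cball 0 R"
  shows "integrable M (\<lambda>x. (real (card (X x \<inter> S)))\<^sup>2)"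
proof -
  have bS: "bounded S" using R bounded_cball bounded_subset by blast
  note [measurable] = card_measurable[OF S bS]
  have off: "(real (card (X x \<inter> S)))\<^sup>2 - real (card (X x \<inter> S)) =
      (\<Sum>z\<in>X x \<inter> S. \<Sum>w\<in>X x \<inter> S. if z \<noteq> w then 1 else 0)" if "x \<in> space M" for x
  proof -
    have fin: "finite (X x \<inter> S)" by (rule point_process_finite[OF process that bS])
    have "(\<Sum>w\<in>X x \<inter> S. if z \<noteq> w then 1 else 0) = real (card (X x \<inter> S)) - 1" if "z \<in> X x \<inter> S" for z
    proof -
      have "(\<Sum>w\<in>X x \<inter> S. if z \<noteq> w then 1 else 0) = (\<Sum>w\<in>X x \<inter> S. 1 - (if z = w then 1 else (0::real)))"
        by (intro sum.cong) auto
      then show ?thesis using fin that by (simp add: sum_subtractf sum.delta')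
    qed
    then have "(\<Sum>z\<in>X x \<inter> S. \<Sum>w\<in>X x \<inter> S. if z \<noteq> w then 1 else 0)
        = (\<Sum>z\<in>X x \<inter> S. real (card (X x \<inter> S)) - 1)"
      by (rule sum.cong[OF refl])
    then show ?thesis by (simp add: power2_eq_square algebra_simps)
  qed
  have "integrable M (\<lambda>x. (real (card (X x \<inter> S)))\<^sup>2 - real (card (X x \<inter> S)))"
  proof (rule integrableI_nonneg)
    show "AE x in M. 0 \<le> (real (card (X x \<inter> S)))\<^sup>2 - real (card (X x \<inter> S))"
      by (rule AE_I2) (simp only: off, auto intro!: sum_nonneg)
    show "(\<integral>\<^sup>+x. ennreal ((real (card (X x \<inter> S)))\<^sup>2 - real (card (X x \<inter> S))) \<partial>M) < \<infinity>"
      using nn_integral_off_diagonal_pairs_finite[OF S R] by (simp only: off cong: nn_integral_cong)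
  qed measurable
  from Bochner_Integration.integrable_add[OF this integrable_card[OF S R]] show ?thesis by simp
qed

text \<open>Only finitely many cells of the grid meet \<open>S\<close>, and distinct cells are disjoint, so the
  prescribed intensities give the expectation of the rounded sum; simplicity of the process makes the
  rounded off-diagonal sum converge to the true one.\<close>

lemma second_order_Campbell:
  fixes G :: "complex \<Rightarrow> complex \<Rightarrow> complex"
  assumes S [measurable]: "S \<in> sets borel" and R: "S \<subseteq> cball 0 R"
    and G: "continuous_on UNIV (case_prod G)" and B: "\<And>z w. norm (G z w) \<le> B"
  shows "integrable M (\<lambda>x. \<Sum>z\<in>X x \<inter> S. \<Sum>w\<in>X x \<inter> S. if z \<noteq> w then G z w else 0)"
    and "(\<integral>x. (\<Sum>z\<in>X x \<inter> S. \<Sum>w\<in>X x \<inter> S. if z \<noteq> w then G z w else 0) \<partial>M)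
      = (\<integral>p. indicator (S \<times> S) p * G (fst p) (snd p) * of_real (pair_intensity p)
           \<partial>(gaussian_measure \<Otimes>\<^sub>M gaussian_measure))"
proof -
  define T where "T i x = (\<Sum>z\<in>X x \<inter> S. \<Sum>w\<in>X x \<inter> S.
      if grid_round i z \<noteq> grid_round i w then G (grid_round i z) (grid_round i w) else 0)" for i x
  define E where "E x = (\<Sum>z\<in>X x \<inter> S. \<Sum>w\<in>X x \<inter> S. if z \<noteq> w then G z w else 0)" for x
  define h where "h i p = indicator (S \<times> S) p *
      (if grid_round i (fst p) \<noteq> grid_round i (snd p)
       then G (grid_round i (fst p)) (grid_round i (snd p)) else 0) * of_real (pair_intensity p)" for i p
  define h' where "h' p = indicator (S \<times> S) p * G (fst p) (snd p) * of_real (pair_intensity p)" for p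
  note rps = rounded_pair_sum[OF S R, where G = G, folded T_def h_def]
  have B0: "0 \<le> B" using B[of undefined undefined] norm_ge_zero order_trans by blast
  have GM: "case_prod G \<in> borel_measurable (borel \<Otimes>\<^sub>M borel)"
    using borel_measurable_continuous_onI[OF G] by (simp add: borel_prod)
  have [measurable]: "(\<lambda>x. G (f x) (g x)) \<in> borel_measurable N"
    if "f \<in> borel_measurable N" "g \<in> borel_measurable N" for f g and N :: "'z measure"
    using measurable_compose[OF measurable_Pair[OF that] GM] by simp
  have Tint: "integrable M (T i)" for i by (rule rps(1))
  have TO: "(\<lambda>i. T i x) \<longlonglongrightarrow> E x" for x
    unfolding T_def E_def by (intro tendsto_sum tendsto_grid_round_off_diagonal G)
  have OM: "E \<in> borel_measurable M"
    by (rule borel_measurable_LIMSEQ_metric[where f = T]) (use Tint TO in auto)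
  \<comment> \<open>A double sum over \<open>N\<close> points is at most \<open>B * N^2\<close>
    whatever the mesh.\<close>
  have TB: "norm (T i x) \<le> B * (real (card (X x \<inter> S)))\<^sup>2" for i x
  proof -
    have "norm (T i x) \<le> (\<Sum>z\<in>X x \<inter> S. \<Sum>w\<in>X x \<inter> S. B)"
      unfolding T_def by (intro sum_norm_le) (auto simp: B B0)
    then show ?thesis by (simp add: power2_eq_square mult_ac)
  qed
  note dom = OM borel_measurable_integrable[OF Tint] integrable_mult_right[OF integrable_card_squared[OF S R], of B]
    AE_I2[OF TO] AE_I2[OF TB]
  have lim1: "(\<lambda>i. \<integral>x. T i x \<partial>M) \<longlonglongrightarrow> (\<integral>x. E x \<partial>M)"
    by (rule integral_dominated_convergence[OF dom])
  show "integrable M (\<lambda>x. \<Sum>z\<in>X x \<inter> S. \<Sum>w\<in>X x \<inter> S. if z \<noteq> w then G z w else 0)"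
    using integrable_dominated_convergence[OF dom] by (simp add: E_def[abs_def])
  have lim2: "(\<lambda>i. \<integral>p. h i p \<partial>(gaussian_measure \<Otimes>\<^sub>M gaussian_measure)) \<longlonglongrightarrow>
      (\<integral>p. h' p \<partial>(gaussian_measure \<Otimes>\<^sub>M gaussian_measure))"
  proof (rule integral_dominated_convergence)
    show "integrable (gaussian_measure \<Otimes>\<^sub>M gaussian_measure) (\<lambda>p. B * (exp (R\<^sup>2) * exp (R\<^sup>2)))"
      by simp
    show "h' \<in> borel_measurable (gaussian_measure \<Otimes>\<^sub>M gaussian_measure)"
      unfolding h'_def by measurable
    show "h i \<in> borel_measurable (gaussian_measure \<Otimes>\<^sub>M gaussian_measure)" for i
      unfolding h_def by measurable
    show "AE p in gaussian_measure \<Otimes>\<^sub>M gaussian_measure. norm (h i p) \<le> B * (exp (R\<^sup>2) * exp (R\<^sup>2))" for i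
    proof (rule AE_I2)
      fix p
      show "norm (h i p) \<le> B * (exp (R\<^sup>2) * exp (R\<^sup>2))"
      proof (cases "p \<in> S \<times> S")
        case True
        then have "p \<in> cball 0 R \<times> cball 0 R" using R by auto
        then show ?thesis
          using True B B0 pair_intensity_le_cball[of p R] pair_intensity_nonneg[of p]
          by (simp add: h_def norm_mult mult_mono)
      qed (use B0 in \<open>auto simp: h_def\<close>)
    qed
    show "AE p in gaussian_measure \<Otimes>\<^sub>M gaussian_measure. (\<lambda>i. h i p) \<longlonglongrightarrow> h' p"
    proof (rule AE_I2)
      fix p
      \<comment> \<open>Inserting \<open>fst p \<noteq> snd p\<close> costs nothing, as the pair
        intensity vanishes on the diagonal.\<close>
      have "h' p = indicator (S \<times> S) p *
          (if fst p \<noteq> snd p then G (fst p) (snd p) else 0) * of_real (pair_intensity p)"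
        using pair_intensity_diag[of "fst p"] by (cases p) (auto simp: h'_def)
      then show "(\<lambda>i. h i p) \<longlonglongrightarrow> h' p"
        unfolding h_def by (simp only:) (intro tendsto_intros tendsto_grid_round_off_diagonal G)
    qed
  qed
  show "(\<integral>x. (\<Sum>z\<in>X x \<inter> S. \<Sum>w\<in>X x \<inter> S. if z \<noteq> w then G z w else 0) \<partial>M)
      = (\<integral>p. indicator (S \<times> S) p * G (fst p) (snd p) * of_real (pair_intensity p)
           \<partial>(gaussian_measure \<Otimes>\<^sub>M gaussian_measure))"
    using LIMSEQ_unique[OF lim1 lim2[folded rps(2)]] by (simp add: E_def h'_def)
qed

text \<open>The squared modulus of a finite sum splits into its diagonal, evaluated by
  \<open>Campbell\<close>, and its off-diagonal part, evaluated by
  \<open>second_order_Campbell\<close>.\<close>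

lemma second_moment:
  fixes f :: "complex \<Rightarrow> complex"
  assumes f: "continuous_on UNIV f" and B: "\<And>z. norm (f z) \<le> B" and supp: "\<And>z. z \<notin> cball 0 R \<Longrightarrow> f z = 0"
  shows "integrable M (\<lambda>x. (norm (\<integral>z. f z \<partial>pts_measure (X x)))\<^sup>2)"
    and "complex_of_real (\<integral>x. (norm (\<integral>z. f z \<partial>pts_measure (X x)))\<^sup>2 \<partial>M)
      = of_real (\<integral>z. (norm (f z))\<^sup>2 * intensity z \<partial>gaussian_measure)
        + (\<integral>p. f (fst p) * cnj (f (snd p)) * of_real (pair_intensity p)
             \<partial>(gaussian_measure \<Otimes>\<^sub>M gaussian_measure))"
proof -
  let ?S = "cball 0 R :: complex set"
  have fM [measurable]: "f \<in> borel_measurable borel" by (rule borel_measurable_continuous_onI[OF f])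
  have B0: "0 \<le> B" using B[of undefined] norm_ge_zero order_trans by blast
  define D where "D x = (\<Sum>z\<in>X x \<inter> ?S. (norm (f z))\<^sup>2)" for x
  define E where "E x = (\<Sum>z\<in>X x \<inter> ?S. \<Sum>w\<in>X x \<inter> ?S. if z \<noteq> w then f z * cnj (f w) else 0)" for x
  have GB: "norm (f z * cnj (f w)) \<le> B * B" for z w
    using B B0 by (simp add: norm_mult mult_mono)
  have cont: "continuous_on UNIV (\<lambda>(z, w). f z * cnj (f w))"
    unfolding case_prod_unfold
    by (intro continuous_intros continuous_on_compose2[OF f]) auto
  note camp = second_order_Campbell[of ?S R "\<lambda>z w. f z * cnj (f w)" "B * B", OF _ _ cont GB, folded E_def, simplified]
  have sq: "complex_of_real ((norm (\<integral>z. f z \<partial>pts_measure (X x)))\<^sup>2) = of_real (D x) + E x" if "x \<in> space M" for x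
  proof -
    have fin: "finite (X x \<inter> ?S)" by (rule point_process_finite[OF process that]) simp
    have int: "(\<integral>z. f z \<partial>pts_measure (X x)) = (\<Sum>z\<in>X x \<inter> ?S. f z)"
      by (rule integral_pts_measure_finite) (use fin supp in auto)
    have "complex_of_real ((norm (\<integral>z. f z \<partial>pts_measure (X x)))\<^sup>2)
        = (\<Sum>z\<in>X x \<inter> ?S. \<Sum>w\<in>X x \<inter> ?S. f z * cnj (f w))"
      by (simp only: int complex_norm_square cnj_sum sum_product)
    also have "\<dots> = (\<Sum>z\<in>X x \<inter> ?S. \<Sum>w\<in>X x \<inter> ?S.
        (if w = z then f z * cnj (f z) else 0) + (if z \<noteq> w then f z * cnj (f w) else 0))"
      by (intro sum.cong) auto
    also have "\<dots> = of_real (D x) + E x"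
      using fin by (simp add: D_def E_def sum.distrib sum.delta complex_norm_square[symmetric] del: of_real_power)
    finally show ?thesis .
  qed
  have Dint: "integrable gaussian_measure (\<lambda>z. (norm (f z))\<^sup>2 * intensity z)"
  proof (rule gaussian.integrable_const_bound[where B = "B\<^sup>2 * exp (R\<^sup>2)"])
    show "AE z in gaussian_measure. norm ((norm (f z))\<^sup>2 * intensity z) \<le> B\<^sup>2 * exp (R\<^sup>2)"
    proof (rule AE_I2)
      show "norm ((norm (f z))\<^sup>2 * intensity z) \<le> B\<^sup>2 * exp (R\<^sup>2)" for z
        using supp[of z] B[of z] B0 intensity_le_cball[of z R] intensity_nonneg[of z]
        by (cases "z \<in> ?S") (auto simp: abs_mult intro!: mult_mono power_mono)
    qed
  qed measurable
  have D_nn: "(\<integral>\<^sup>+x. ennreal (D x) \<partial>M) = ennreal (\<integral>z. (norm (f z))\<^sup>2 * intensity z \<partial>gaussian_measure)"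
  proof -
    have Dx: "ennreal (D x) = (\<integral>\<^sup>+z. ennreal ((norm (f z))\<^sup>2) \<partial>pts_measure (X x))" if "x \<in> space M" for x
      using point_process_finite[OF process that, of ?S] supp
      by (subst nn_integral_pts_measure_finite[where A = ?S]) (auto simp: D_def)
    have "(\<integral>\<^sup>+x. ennreal (D x) \<partial>M) = (\<integral>\<^sup>+x. (\<integral>\<^sup>+z. ennreal ((norm (f z))\<^sup>2) \<partial>pts_measure (X x)) \<partial>M)"
      by (rule nn_integral_cong) (rule Dx)
    also have "\<dots> = (\<integral>\<^sup>+z. ennreal ((norm (f z))\<^sup>2 * intensity z) \<partial>gaussian_measure)"
      by (subst Campbell) (auto simp: ennreal_mult' intensity_nonneg intro!: nn_integral_cong)
    also have "\<dots> = ennreal (\<integral>z. (norm (f z))\<^sup>2 * intensity z \<partial>gaussian_measure)"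
      by (rule nn_integral_eq_integral[OF Dint]) (simp add: intensity_nonneg)
    finally show ?thesis .
  qed
  have DM: "D \<in> borel_measurable M"
  proof -
    have "(\<lambda>x. \<integral>z. (norm (f z))\<^sup>2 \<partial>pts_measure (X x)) \<in> borel_measurable M"
      by (rule measurable_integral_pts_measure_real[OF process, where A = ?S]) (use supp in auto)
    moreover have "(\<integral>z. (norm (f z))\<^sup>2 \<partial>pts_measure (X x)) = D x" if "x \<in> space M" for x
      unfolding D_def using point_process_finite[OF process that, of ?S] supp
      by (intro integral_pts_measure_finite) auto
    ultimately show ?thesis by (simp cong: measurable_cong)
  qed
  have D0: "0 \<le> D x" for x by (simp add: D_def sum_nonneg)
  have Dintegrable: "integrable M D"
    by (rule integrableI_nonneg) (use DM D0 D_nn in auto)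
  have D_val: "(\<integral>x. D x \<partial>M) = (\<integral>z. (norm (f z))\<^sup>2 * intensity z \<partial>gaussian_measure)"
    using nn_integral_eq_integral[OF Dintegrable] D_nn D0
    by (simp add: integral_nonneg_AE intensity_nonneg)
  have int: "integrable M (\<lambda>x. of_real (D x) + E x)"
    by (intro Bochner_Integration.integrable_add integrable_of_real Dintegrable camp(1))
  then have "integrable M (\<lambda>x. complex_of_real ((norm (\<integral>z. f z \<partial>pts_measure (X x)))\<^sup>2))"
    by (subst Bochner_Integration.integrable_cong[OF refl sq])
  from integrable_Re[OF this] show "integrable M (\<lambda>x. (norm (\<integral>z. f z \<partial>pts_measure (X x)))\<^sup>2)"
    by (simp only: Re_complex_of_real)
  have "complex_of_real (\<integral>x. (norm (\<integral>z. f z \<partial>pts_measure (X x)))\<^sup>2 \<partial>M)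
      = (\<integral>x. complex_of_real ((norm (\<integral>z. f z \<partial>pts_measure (X x)))\<^sup>2) \<partial>M)"
    by (rule integral_complex_of_real[symmetric])
  also have "\<dots> = (\<integral>x. of_real (D x) + E x \<partial>M)"
    by (rule Bochner_Integration.integral_cong[OF refl sq])
  also have "\<dots> = of_real (\<integral>x. D x \<partial>M) + (\<integral>x. E x \<partial>M)"
    by (subst Bochner_Integration.integral_add)
       (auto intro: integrable_of_real Dintegrable camp(1) simp: integral_complex_of_real)
  also have "(\<integral>x. E x \<partial>M) = (\<integral>p. f (fst p) * cnj (f (snd p)) * of_real (pair_intensity p)
             \<partial>(gaussian_measure \<Otimes>\<^sub>M gaussian_measure))"
    unfolding camp(2)
    by (intro Bochner_Integration.integral_cong) (use supp in \<open>fastforce simp: indicator_def\<close>)+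
  finally show "complex_of_real (\<integral>x. (norm (\<integral>z. f z \<partial>pts_measure (X x)))\<^sup>2 \<partial>M)
      = of_real (\<integral>z. (norm (f z))\<^sup>2 * intensity z \<partial>gaussian_measure)
        + (\<integral>p. f (fst p) * cnj (f (snd p)) * of_real (pair_intensity p)
             \<partial>(gaussian_measure \<Otimes>\<^sub>M gaussian_measure))"
    by (simp only: D_val)
qed

end

section \<open>Variance bounds for the Ginibre kernels\<close>

lemma cnj_measurable [measurable]: "cnj \<in> borel_measurable borel"
  by (intro borel_measurable_continuous_onI continuous_intros)

text \<open>Scaled to have norm 1 in \<open>L^2\<close> of the Gaussian measure, which is exactly
  the scaling that the coefficients \<open>1 / fact k\<close> of the kernel ask for.\<close>

definition monomial :: "nat \<Rightarrow> complex \<Rightarrow> complex" where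
  "monomial k z = z ^ k / of_real (sqrt (fact k))"

lemma continuous_on_monomial [continuous_intros]:
  "continuous_on A f \<Longrightarrow> continuous_on A (\<lambda>x. monomial k (f x))"
  unfolding monomial_def by (intro continuous_intros) auto

lemma monomial_measurable [measurable]: "monomial k \<in> borel_measurable borel"
  unfolding monomial_def by measurable

lemma norm_monomial_squared: "(norm (monomial k z))\<^sup>2 = norm z ^ (2 * k) / fact k"
  by (simp add: monomial_def norm_divide norm_power power_divide power_mult[symmetric] mult.commute)

lemma monomial_normalized: "(\<integral>\<^sup>+z. ennreal ((norm (monomial k z))\<^sup>2) \<partial>gaussian_measure) = 1"
proof -
  have "(\<integral>\<^sup>+z. ennreal ((norm (monomial k z))\<^sup>2) \<partial>gaussian_measure)
      = (\<integral>\<^sup>+z. ennreal (1 / fact k) * ennreal (norm z ^ (2 * k)) \<partial>gaussian_measure)"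
    by (intro nn_integral_cong) (simp add: norm_monomial_squared ennreal_mult'[symmetric])
  also have "\<dots> = ennreal (1 / fact k) * ennreal (fact k)"
    by (simp add: nn_integral_cmult nn_integral_gaussian_power)
  finally show ?thesis by (simp add: ennreal_mult'[symmetric])
qed

lemma ginibre_kernel_monomial: "ginibre_kernel n z w = (\<Sum>k<n. monomial k z * cnj (monomial k w))"
  unfolding ginibre_kernel_def
  by (intro sum.cong refl)
     (simp add: monomial_def power_mult_distrib flip: of_real_mult)

lemma ginibre_kernel_diag: "ginibre_kernel n z z = of_real (\<Sum>k<n. (norm (monomial k z))\<^sup>2)"
  by (simp add: ginibre_kernel_monomial complex_norm_square del: of_real_power)

lemma ginibre_kernel_tendsto: "(\<lambda>n. ginibre_kernel n z w) \<longlonglongrightarrow> exp (z * cnj w)"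
  using exp_converges[of "z * cnj w"]
  by (simp add: sums_def ginibre_kernel_def scaleR_conv_of_real divide_inverse mult.commute)

text \<open>The diagonal is a partial sum of the exponential series at \<open>|z|^2\<close>, and the
  two-point bound is Cauchy-Schwarz for sums over \<open>k < n\<close>.\<close>

lemma gaussian_kernel_ginibre: "gaussian_kernel (ginibre_kernel n)"
proof
  show "case_prod (ginibre_kernel n) \<in> borel_measurable (borel \<Otimes>\<^sub>M borel)"
    unfolding ginibre_kernel_monomial case_prod_unfold by measurable
  show "ginibre_kernel n w z = cnj (ginibre_kernel n z w)" for z w
    by (simp add: ginibre_kernel_monomial mult.commute)
  show "0 \<le> Re (ginibre_kernel n z z)" for z
    by (simp add: ginibre_kernel_diag sum_nonneg)
  show "Re (ginibre_kernel n z z) \<le> exp ((norm z)\<^sup>2)" for z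
  proof -
    have "(\<Sum>k<n. (norm (monomial k z))\<^sup>2) = (\<Sum>k<n. ((norm z)\<^sup>2) ^ k /\<^sub>R fact k)"
      by (simp add: norm_monomial_squared divide_inverse mult.commute flip: power_mult)
    also have "\<dots> \<le> (\<Sum>k. ((norm z)\<^sup>2) ^ k /\<^sub>R fact k)"
      by (rule sum_le_suminf[OF summable_exp_generic]) auto
    also have "\<dots> = exp ((norm z)\<^sup>2)" by (simp add: exp_def)
    finally show ?thesis by (simp add: ginibre_kernel_diag)
  qed
  show "(norm (ginibre_kernel n z w))\<^sup>2 \<le> Re (ginibre_kernel n z z) * Re (ginibre_kernel n w w)" for z w
  proof -
    have "(norm (ginibre_kernel n z w))\<^sup>2 \<le> (\<Sum>k<n. norm (monomial k z) * norm (monomial k w))\<^sup>2"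
      unfolding ginibre_kernel_monomial
      by (intro power_mono sum_norm_le) (auto simp: norm_mult)
    also have "\<dots> \<le> (\<Sum>k<n. (norm (monomial k z))\<^sup>2) * (\<Sum>k<n. (norm (monomial k w))\<^sup>2)"
      by (rule Cauchy_Schwarz_ineq_sum)
    finally show ?thesis by (simp add: ginibre_kernel_diag)
  qed
qed

definition exp_kernel :: "complex \<Rightarrow> complex \<Rightarrow> complex" where
  "exp_kernel z w = exp (z * cnj w)"

lemma norm_exp_kernel_squared: "(norm (exp_kernel z w))\<^sup>2 = exp (2 * Re (z * cnj w))"
  by (simp only: exp_kernel_def norm_exp_eq_Re exp_double)

lemma exp_kernel_diag: "exp_kernel z z = of_real (exp ((norm z)\<^sup>2))"
  by (simp add: exp_kernel_def complex_norm_square[symmetric] exp_of_real[symmetric] del: of_real_power)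

lemma gaussian_kernel_exp: "gaussian_kernel exp_kernel"
proof
  show "case_prod exp_kernel \<in> borel_measurable (borel \<Otimes>\<^sub>M borel)"
    unfolding exp_kernel_def case_prod_unfold by measurable
  show "exp_kernel w z = cnj (exp_kernel z w)" for z w
    by (simp add: exp_kernel_def exp_cnj mult.commute)
  show "0 \<le> Re (exp_kernel z z)" "Re (exp_kernel z z) \<le> exp ((norm z)\<^sup>2)" for z
    by (simp_all add: exp_kernel_diag)
  show "(norm (exp_kernel z w))\<^sup>2 \<le> Re (exp_kernel z z) * Re (exp_kernel w w)" for z w
  proof -
    \<comment> \<open>Cauchy-Schwarz for the exponential kernel is the expansion of this inequality,
      exponentiated.\<close>
    have "0 \<le> (norm (z - w))\<^sup>2" by simp
    then have "2 * Re (z * cnj w) \<le> (norm z)\<^sup>2 + (norm w)\<^sup>2"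
      by (simp add: cmod_power2 power2_diff)
    then show ?thesis
      by (simp add: norm_exp_kernel_squared exp_kernel_diag flip: exp_add)
  qed
qed

text \<open>The variance of the linear statistic of \<open>f\<close> under a determinantal process
  with Hermitian kernel \<open>K\<close>. For the test functions below the double integral is real
  by the symmetry between \<open>z\<close> and \<open>w\<close>; \<open>Re\<close> only adapts the
  type.\<close>

definition kernel_variance :: "(complex \<Rightarrow> complex \<Rightarrow> complex) \<Rightarrow> (complex \<Rightarrow> complex) \<Rightarrow> real" where
  "kernel_variance K f = (\<integral>z. (norm (f z))\<^sup>2 * Re (K z z) \<partial>gaussian_measure)
     - Re (\<integral>p. f (fst p) * cnj (f (snd p)) * of_real ((norm (K (fst p) (snd p)))\<^sup>2)
         \<partial>(gaussian_measure \<Otimes>\<^sub>M gaussian_measure))"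

text \<open>Compact support confines the kernels to a ball, where they are bounded; their products
  with test functions are then integrable against the Gaussian probability measure.\<close>

locale bounded_test_function =
  fixes f :: "complex \<Rightarrow> complex" and B R :: real
  assumes f_cont: "continuous_on UNIV f"
    and f_bound: "norm (f z) \<le> B"
    and f_supp: "z \<notin> cball 0 R \<Longrightarrow> f z = 0"
begin

lemma f_measurable [measurable]: "f \<in> borel_measurable borel"
  by (rule borel_measurable_continuous_onI[OF f_cont])

lemma bound_nonneg: "0 \<le> B"
  using f_bound[of undefined] norm_ge_zero order_trans by blast

lemma integrable_mult_test:
  fixes g :: "complex \<Rightarrow> complex"
  assumes [measurable]: "g \<in> borel_measurable borel" and C: "\<And>z. z \<in> cball 0 R \<Longrightarrow> norm (g z) \<le> C"
  shows "integrable gaussian_measure (\<lambda>z. f z * g z)"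
proof (rule gaussian.integrable_const_bound[where B = "B * max C 0"])
  show "AE z in gaussian_measure. norm (f z * g z) \<le> B * max C 0"
  proof (rule AE_I2)
    show "norm (f z * g z) \<le> B * max C 0" for z
      using f_supp[of z] f_bound[of z] bound_nonneg C[of z]
      by (cases "z \<in> cball 0 R") (auto simp: norm_mult intro!: mult_mono)
  qed
qed measurable

lemma integrable_pair_mult_test:
  fixes g :: "complex \<times> complex \<Rightarrow> complex"
  assumes [measurable]: "g \<in> borel_measurable (borel \<Otimes>\<^sub>M borel)"
    and C: "\<And>p. p \<in> cball 0 R \<times> cball 0 R \<Longrightarrow> norm (g p) \<le> C"
  shows "integrable (gaussian_measure \<Otimes>\<^sub>M gaussian_measure) (\<lambda>p. f (fst p) * cnj (f (snd p)) * g p)"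
proof (rule gaussian_pair.integrable_const_bound[where B = "B * B * max C 0"])
  show "AE p in gaussian_measure \<Otimes>\<^sub>M gaussian_measure.
      norm (f (fst p) * cnj (f (snd p)) * g p) \<le> B * B * max C 0"
  proof (rule AE_I2)
    fix p
    show "norm (f (fst p) * cnj (f (snd p)) * g p) \<le> B * B * max C 0"
    proof (cases "p \<in> cball 0 R \<times> cball 0 R")
      case True
      then show ?thesis
        using f_bound[of "fst p"] f_bound[of "snd p"] bound_nonneg C[of p]
        by (auto simp: norm_mult intro!: mult_mono)
    next
      case False
      then have "f (fst p) = 0 \<or> f (snd p) = 0"
        using f_supp by (cases p) auto
      then show ?thesis using bound_nonneg by auto
    qed
  qed
qed measurable

lemma integrable_norm_squared_mult_test:
  fixes g :: "complex \<Rightarrow> real"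
  assumes [measurable]: "g \<in> borel_measurable borel" and C: "\<And>z. z \<in> cball 0 R \<Longrightarrow> \<bar>g z\<bar> \<le> C"
  shows "integrable gaussian_measure (\<lambda>z. (norm (f z))\<^sup>2 * g z)"
proof (rule gaussian.integrable_const_bound[where B = "B\<^sup>2 * max C 0"])
  show "AE z in gaussian_measure. norm ((norm (f z))\<^sup>2 * g z) \<le> B\<^sup>2 * max C 0"
  proof (rule AE_I2)
    show "norm ((norm (f z))\<^sup>2 * g z) \<le> B\<^sup>2 * max C 0" for z
      using f_supp[of z] f_bound[of z] bound_nonneg C[of z]
      by (cases "z \<in> cball 0 R") (auto simp: abs_mult intro!: mult_mono power_mono)
  qed
qed measurable

end

lemma integral_pair_gaussian_mult:
  fixes g h :: "complex \<Rightarrow> complex"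
  assumes "integrable (gaussian_measure \<Otimes>\<^sub>M gaussian_measure) (\<lambda>p. g (fst p) * h (snd p))"
  shows "(\<integral>p. g (fst p) * h (snd p) \<partial>(gaussian_measure \<Otimes>\<^sub>M gaussian_measure))
    = (\<integral>z. g z \<partial>gaussian_measure) * (\<integral>z. h z \<partial>gaussian_measure)"
  using gaussian_pair.integral_fst'[OF assms, symmetric] by simp

text \<open>The last assumption says that \<open>f\<close> has angular frequency \<open>- l\<close>;
  since \<open>l \<ge> 1\<close>, it integrates to zero against every radial weight.\<close>

locale angular_test_function = bounded_test_function +
  fixes l :: nat
  assumes l: "l \<ge> 1"
    and f_angular: "norm u = 1 \<Longrightarrow> f (u * z) = u powi (- int l) * f z"
begin

lemma integral_radial_zero:
  fixes g :: "complex \<Rightarrow> complex"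
  assumes [measurable]: "g \<in> borel_measurable borel" and g: "\<And>u z. norm u = 1 \<Longrightarrow> g (u * z) = g z"
  shows "(\<integral>z. f z * g z \<partial>gaussian_measure) = 0"
  by (rule gaussian_integral_angular_zero[where m = "- int l"]) (use l f_angular g in auto)

text \<open>The integrand has angular frequency \<open>k - m - l\<close>, so only
  \<open>k = m + l\<close> can survive.\<close>

lemma cross_coefficient_zero:
  assumes "k \<noteq> m + l"
  shows "(\<integral>z. f z * (monomial k z * cnj (monomial m z)) \<partial>gaussian_measure) = 0"
proof (rule gaussian_integral_angular_zero[where m = "- int l + int k - int m"])
  fix u z :: complex assume u: "norm u = 1"
  then have u0: "u \<noteq> 0" by auto
  \<comment> \<open>On the unit circle conjugation is inversion, so the conjugated monomial has
    frequency \<open>- m\<close>.\<close>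
  have "u * cnj u = 1" using u by (simp add: complex_norm_square[symmetric])
  then have "u ^ m * cnj u ^ m = 1" by (simp add: power_mult_distrib[symmetric])
  then show "f (u * z) * (monomial k (u * z) * cnj (monomial m (u * z)))
      = u powi (- int l + int k - int m) * (f z * (monomial k z * cnj (monomial m z)))"
    using u0 by (simp add: f_angular[OF u] monomial_def power_int_add power_int_diff power_int_minus
      power_mult_distrib field_simps)
qed (use assms in auto)

end

text \<open>The product of one-point intensities in \<open>pair_intensity\<close> contributes the
  squared modulus of the mean, which vanishes for a radial intensity; what remains of the second
  moment is the variance.\<close>

lemma (in gaussian_determinantal) second_moment_angular:
  assumes "angular_test_function f B R l"
    and radial: "\<And>u z. norm u = 1 \<Longrightarrow> intensity (u * z) = intensity z"
  shows "integrable M (\<lambda>x. (norm (\<integral>z. f z \<partial>pts_measure (X x)))\<^sup>2)"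
    and "(\<integral>x. (norm (\<integral>z. f z \<partial>pts_measure (X x)))\<^sup>2 \<partial>M) = kernel_variance K f"
proof -
  interpret f: angular_test_function f B R l by fact
  note sm = second_moment[OF f.f_cont f.f_bound f.f_supp]
  show "integrable M (\<lambda>x. (norm (\<integral>z. f z \<partial>pts_measure (X x)))\<^sup>2)" by (rule sm(1))
  let ?P = "gaussian_measure \<Otimes>\<^sub>M gaussian_measure"
  have i1: "integrable ?P (\<lambda>p. f (fst p) * cnj (f (snd p)) * of_real (intensity (fst p) * intensity (snd p)))"
  proof (rule f.integrable_pair_mult_test)
    show "norm (complex_of_real (intensity (fst p) * intensity (snd p))) \<le> exp (R\<^sup>2) * exp (R\<^sup>2)"
      if "p \<in> cball 0 R \<times> cball 0 R" for p
      using that intensity_le_cball[of "fst p" R] intensity_le_cball[of "snd p" R]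
      by (auto simp: norm_mult intensity_nonneg mem_Times_iff intro!: mult_mono)
  qed measurable
  have i2: "integrable ?P (\<lambda>p. f (fst p) * cnj (f (snd p)) * of_real ((norm (K (fst p) (snd p)))\<^sup>2))"
  proof (rule f.integrable_pair_mult_test)
    fix p :: "complex \<times> complex" assume p: "p \<in> cball 0 R \<times> cball 0 R"
    have "(norm (K (fst p) (snd p)))\<^sup>2 \<le> intensity (fst p) * intensity (snd p)"
      using K_Cauchy_Schwarz by (simp add: intensity_def)
    also have "\<dots> \<le> exp (R\<^sup>2) * exp (R\<^sup>2)"
      using p intensity_le_cball[of "fst p" R] intensity_le_cball[of "snd p" R]
      by (auto simp: intensity_nonneg mem_Times_iff intro!: mult_mono)
    finally show "norm (complex_of_real ((norm (K (fst p) (snd p)))\<^sup>2)) \<le> exp (R\<^sup>2) * exp (R\<^sup>2)"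
      by (simp del: of_real_power)
  qed measurable
  have "(\<integral>p. f (fst p) * cnj (f (snd p)) * of_real (intensity (fst p) * intensity (snd p)) \<partial>?P)
      = (\<integral>p. (f (fst p) * of_real (intensity (fst p))) * cnj (f (snd p) * of_real (intensity (snd p))) \<partial>?P)"
    by (simp add: mult_ac)
  also have "\<dots> = (\<integral>z. f z * of_real (intensity z) \<partial>gaussian_measure)
      * (\<integral>z. cnj (f z * of_real (intensity z)) \<partial>gaussian_measure)"
    using i1 by (intro integral_pair_gaussian_mult[where h = "\<lambda>z. cnj (f z * of_real (intensity z))"])
      (simp add: mult_ac)
  also have "(\<integral>z. f z * of_real (intensity z) \<partial>gaussian_measure) = 0"
    by (rule f.integral_radial_zero) (auto simp: radial)
  finally have z: "(\<integral>p. f (fst p) * cnj (f (snd p)) * of_real (intensity (fst p) * intensity (snd p)) \<partial>?P) = 0"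
    by simp
  have "(\<integral>p. f (fst p) * cnj (f (snd p)) * of_real (pair_intensity p) \<partial>?P)
     = (\<integral>p. f (fst p) * cnj (f (snd p)) * of_real (intensity (fst p) * intensity (snd p))
          - f (fst p) * cnj (f (snd p)) * of_real ((norm (K (fst p) (snd p)))\<^sup>2) \<partial>?P)"
    by (simp add: pair_intensity_def algebra_simps)
  also have "\<dots> = - (\<integral>p. f (fst p) * cnj (f (snd p)) * of_real ((norm (K (fst p) (snd p)))\<^sup>2) \<partial>?P)"
    by (subst Bochner_Integration.integral_diff[OF i1 i2]) (simp only: z diff_0)
  finally have "complex_of_real (\<integral>x. (norm (\<integral>z. f z \<partial>pts_measure (X x)))\<^sup>2 \<partial>M)
      = of_real (\<integral>z. (norm (f z))\<^sup>2 * intensity z \<partial>gaussian_measure)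
        - (\<integral>p. f (fst p) * cnj (f (snd p)) * of_real ((norm (K (fst p) (snd p)))\<^sup>2) \<partial>?P)"
    using sm(2) by simp
  from arg_cong[where f = Re, OF this]
  show "(\<integral>x. (norm (\<integral>z. f z \<partial>pts_measure (X x)))\<^sup>2 \<partial>M) = kernel_variance K f"
    by (simp add: kernel_variance_def intensity_def)
qed

section \<open>The Lipschitz bound for the infinite kernel\<close>

lemma Re_mult_cnj: "Re (a * cnj b) = ((norm a)\<^sup>2 + (norm b)\<^sup>2 - (norm (a - b))\<^sup>2) / 2"
  unfolding cmod_power2 by (simp add: power2_eq_square algebra_simps)

lemma integrable_pair_gaussian_mult:
  fixes g h :: "complex \<Rightarrow> complex"
  assumes g: "integrable gaussian_measure g" and h: "integrable gaussian_measure h"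
  shows "integrable (gaussian_measure \<Otimes>\<^sub>M gaussian_measure) (\<lambda>p. g (fst p) * h (snd p))"
proof (rule gaussian_pair.Fubini_integrable)
  have [measurable]: "g \<in> borel_measurable borel" "h \<in> borel_measurable borel"
    using g h by (auto dest: borel_measurable_integrable)
  show "(\<lambda>p. g (fst p) * h (snd p)) \<in> borel_measurable (gaussian_measure \<Otimes>\<^sub>M gaussian_measure)"
    by measurable
qed (use g h in \<open>auto simp: norm_mult\<close>)

lemma exp_kernel_measurable [measurable (raw)]:
  assumes [measurable]: "g \<in> borel_measurable N" "h \<in> borel_measurable N"
  shows "(\<lambda>x. exp_kernel (g x) (h x)) \<in> borel_measurable N"
  unfolding exp_kernel_def by measurable

text \<open>With its Gaussian weights \<open>\<bar>exp (z * cnj w)\<bar>\<^sup>2\<close> is the translation kernel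
  \<open>exp (- \<bar>w - z\<bar>\<^sup>2)\<close>.\<close>

lemma nn_integral_exp_kernel:
  assumes [measurable]: "g \<in> borel_measurable borel"
  shows "(\<integral>\<^sup>+w. g (w - z) * ennreal ((norm (exp_kernel z w))\<^sup>2) \<partial>gaussian_measure)
    = ennreal (exp ((norm z)\<^sup>2)) * (\<integral>\<^sup>+w. g w \<partial>gaussian_measure)"
proof -
  let ?G = "\<lambda>u. ennreal (exp (- (norm u)\<^sup>2) / pi) * g u"
  have "(\<integral>\<^sup>+w. g (w - z) * ennreal ((norm (exp_kernel z w))\<^sup>2) \<partial>gaussian_measure)
      = (\<integral>\<^sup>+w. ennreal (exp ((norm z)\<^sup>2)) * ?G (- z + w) \<partial>lborel)"
  proof (subst nn_integral_gaussian_measure, measurable, rule nn_integral_cong)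
    fix w :: complex
    have "(norm (- z + w))\<^sup>2 = (norm z)\<^sup>2 + (norm w)\<^sup>2 - 2 * Re (z * cnj w)"
      unfolding cmod_power2 by (simp add: power2_eq_square algebra_simps)
    then have "exp (- (norm w)\<^sup>2) / pi * (norm (exp_kernel z w))\<^sup>2
        = exp ((norm z)\<^sup>2) * (exp (- (norm (- z + w))\<^sup>2) / pi)"
      by (simp only: norm_exp_kernel_squared times_divide_eq_left times_divide_eq_right exp_add[symmetric])
         (simp add: algebra_simps)
    then have "ennreal (exp (- (norm w)\<^sup>2) / pi) * ennreal ((norm (exp_kernel z w))\<^sup>2)
        = ennreal (exp ((norm z)\<^sup>2)) * ennreal (exp (- (norm (- z + w))\<^sup>2) / pi)"
      by (simp only: ennreal_mult'[symmetric] exp_ge_zero divide_nonneg_pos pi_gt_zero ennreal_mult''[symmetric] zero_le_power2)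
    then have "ennreal (exp (- (norm w)\<^sup>2) / pi) * ennreal ((norm (exp_kernel z w))\<^sup>2) * g (- z + w)
        = ennreal (exp ((norm z)\<^sup>2)) * ennreal (exp (- (norm (- z + w))\<^sup>2) / pi) * g (- z + w)"
      by (simp only:)
    then show "ennreal (exp (- (norm w)\<^sup>2) / pi) * (g (w - z) * ennreal ((norm (exp_kernel z w))\<^sup>2))
        = ennreal (exp ((norm z)\<^sup>2)) * ?G (- z + w)"
      by (simp only: mult_ac uminus_add_conv_diff)
  qed
  also have "\<dots> = ennreal (exp ((norm z)\<^sup>2)) * (\<integral>\<^sup>+w. ?G (- z + w) \<partial>lborel)"
    by (rule nn_integral_cmult) measurable
  also have "(\<integral>\<^sup>+w. ?G (- z + w) \<partial>lborel) = (\<integral>\<^sup>+w. ?G w \<partial>lborel)"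
    by (rule nn_integral_lborel_translate) measurable
  also have "\<dots> = (\<integral>\<^sup>+w. g w \<partial>gaussian_measure)"
    by (simp add: nn_integral_gaussian_measure)
  finally show ?thesis .
qed

text \<open>The total mass of a Gaussian density recentred at \<open>z\<close>. As the value equals
  \<open>exp_kernel z z\<close>, this is the reproducing property of the kernel.\<close>

lemma exp_kernel_integral:
  "has_bochner_integral gaussian_measure (\<lambda>w. (norm (exp_kernel z w))\<^sup>2) (exp ((norm z)\<^sup>2))"
  using nn_integral_exp_kernel[of "\<lambda>_. 1" z] gaussian.emeasure_space_1
  by (intro has_bochner_integral_nn_integral) auto

text \<open>The weight \<open>|z - w|^2\<close> leaves the value unchanged because a standard
  complex Gaussian has second moment 1.\<close>

lemma exp_kernel_integral_distance:
  "has_bochner_integral gaussian_measure (\<lambda>w. (norm (z - w))\<^sup>2 * (norm (exp_kernel z w))\<^sup>2) (exp ((norm z)\<^sup>2))"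
proof (rule has_bochner_integral_nn_integral)
  have "(\<integral>\<^sup>+w. ennreal ((norm (z - w))\<^sup>2 * (norm (exp_kernel z w))\<^sup>2) \<partial>gaussian_measure)
      = (\<integral>\<^sup>+w. ennreal (norm (w - z) ^ (2 * 1)) * ennreal ((norm (exp_kernel z w))\<^sup>2) \<partial>gaussian_measure)"
    by (intro nn_integral_cong) (simp add: ennreal_mult' norm_minus_commute)
  also have "\<dots> = ennreal (exp ((norm z)\<^sup>2))"
    using nn_integral_gaussian_power[of 1]
    by (subst nn_integral_exp_kernel[of "\<lambda>u. ennreal (norm u ^ (2 * 1))" z]) simp_all
  finally show "(\<integral>\<^sup>+w. ennreal ((norm (z - w))\<^sup>2 * (norm (exp_kernel z w))\<^sup>2) \<partial>gaussian_measure)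
      = ennreal (exp ((norm z)\<^sup>2))" .
qed auto

text \<open>The exponential cancels the Gaussian density, leaving the area of the disc divided by
  \<open>pi\<close>; the factor \<open>R^2\<close> of the variance bound originates here.\<close>

lemma integral_exp_cball:
  assumes "R \<ge> 0"
  shows "has_bochner_integral gaussian_measure (\<lambda>z. indicator (cball 0 R) z * exp ((norm z)\<^sup>2)) (R\<^sup>2)"
proof (rule has_bochner_integral_nn_integral)
  have [measurable]: "(cball 0 R :: complex set) \<in> sets borel" by simp
  have meas: "(\<lambda>z::complex. ennreal (indicator (cball 0 R) z * exp ((norm z)\<^sup>2))) \<in> borel_measurable borel"
    by measurable
  have "(\<integral>\<^sup>+z. ennreal (indicator (cball 0 R) z * exp ((norm z)\<^sup>2)) \<partial>gaussian_measure)
      = (\<integral>\<^sup>+z. ennreal (1 / pi) * indicator (cball 0 R :: complex set) z \<partial>lborel)"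
    unfolding nn_integral_gaussian_measure[OF meas]
    by (rule nn_integral_cong) (auto simp: indicator_def ennreal_mult'[symmetric] exp_minus)
  also have "\<dots> = ennreal (1 / pi) * ennreal (pi * R\<^sup>2)"
    using assms by (subst nn_integral_cmult_indicator) (auto simp: emeasure_cball eval_unit_ball_vol)
  also have "\<dots> = ennreal (R\<^sup>2)"
    by (simp add: ennreal_mult'[symmetric])
  finally show "(\<integral>\<^sup>+z. ennreal (indicator (cball 0 R) z * exp ((norm z)\<^sup>2)) \<partial>gaussian_measure) = ennreal (R\<^sup>2)" .
  show "(\<lambda>z. indicator (cball 0 R) z * exp ((norm z)\<^sup>2)) \<in> borel_measurable gaussian_measure"
    by measurable
qed auto

context bounded_test_function
begin

text \<open>By the polarisation identity \<open>Re_mult_cnj\<close>, the integrand of the double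
  integral is half of \<open>|f(z)|^2 + |f(w)|^2 - |f(z) - f(w)|^2\<close>, weighted by the kernel.
  The first two terms reproduce the single integral exactly. The third is of second order in
  \<open>z - w\<close>, and the translation kernel integrates it to a constant per unit of
  area.\<close>

lemma kernel_variance_exp_le:
  assumes Lip: "\<And>z w. norm (f z - f w) \<le> \<Lambda> * norm (z - w)" and R: "R \<ge> 0"
  shows "kernel_variance exp_kernel f \<le> \<Lambda>\<^sup>2 * R\<^sup>2"
proof -
  let ?P = "gaussian_measure \<Otimes>\<^sub>M gaussian_measure"
  let ?S = "cball 0 R :: complex set"
  let ?q = "\<lambda>z w. (norm (exp_kernel z w))\<^sup>2"
  let ?E = "\<lambda>z. exp ((norm z)\<^sup>2) :: real"
  \<comment> \<open>The half of the lower bound that is attributed to the first variable;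
    \<open>A'\<close> is its mirror image. The error is restricted to \<open>fst p\<close> in the
    ball, since over the whole plane it would in general not be integrable.\<close>
  define A where "A p = ((norm (f (fst p)))\<^sup>2 - \<Lambda>\<^sup>2 * (norm (fst p - snd p))\<^sup>2 * indicator ?S (fst p)) * ?q (fst p) (snd p) / 2" for p
  have [measurable]: "?S \<in> sets borel" by simp
  have qsym: "?q z w = ?q w z" for z w
    by (simp add: norm_exp_kernel_squared mult.commute)
  have intf: "integrable gaussian_measure (\<lambda>z. (norm (f z))\<^sup>2 * ?E z)"
    by (rule integrable_norm_squared_mult_test[where C = "exp (R\<^sup>2)"]) (auto intro!: power_mono)
  note intS = integral_exp_cball[OF R]
  have int1: "integrable ?P (\<lambda>p. (norm (f (fst p)))\<^sup>2 * ?q (fst p) (snd p))"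
  proof (rule gaussian_pair.Fubini_integrable)
    have "(\<integral>w. norm ((norm (f z))\<^sup>2 * ?q z w) \<partial>gaussian_measure) = (norm (f z))\<^sup>2 * ?E z" for z
      using has_bochner_integral_integral_eq[OF exp_kernel_integral[of z]] by simp
    then show "integrable gaussian_measure
        (\<lambda>z. \<integral>w. norm ((norm (f (fst (z, w))))\<^sup>2 * ?q (fst (z, w)) (snd (z, w))) \<partial>gaussian_measure)"
      by (simp only: fst_conv snd_conv intf)
    show "AE z in gaussian_measure. integrable gaussian_measure
        (\<lambda>w. (norm (f (fst (z, w))))\<^sup>2 * ?q (fst (z, w)) (snd (z, w)))"
      using exp_kernel_integral by (auto simp: has_bochner_integral_iff)
  qed measurable
  have int2: "integrable ?P (\<lambda>p. indicator ?S (fst p) * ((norm (fst p - snd p))\<^sup>2 * ?q (fst p) (snd p)))"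
  proof (rule gaussian_pair.Fubini_integrable)
    have "(\<integral>w. norm (indicator ?S z * ((norm (z - w))\<^sup>2 * ?q z w)) \<partial>gaussian_measure) = indicator ?S z * ?E z" for z
      using has_bochner_integral_integral_eq[OF exp_kernel_integral_distance[of z]] by (simp add: abs_mult)
    then show "integrable gaussian_measure
        (\<lambda>z. \<integral>w. norm (indicator ?S (fst (z, w)) * ((norm (fst (z, w) - snd (z, w)))\<^sup>2 * ?q (fst (z, w)) (snd (z, w))))
           \<partial>gaussian_measure)"
      using intS by (simp only: fst_conv snd_conv has_bochner_integral_iff)
    show "AE z in gaussian_measure. integrable gaussian_measure
        (\<lambda>w. indicator ?S (fst (z, w)) * ((norm (fst (z, w) - snd (z, w)))\<^sup>2 * ?q (fst (z, w)) (snd (z, w))))"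
      using exp_kernel_integral_distance by (auto simp: has_bochner_integral_iff)
  qed measurable
  have A: "A = (\<lambda>p. ((norm (f (fst p)))\<^sup>2 * ?q (fst p) (snd p)
      - \<Lambda>\<^sup>2 * (indicator ?S (fst p) * ((norm (fst p - snd p))\<^sup>2 * ?q (fst p) (snd p)))) / 2)"
    by (auto simp: A_def algebra_simps)
  have intA: "integrable ?P A"
    unfolding A by (intro integrable_divide Bochner_Integration.integrable_diff integrable_mult_right int1 int2)
  have valA: "(\<integral>p. A p \<partial>?P) = ((\<integral>z. (norm (f z))\<^sup>2 * ?E z \<partial>gaussian_measure) - \<Lambda>\<^sup>2 * R\<^sup>2) / 2"
  proof -
    have 1: "(\<integral>p. (norm (f (fst p)))\<^sup>2 * ?q (fst p) (snd p) \<partial>?P) = (\<integral>z. (norm (f z))\<^sup>2 * ?E z \<partial>gaussian_measure)"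
      using gaussian_pair.integral_fst'[OF int1, symmetric] has_bochner_integral_integral_eq[OF exp_kernel_integral]
      by simp
    have 2: "(\<integral>p. indicator ?S (fst p) * ((norm (fst p - snd p))\<^sup>2 * ?q (fst p) (snd p)) \<partial>?P)
        = (\<integral>z. indicator ?S z * ?E z \<partial>gaussian_measure)"
      using gaussian_pair.integral_fst'[OF int2, symmetric]
        has_bochner_integral_integral_eq[OF exp_kernel_integral_distance]
      by simp
    show ?thesis
      unfolding A using int1 int2 has_bochner_integral_integral_eq[OF intS]
      by (simp add: Bochner_Integration.integral_diff 1 2)
  qed
  define A' where "A' p = A (snd p, fst p)" for p
  have intA': "integrable ?P A'"
    using gaussian_pair.integrable_product_swap[OF intA] by (simp add: A'_def[abs_def] case_prod_unfold)
  have valA': "(\<integral>p. A' p \<partial>?P) = (\<integral>p. A p \<partial>?P)"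
    using gaussian_pair.integral_product_swap[of A] intA by (simp add: A'_def[abs_def] case_prod_unfold)
  let ?F = "\<lambda>p. f (fst p) * cnj (f (snd p)) * of_real (?q (fst p) (snd p))"
  have intF: "integrable ?P ?F"
  proof (rule integrable_pair_mult_test)
    fix p :: "complex \<times> complex" assume p: "p \<in> ?S \<times> ?S"
    have "?q (fst p) (snd p) \<le> ?E (fst p) * ?E (snd p)"
      using gaussian_kernel.K_Cauchy_Schwarz[OF gaussian_kernel_exp] by (simp add: exp_kernel_diag)
    also have "\<dots> \<le> exp (R\<^sup>2) * exp (R\<^sup>2)"
      using p by (intro mult_mono) (auto intro!: power_mono)
    finally show "norm (complex_of_real (?q (fst p) (snd p))) \<le> exp (R\<^sup>2) * exp (R\<^sup>2)"
      by (simp del: of_real_power)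
  qed measurable
  have le: "A p + A' p \<le> Re (?F p)" for p
  proof -
    obtain z w where p: "p = (z, w)" by (cases p)
    \<comment> \<open>The increment vanishes unless one of the two points lies in the ball, and then
      the indicators add up to at least 1.\<close>
    have "(norm (f z - f w))\<^sup>2 \<le> \<Lambda>\<^sup>2 * (norm (z - w))\<^sup>2 * (indicator ?S z + indicator ?S w)"
    proof (cases "z \<in> ?S \<or> w \<in> ?S")
      case True
      have "(norm (f z - f w))\<^sup>2 \<le> \<Lambda>\<^sup>2 * (norm (z - w))\<^sup>2 * 1"
        using power_mono[OF Lip[of z w] norm_ge_zero, of 2] by (simp add: power_mult_distrib)
      also have "\<dots> \<le> \<Lambda>\<^sup>2 * (norm (z - w))\<^sup>2 * (indicator ?S z + indicator ?S w)"
        using True by (intro mult_left_mono) (auto simp: indicator_def)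
      finally show ?thesis .
    next
      case False
      then show ?thesis using f_supp by simp
    qed
    then have "((norm (f z))\<^sup>2 + (norm (f w))\<^sup>2 - \<Lambda>\<^sup>2 * (norm (z - w))\<^sup>2 * (indicator ?S z + indicator ?S w)) / 2 * ?q z w
        \<le> Re (f z * cnj (f w)) * ?q z w"
      unfolding Re_mult_cnj by (intro mult_right_mono) auto
    also have "\<dots> = Re (?F p)"
      unfolding p by (simp del: of_real_power)
    finally show ?thesis
      unfolding p A'_def A_def using qsym[of w z]
      by (simp add: norm_minus_commute[of w z] algebra_simps add_divide_distrib diff_divide_distrib)
  qed
  have "(\<integral>z. (norm (f z))\<^sup>2 * ?E z \<partial>gaussian_measure) - \<Lambda>\<^sup>2 * R\<^sup>2 = (\<integral>p. A p + A' p \<partial>?P)"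
    using intA intA' by (simp add: valA valA')
  also have "\<dots> \<le> (\<integral>p. Re (?F p) \<partial>?P)"
    by (rule integral_mono) (use intA intA' integrable_Re[OF intF] le in auto)
  also have "\<dots> = Re (\<integral>p. ?F p \<partial>?P)"
    by (rule integral_Re[OF intF])
  finally show ?thesis
    by (simp add: kernel_variance_def exp_kernel_diag)
qed

text \<open>Dominated convergence: the bounds on the kernels over the support of \<open>f\<close> do
  not involve \<open>n\<close>.\<close>

lemma kernel_variance_ginibre_tendsto:
  "(\<lambda>n. kernel_variance (ginibre_kernel n) f) \<longlonglongrightarrow> kernel_variance exp_kernel f"
  unfolding kernel_variance_def
proof (intro tendsto_diff tendsto_Re)
  let ?P = "gaussian_measure \<Otimes>\<^sub>M gaussian_measure"
  have limK: "(\<lambda>n. ginibre_kernel n z w) \<longlonglongrightarrow> exp_kernel z w" for z w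
    unfolding exp_kernel_def by (rule ginibre_kernel_tendsto)
  interpret G: gaussian_kernel "ginibre_kernel n" for n by (rule gaussian_kernel_ginibre)
  have diag: "Re (ginibre_kernel n z z) \<le> exp (R\<^sup>2)" if "norm z \<le> R" for n z
    using G.intensity_le_cball[of z R n] that by (simp add: G.intensity_def)
  have [measurable]: "(\<lambda>z. Re (ginibre_kernel n z z)) \<in> borel_measurable borel" for n
    by measurable
  show "(\<lambda>n. \<integral>z. (norm (f z))\<^sup>2 * Re (ginibre_kernel n z z) \<partial>gaussian_measure)
      \<longlonglongrightarrow> (\<integral>z. (norm (f z))\<^sup>2 * Re (exp_kernel z z) \<partial>gaussian_measure)"
  proof (rule integral_dominated_convergence)
    show "AE z in gaussian_measure. (\<lambda>n. (norm (f z))\<^sup>2 * Re (ginibre_kernel n z z))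
        \<longlonglongrightarrow> (norm (f z))\<^sup>2 * Re (exp_kernel z z)"
      by (intro AE_I2 tendsto_intros limK)
    show "AE z in gaussian_measure. norm ((norm (f z))\<^sup>2 * Re (ginibre_kernel n z z)) \<le> B\<^sup>2 * exp (R\<^sup>2)" for n
    proof (rule AE_I2)
      show "norm ((norm (f z))\<^sup>2 * Re (ginibre_kernel n z z)) \<le> B\<^sup>2 * exp (R\<^sup>2)" for z
        using f_supp[of z] f_bound[of z] bound_nonneg diag[of z n] G.K_diag_nonneg[of n z]
        by (cases "z \<in> cball 0 R") (auto simp: abs_mult intro!: mult_mono power_mono)
    qed
    show "(\<lambda>z. (norm (f z))\<^sup>2 * Re (exp_kernel z z)) \<in> borel_measurable gaussian_measure"
      by (simp add: exp_kernel_diag)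
    show "(\<lambda>z. (norm (f z))\<^sup>2 * Re (ginibre_kernel n z z)) \<in> borel_measurable gaussian_measure" for n
      by measurable
  qed simp
  show "(\<lambda>n. \<integral>p. f (fst p) * cnj (f (snd p)) * of_real ((norm (ginibre_kernel n (fst p) (snd p)))\<^sup>2) \<partial>?P)
      \<longlonglongrightarrow> (\<integral>p. f (fst p) * cnj (f (snd p)) * of_real ((norm (exp_kernel (fst p) (snd p)))\<^sup>2) \<partial>?P)"
  proof (rule integral_dominated_convergence)
    show "AE p in ?P. (\<lambda>n. f (fst p) * cnj (f (snd p)) * of_real ((norm (ginibre_kernel n (fst p) (snd p)))\<^sup>2))
      \<longlonglongrightarrow> f (fst p) * cnj (f (snd p)) * of_real ((norm (exp_kernel (fst p) (snd p)))\<^sup>2)"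
      by (intro AE_I2 tendsto_intros limK)
    show "AE p in ?P. norm (f (fst p) * cnj (f (snd p)) * of_real ((norm (ginibre_kernel n (fst p) (snd p)))\<^sup>2))
        \<le> B * B * (exp (R\<^sup>2) * exp (R\<^sup>2))" for n
    proof (rule AE_I2)
      fix p
      show "norm (f (fst p) * cnj (f (snd p)) * of_real ((norm (ginibre_kernel n (fst p) (snd p)))\<^sup>2))
        \<le> B * B * (exp (R\<^sup>2) * exp (R\<^sup>2))"
      proof (cases "p \<in> cball 0 R \<times> cball 0 R")
        case True
        have "(norm (ginibre_kernel n (fst p) (snd p)))\<^sup>2
            \<le> Re (ginibre_kernel n (fst p) (fst p)) * Re (ginibre_kernel n (snd p) (snd p))"
          by (rule G.K_Cauchy_Schwarz)
        also have "\<dots> \<le> exp (R\<^sup>2) * exp (R\<^sup>2)"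
          using True diag[of "fst p" n] diag[of "snd p" n] G.K_diag_nonneg
          by (auto simp: mem_Times_iff intro!: mult_mono)
        finally show ?thesis
          using f_bound[of "fst p"] f_bound[of "snd p"] bound_nonneg
          by (auto simp: norm_mult norm_power intro!: mult_mono)
      next
        case False
        then have "f (fst p) = 0 \<or> f (snd p) = 0" using f_supp by (cases p) auto
        then show ?thesis using bound_nonneg by auto
      qed
    qed
    show "(\<lambda>p. f (fst p) * cnj (f (snd p)) * of_real ((norm (exp_kernel (fst p) (snd p)))\<^sup>2)) \<in> borel_measurable ?P"
      by measurable
    show "(\<lambda>p. f (fst p) * cnj (f (snd p)) * of_real ((norm (ginibre_kernel n (fst p) (snd p)))\<^sup>2)) \<in> borel_measurable ?P" for n
      by measurable
  qed simp
qed

end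

section \<open>Monotonicity of the variance in the dimension\<close>

context angular_test_function
begin

text \<open>The matrix entries of multiplication by \<open>f\<close> between normalised
  monomials.\<close>

definition coefficient :: "nat \<Rightarrow> nat \<Rightarrow> complex" where
  "coefficient k m = (\<integral>z. f z * (monomial k z * cnj (monomial m z)) \<partial>gaussian_measure)"

lemma monomial_bounded_cball: "\<exists>C. \<forall>z\<in>cball 0 R. norm (monomial k z) \<le> C"
  using compact_imp_bounded[OF compact_continuous_image[OF continuous_on_monomial[OF continuous_on_id] compact_cball]]
  by (fastforce simp: bounded_iff)

lemma integrable_monomial_product:
  "integrable gaussian_measure (\<lambda>z. f z * (monomial k z * cnj (monomial m z)))"
proof -
  obtain C where C: "\<forall>z\<in>cball 0 R. norm (monomial k z) \<le> C"
    using monomial_bounded_cball[of k] by blast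
  obtain C' where "\<forall>z\<in>cball 0 R. norm (monomial m z) \<le> C'"
    using monomial_bounded_cball[of m] by blast
  with C show ?thesis
    by (intro integrable_mult_test[where C = "C * C'"])
       (auto simp: norm_mult intro!: mult_mono intro: order_trans[OF norm_ge_zero])
qed

text \<open>Cauchy-Schwarz against the unit vector \<open>monomial m\<close>. With
  \<open>m = k - l\<close> it makes each summand of the variance non-negative.\<close>

lemma norm_coefficient_squared_le:
  "(norm (coefficient k m))\<^sup>2 \<le> (\<integral>z. (norm (f z))\<^sup>2 * (norm (monomial k z))\<^sup>2 \<partial>gaussian_measure)"
proof -
  obtain C where C: "\<And>z. z \<in> cball 0 R \<Longrightarrow> norm (monomial k z) \<le> C"
    using monomial_bounded_cball[of k] by blast
  have int: "integrable gaussian_measure (\<lambda>z. (norm (f z))\<^sup>2 * (norm (monomial k z))\<^sup>2)"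
    by (rule integrable_norm_squared_mult_test[where C = "C\<^sup>2"]) (auto intro!: power_mono C)
  have "ennreal (norm (coefficient k m))
      \<le> (\<integral>\<^sup>+z. ennreal (norm (f z) * norm (monomial k z)) * ennreal (norm (monomial m z)) \<partial>gaussian_measure)"
    unfolding coefficient_def using integral_norm_bound_ennreal[OF integrable_monomial_product[of k m]]
    by (simp add: norm_mult ennreal_mult mult.assoc)
  then have "(ennreal (norm (coefficient k m)))\<^sup>2
      \<le> (\<integral>\<^sup>+z. ennreal (norm (f z) * norm (monomial k z)) * ennreal (norm (monomial m z)) \<partial>gaussian_measure)\<^sup>2"
    by (intro power_mono) auto
  also have "\<dots> \<le> (\<integral>\<^sup>+z. (ennreal (norm (f z) * norm (monomial k z)))\<^sup>2 \<partial>gaussian_measure)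
      * (\<integral>\<^sup>+z. (ennreal (norm (monomial m z)))\<^sup>2 \<partial>gaussian_measure)"
    by (rule Cauchy_Schwarz_nn_integral) measurable
  also have "\<dots> = (\<integral>\<^sup>+z. ennreal ((norm (f z))\<^sup>2 * (norm (monomial k z))\<^sup>2) \<partial>gaussian_measure)"
    using monomial_normalized[of m] by (simp add: ennreal_power power_mult_distrib)
  also have "\<dots> = ennreal (\<integral>z. (norm (f z))\<^sup>2 * (norm (monomial k z))\<^sup>2 \<partial>gaussian_measure)"
    by (rule nn_integral_eq_integral[OF int]) simp
  finally show ?thesis
    by (simp add: ennreal_power ennreal_le_iff)
qed

text \<open>Expanding the squared kernel in monomials gives the sum of
  \<open>|coefficient k m|^2\<close> over \<open>k, m < n\<close>, where the angular frequency
  leaves only \<open>m = k - l\<close>. This index is below \<open>n\<close> whenever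
  \<open>k\<close> is, so the condition \<open>m < n\<close> removes nothing.\<close>

lemma kernel_variance_ginibre:
  "kernel_variance (ginibre_kernel n) f =
    (\<Sum>k<n. (\<integral>z. (norm (f z))\<^sup>2 * (norm (monomial k z))\<^sup>2 \<partial>gaussian_measure)
       - (if l \<le> k then (norm (coefficient k (k - l)))\<^sup>2 else 0))"
proof -
  let ?P = "gaussian_measure \<Otimes>\<^sub>M gaussian_measure"
  define g where "g k m z = f z * (monomial k z * cnj (monomial m z))" for k m z
  have gint: "integrable gaussian_measure (g k m)" for k m
    unfolding g_def by (rule integrable_monomial_product)
  have pint: "integrable ?P (\<lambda>p. g k m (fst p) * cnj (g k m (snd p)))" for k m
    by (rule integrable_pair_gaussian_mult[where h = "\<lambda>z. cnj (g k m z)"]) (auto simp: gint)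
  have sq: "f (fst p) * cnj (f (snd p)) * of_real ((norm (ginibre_kernel n (fst p) (snd p)))\<^sup>2)
      = (\<Sum>k<n. \<Sum>m<n. g k m (fst p) * cnj (g k m (snd p)))" for p
  proof -
    have "f (fst p) * cnj (f (snd p)) * of_real ((norm (ginibre_kernel n (fst p) (snd p)))\<^sup>2)
      = (\<Sum>k<n. \<Sum>m<n. f (fst p) * cnj (f (snd p)) * (monomial k (fst p) * cnj (monomial k (snd p)) *
          cnj (monomial m (fst p) * cnj (monomial m (snd p)))))"
      by (simp only: complex_norm_square ginibre_kernel_monomial cnj_sum sum_product) (simp only: sum_distrib_left)
    then show ?thesis by (simp add: g_def mult_ac)
  qed
  have "(\<integral>p. f (fst p) * cnj (f (snd p)) * of_real ((norm (ginibre_kernel n (fst p) (snd p)))\<^sup>2) \<partial>?P)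
      = (\<Sum>k<n. \<Sum>m<n. \<integral>p. g k m (fst p) * cnj (g k m (snd p)) \<partial>?P)"
    unfolding sq
    by (subst Bochner_Integration.integral_sum, intro Bochner_Integration.integrable_sum pint,
        intro sum.cong refl Bochner_Integration.integral_sum pint)
  also have "\<dots> = (\<Sum>k<n. \<Sum>m<n. of_real ((norm (coefficient k m))\<^sup>2))"
    using integral_pair_gaussian_mult[of "g k m" "\<lambda>z. cnj (g k m z)" for k m] pint
    by (simp add: complex_norm_square coefficient_def g_def[abs_def] del: of_real_power complex_cnj_mult)
  also have "\<dots> = of_real (\<Sum>k<n. \<Sum>m<n. (norm (coefficient k m))\<^sup>2)"
    by (simp del: of_real_power)
  also have "(\<Sum>k<n. \<Sum>m<n. (norm (coefficient k m))\<^sup>2)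
      = (\<Sum>k<n. if l \<le> k then (norm (coefficient k (k - l)))\<^sup>2 else 0)"
  proof (rule sum.cong[OF refl])
    fix k assume k: "k \<in> {..<n}"
    \<comment> \<open>Truncated subtraction gives \<open>k - l = 0\<close> for \<open>k < l\<close>,
      where the coefficient vanishes; hence the guard \<open>l \<le> k\<close>.\<close>
    have "(\<Sum>m<n. (norm (coefficient k m))\<^sup>2)
        = (\<Sum>m<n. if m = k - l then (if l \<le> k then (norm (coefficient k m))\<^sup>2 else 0) else 0)"
      using cross_coefficient_zero by (intro sum.cong refl) (auto simp: coefficient_def)
    then show "(\<Sum>m<n. (norm (coefficient k m))\<^sup>2) = (if l \<le> k then (norm (coefficient k (k - l)))\<^sup>2 else 0)"
      using k by (auto simp: sum.delta)
  qed
  finally have J: "Re (\<integral>p. f (fst p) * cnj (f (snd p)) * of_real ((norm (ginibre_kernel n (fst p) (snd p)))\<^sup>2) \<partial>?P)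
      = (\<Sum>k<n. if l \<le> k then (norm (coefficient k (k - l)))\<^sup>2 else 0)"
    by (simp only: Re_complex_of_real)
  have int: "integrable gaussian_measure (\<lambda>z. (norm (f z))\<^sup>2 * (norm (monomial k z))\<^sup>2)" for k
  proof -
    obtain C where C: "\<And>z. z \<in> cball 0 R \<Longrightarrow> norm (monomial k z) \<le> C"
      using monomial_bounded_cball[of k] by blast
    show ?thesis
      by (rule integrable_norm_squared_mult_test[where C = "C\<^sup>2"]) (auto intro!: power_mono C)
  qed
  have "(\<integral>z. (norm (f z))\<^sup>2 * Re (ginibre_kernel n z z) \<partial>gaussian_measure)
      = (\<Sum>k<n. \<integral>z. (norm (f z))\<^sup>2 * (norm (monomial k z))\<^sup>2 \<partial>gaussian_measure)"
    using int by (simp add: ginibre_kernel_diag sum_distrib_left Bochner_Integration.integral_sum)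
  with J show ?thesis
    by (simp add: kernel_variance_def sum_subtractf)
qed

lemma kernel_variance_ginibre_le: "kernel_variance (ginibre_kernel n) f \<le> kernel_variance exp_kernel f"
proof (rule incseq_le[OF _ kernel_variance_ginibre_tendsto])
  show "incseq (\<lambda>n. kernel_variance (ginibre_kernel n) f)"
  proof (rule incseq_SucI)
    fix n
    \<comment> \<open>The increment at degree \<open>n\<close> is this integral minus a squared
      coefficient, or the integral alone when \<open>n < l\<close>.\<close>
    have "0 \<le> (\<integral>z. (norm (f z))\<^sup>2 * (norm (monomial n z))\<^sup>2 \<partial>gaussian_measure)"
      by simp
    then show "kernel_variance (ginibre_kernel n) f \<le> kernel_variance (ginibre_kernel (Suc n)) f"
      using norm_coefficient_squared_le[of n "n - l"] by (simp add: kernel_variance_ginibre)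
  qed
qed

end

section \<open>The dyadic partition of unity\<close>

text \<open>\<open>times_cont_diff\<close> provides continuity of each directional derivative
  separately, so compactness is applied to the directions \<open>1\<close> and \<open>\<i>\<close>,
  and the sum of the two bounds controls the operator norm. The mean value inequality on the convex
  ball does the rest.\<close>

lemma times_cont_diff_1_imp_Lipschitz_cball:
  fixes f :: "complex \<Rightarrow> real"
  assumes "times_cont_diff 1 f"
  shows "\<exists>\<Lambda>\<ge>0. \<forall>z\<in>cball 0 R. \<forall>w\<in>cball 0 R. \<bar>f z - f w\<bar> \<le> \<Lambda> * norm (z - w)"
proof -
  let ?D = "\<lambda>x. frechet_derivative f (at x)"
  have der: "(f has_derivative ?D x) (at x)" for x
    using assms by (simp add: frechet_derivative_works)
  have bd: "\<exists>C. \<forall>x\<in>cball 0 R. \<bar>?D x v\<bar> \<le> C" for v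
  proof -
    have "continuous_on (cball 0 R) (\<lambda>x. ?D x v)"
      using assms by (auto intro: continuous_on_subset[OF _ subset_UNIV])
    from compact_imp_bounded[OF compact_continuous_image[OF this compact_cball]] show ?thesis
      by (auto simp: bounded_iff)
  qed
  obtain C1 where C1: "\<forall>x\<in>cball 0 R. \<bar>?D x 1\<bar> \<le> C1" using bd by blast
  obtain C2 where C2: "\<forall>x\<in>cball 0 R. \<bar>?D x \<i>\<bar> \<le> C2" using bd by blast
  have "\<bar>f z - f w\<bar> \<le> max 0 (C1 + C2) * norm (z - w)" if "z \<in> cball 0 R" "w \<in> cball 0 R" for z w
  proof -
    have "norm (f z - f w) \<le> max 0 (C1 + C2) * norm (z - w)"
    proof (rule differentiable_bound[OF convex_cball _ _ that])
      show "(f has_derivative ?D x) (at x within cball 0 R)" for x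
        by (rule has_derivative_at_withinI[OF der])
      show "onorm (?D x) \<le> max 0 (C1 + C2)" if x: "x \<in> cball 0 R" for x
      proof (rule onorm_le)
        fix h
        interpret D: bounded_linear "?D x" using der[of x] by (rule has_derivative_bounded_linear)
        have "h = Re h *\<^sub>R 1 + Im h *\<^sub>R \<i>" by (simp add: complex_eq_iff)
        then have "?D x h = Re h * ?D x 1 + Im h * ?D x \<i>"
          using D.add[of "Re h *\<^sub>R 1" "Im h *\<^sub>R \<i>"] D.scaleR by simp
        then have "\<bar>?D x h\<bar> \<le> \<bar>Re h\<bar> * \<bar>?D x 1\<bar> + \<bar>Im h\<bar> * \<bar>?D x \<i>\<bar>"
          by (metis abs_mult abs_triangle_ineq)
        also have "\<dots> \<le> norm h * C1 + norm h * C2"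
          using C1 C2 x by (intro add_mono mult_mono abs_Re_le_cmod abs_Im_le_cmod) auto
        also have "\<dots> \<le> max 0 (C1 + C2) * norm h"
          by (simp add: distrib_left[symmetric] mult.commute[of _ "norm h"] mult_left_mono)
        finally show "norm (?D x h) \<le> max 0 (C1 + C2) * norm h" by simp
      qed
    qed
    then show ?thesis by simp
  qed
  then show ?thesis by (intro exI[of _ "max 0 (C1 + C2)"] conjI ballI) auto
qed

text \<open>Telescoping by induction. At \<open>l = 0\<close> the exponent \<open>l - 1\<close> is
  truncated to 0, harmless behind the factor \<open>real l = 0\<close>.\<close>

lemma norm_power_diff_le:
  fixes a b :: complex
  assumes "norm a \<le> M" "norm b \<le> M"
  shows "norm (a ^ l - b ^ l) \<le> real l * M ^ (l - 1) * norm (a - b)"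
proof -
  have M: "0 \<le> M" using assms(1) norm_ge_zero order_trans by blast
  show ?thesis
  proof (induction l)
    case (Suc l)
    have "a ^ Suc l - b ^ Suc l = a ^ l * (a - b) + (a ^ l - b ^ l) * b"
      by (simp add: algebra_simps)
    then have "norm (a ^ Suc l - b ^ Suc l) \<le> norm (a ^ l) * norm (a - b) + norm (a ^ l - b ^ l) * norm b"
      by (metis norm_mult norm_triangle_ineq)
    also have "\<dots> \<le> M ^ l * norm (a - b) + (real l * M ^ (l - 1) * norm (a - b)) * M"
      using assms M Suc by (intro add_mono mult_mono) (auto simp: norm_power intro!: power_mono)
    also have "\<dots> = real (Suc l) * M ^ (Suc l - 1) * norm (a - b)"
      by (cases l) (auto simp: algebra_simps)
    finally show ?case .
  qed simp
qed

section \<open>Size and regularity of the cut-off\<close>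

locale cutoff_function =
  fixes r0 :: real and \<phi> :: "complex \<Rightarrow> real"
  assumes r0: "r0 > 0" and cutoff: "cutoff r0 \<phi>"
begin

lemma radial: "norm z = norm w \<Longrightarrow> \<phi> z = \<phi> w"
  using cutoff unfolding cutoff_def radial_def by blast

lemma nonneg: "0 \<le> \<phi> z"
  using cutoff by (simp add: cutoff_def)

lemma support: "\<phi> z \<noteq> 0 \<Longrightarrow> r0 \<le> norm z \<and> norm z \<le> 3 * r0"
  using cutoff closure_subset[of "{z. \<phi> z \<noteq> 0}"] by (auto simp: cutoff_def)

lemma eq_one: "3 * r0 / 2 \<le> norm z \<Longrightarrow> norm z \<le> 2 * r0 \<Longrightarrow> \<phi> z = 1"
  using cutoff by (simp add: cutoff_def)

lemma reflect:
  assumes "r0 \<le> norm z" "norm z \<le> 3 * r0 / 2"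
  shows "\<phi> z + \<phi> (2 * z) = 1"
proof -
  have "\<phi> (complex_of_real (r0 + (norm z - r0))) = 1 - \<phi> (complex_of_real (2 * r0 + 2 * (norm z - r0)))"
    using cutoff assms unfolding cutoff_def by (elim conjE) (erule allE[of _ "norm z - r0"], simp)
  moreover have "\<phi> (complex_of_real (r0 + (norm z - r0))) = \<phi> z"
    by (rule radial) simp
  moreover have "\<phi> (complex_of_real (2 * r0 + 2 * (norm z - r0))) = \<phi> (2 * z)"
    by (rule radial) (simp add: norm_mult)
  ultimately show ?thesis by simp
qed

text \<open>\<open>reflect\<close> covers radii up to \<open>3 * r0 / 2\<close>; beyond,
  \<open>2 * z\<close> has left the support and the first term is already 1. The partition of unity
  rests on this two-scale identity.\<close>

lemma dyadic_pair:
  assumes "r0 \<le> norm z" "norm z < 2 * r0"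
  shows "\<phi> z + \<phi> (2 * z) = 1"
proof (cases "norm z \<le> 3 * r0 / 2")
  case False
  then have "\<phi> (2 * z) = 0" using support[of "2 * z"] by (auto simp: norm_mult)
  then show ?thesis using False assms eq_one[of z] by simp
qed (use assms reflect in auto)

text \<open>The two-scale identity is applied at \<open>z\<close> below radius \<open>2 * r0\<close>
  and at \<open>z / 2\<close> from there on; in both cases the other term is non-negative.\<close>

lemma le_one: "\<phi> z \<le> 1"
proof (cases "\<phi> z = 0")
  case False
  then have z: "r0 \<le> norm z" "norm z \<le> 3 * r0" using support by auto
  show ?thesis
  proof (cases "norm z < 2 * r0")
    case True
    then show ?thesis using dyadic_pair[of z] z nonneg[of "2 * z"] by simp
  next
    case False
    have "\<phi> (z / 2) + \<phi> (2 * (z / 2)) = 1"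
      by (rule dyadic_pair) (use z False r0 in \<open>auto simp: norm_divide\<close>)
    then show ?thesis using nonneg[of "z / 2"] by simp
  qed
qed simp

lemma continuous: "continuous_on UNIV \<phi>"
proof -
  have "times_cont_diff 0 \<phi>" using cutoff unfolding cutoff_def smooth_def by blast
  then show ?thesis by simp
qed

lemma phi_measurable [measurable]: "\<phi> \<in> borel_measurable borel"
  by (rule borel_measurable_continuous_onI[OF continuous])

lemma Lipschitz: "\<exists>\<Lambda>\<ge>0. \<forall>z w. \<bar>\<phi> z - \<phi> w\<bar> \<le> \<Lambda> * norm (z - w)"
proof -
  have "times_cont_diff 1 \<phi>" using cutoff unfolding cutoff_def smooth_def by blast
  from times_cont_diff_1_imp_Lipschitz_cball[OF this, of "4 * r0"]
  obtain \<Lambda> where \<Lambda>: "\<Lambda> \<ge> 0"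
    "\<forall>z\<in>cball 0 (4 * r0). \<forall>w\<in>cball 0 (4 * r0). \<bar>\<phi> z - \<phi> w\<bar> \<le> \<Lambda> * norm (z - w)"
    by blast
  \<comment> \<open>The ball of radius \<open>4 * r0\<close> leaves a collar of width
    \<open>r0\<close> around the support. Across it the jump is at most 1, which accounts for the
    summand \<open>1 / r0\<close>.\<close>
  have *: "\<bar>\<phi> z - \<phi> w\<bar> \<le> (\<Lambda> + 1 / r0) * norm (z - w)" if "norm z \<le> norm w" for z w
  proof -
    consider "norm w \<le> 4 * r0" | "norm w > 4 * r0" "norm z \<le> 3 * r0" | "norm w > 4 * r0" "norm z > 3 * r0"
      by linarith
    then show ?thesis
    proof cases
      case 1
      then have "\<bar>\<phi> z - \<phi> w\<bar> \<le> \<Lambda> * norm (z - w)" using \<Lambda>(2) that by auto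
      also have "\<dots> \<le> (\<Lambda> + 1 / r0) * norm (z - w)" using r0 by (intro mult_right_mono) auto
      finally show ?thesis .
    next
      case 2
      have "\<phi> w = 0" using support[of w] 2 r0 by auto
      then have "\<bar>\<phi> z - \<phi> w\<bar> \<le> 1" using nonneg le_one by simp
      also have "1 \<le> 1 / r0 * norm (z - w)"
        using norm_triangle_ineq2[of w z] 2 r0 by (simp add: norm_minus_commute field_simps)
      also have "\<dots> \<le> (\<Lambda> + 1 / r0) * norm (z - w)" using \<Lambda>(1) by (intro mult_right_mono) auto
      finally show ?thesis .
    next
      case 3
      then have "\<phi> z = 0" "\<phi> w = 0" using support[of z] support[of w] r0 by auto
      then show ?thesis using \<Lambda>(1) r0 by simp
    qed
  qed
  have "\<bar>\<phi> z - \<phi> w\<bar> \<le> (\<Lambda> + 1 / r0) * norm (z - w)" for z w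
    using *[of z w] *[of w z] by (cases "norm z \<le> norm w") (auto simp: norm_minus_commute abs_minus_commute)
  then show ?thesis using \<Lambda>(1) r0 by (intro exI[of _ "\<Lambda> + 1 / r0"]) auto
qed

text \<open>A product estimate: \<open>\<phi>\<close> is Lipschitz and at most 1, and inversion is
  Lipschitz with constant \<open>1 / r0^2\<close> outside the disc of radius \<open>r0\<close>,
  inside which \<open>\<phi>\<close> vanishes. Ordering the points by modulus ensures that the
  larger one stays away from 0 unless both values are 0.\<close>

lemma Lipschitz_div_power:
  "\<exists>\<Lambda>\<ge>0. \<forall>z w. norm (complex_of_real (\<phi> z) / z ^ l - complex_of_real (\<phi> w) / w ^ l) \<le> \<Lambda> * norm (z - w)"
proof -
  obtain \<Lambda> where \<Lambda>: "\<Lambda> \<ge> 0" "\<And>z w. \<bar>\<phi> z - \<phi> w\<bar> \<le> \<Lambda> * norm (z - w)"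
    using Lipschitz by blast
  \<comment> \<open>The first summand is the increment of \<open>\<phi>\<close> times the bound on
    \<open>z^(-l)\<close>, the second the increment of \<open>z^(-l)\<close>, estimated as an
    \<open>l\<close>-th power of the inverse.\<close>
  define C where "C = \<Lambda> * (1 / r0) ^ l + real l * (1 / r0) ^ (l - 1) * (1 / r0\<^sup>2)"
  have inv: "norm (inverse z ^ l) \<le> (1 / r0) ^ l" if "norm z \<ge> r0" for z :: complex
    unfolding norm_power norm_inverse using that r0
    by (intro power_mono) (auto simp: divide_inverse intro!: le_imp_inverse_le)
  have *: "norm (complex_of_real (\<phi> z) / z ^ l - complex_of_real (\<phi> w) / w ^ l) \<le> C * norm (z - w)"
    if "norm w \<le> norm z" for z w
  proof (cases "norm z \<ge> r0")
    case True
    have "complex_of_real (\<phi> z) / z ^ l - complex_of_real (\<phi> w) / w ^ l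
        = of_real (\<phi> z - \<phi> w) * inverse z ^ l + of_real (\<phi> w) * (inverse z ^ l - inverse w ^ l)"
      by (simp add: algebra_simps divide_inverse power_inverse)
    then have "norm (complex_of_real (\<phi> z) / z ^ l - complex_of_real (\<phi> w) / w ^ l)
        \<le> norm (of_real (\<phi> z - \<phi> w) * inverse z ^ l) + norm (of_real (\<phi> w) * (inverse z ^ l - inverse w ^ l))"
      by (metis norm_triangle_ineq)
    also have "\<dots> = \<bar>\<phi> z - \<phi> w\<bar> * norm (inverse z ^ l) + \<phi> w * norm (inverse z ^ l - inverse w ^ l)"
      using nonneg[of w] by (simp only: norm_mult norm_of_real abs_of_nonneg)
    also have "\<dots> \<le> (\<Lambda> * norm (z - w)) * (1 / r0) ^ l
        + real l * (1 / r0) ^ (l - 1) * (1 / r0\<^sup>2 * norm (z - w))"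
    proof (rule add_mono)
      show "\<bar>\<phi> z - \<phi> w\<bar> * norm (inverse z ^ l) \<le> (\<Lambda> * norm (z - w)) * (1 / r0) ^ l"
        using \<Lambda> inv[OF True] by (intro mult_mono) auto
      show "\<phi> w * norm (inverse z ^ l - inverse w ^ l) \<le> real l * (1 / r0) ^ (l - 1) * (1 / r0\<^sup>2 * norm (z - w))"
      proof (cases "\<phi> w = 0")
        case False
        then have w: "norm w \<ge> r0" using support by auto
        have nz: "z \<noteq> 0" "w \<noteq> 0" using True w r0 by auto
        have le: "norm (inverse z) \<le> 1 / r0" "norm (inverse w) \<le> 1 / r0"
          using True w r0 by (auto simp: norm_inverse divide_inverse intro!: le_imp_inverse_le)
        have "norm (inverse z - inverse w) = norm (inverse z) * norm (inverse w) * norm (z - w)"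
          using nz by (simp add: inverse_diff_inverse norm_mult norm_minus_commute mult_ac)
        also have "\<dots> \<le> (1 / r0) * (1 / r0) * norm (z - w)"
          using le r0 by (intro mult_mono) auto
        finally have d: "norm (inverse z - inverse w) \<le> 1 / r0\<^sup>2 * norm (z - w)"
          by (simp add: power2_eq_square)
        have "\<phi> w * norm (inverse z ^ l - inverse w ^ l) \<le> 1 * norm (inverse z ^ l - inverse w ^ l)"
          by (intro mult_right_mono le_one) auto
        also have "\<dots> \<le> real l * (1 / r0) ^ (l - 1) * norm (inverse z - inverse w)"
          using norm_power_diff_le[OF le] by simp
        also have "\<dots> \<le> real l * (1 / r0) ^ (l - 1) * (1 / r0\<^sup>2 * norm (z - w))"
          using r0 by (intro mult_left_mono d) simp
        finally show ?thesis .
      qed (use r0 in simp)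
    qed
    also have "\<dots> = C * norm (z - w)" by (simp add: C_def algebra_simps)
    finally show ?thesis .
  next
    case False
    then have "\<phi> z = 0" "\<phi> w = 0" using support[of z] support[of w] that by auto
    moreover have "0 \<le> C" using \<Lambda>(1) r0 by (simp add: C_def)
    ultimately show ?thesis by simp
  qed
  have "norm (complex_of_real (\<phi> z) / z ^ l - complex_of_real (\<phi> w) / w ^ l) \<le> C * norm (z - w)" for z w
    using *[of z w] *[of w z] by (cases "norm w \<le> norm z") (auto simp: norm_minus_commute)
  moreover have "0 \<le> C" using \<Lambda>(1) r0 by (simp add: C_def)
  ultimately show ?thesis by blast
qed

section \<open>Dyadic dilates and their sum\<close>

lemma dilate_measurable [measurable]: "dilate L \<phi> \<in> borel_measurable borel"
  unfolding dilate_def by measurable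

lemma dilate_nonneg: "0 \<le> dilate L \<phi> z"
  by (simp add: dilate_def nonneg)

lemma dilate_le_one: "dilate L \<phi> z \<le> 1"
  by (simp add: dilate_def le_one)

lemma dilate_support: "dilate (2 ^ j) \<phi> z \<noteq> 0 \<Longrightarrow> r0 * 2 ^ j \<le> norm z \<and> norm z \<le> 3 * r0 * 2 ^ j"
  using support[of "z / complex_of_real (2 ^ j)"] by (simp add: dilate_def norm_divide norm_power field_simps)

lemma cutoff_tilde_measurable [measurable]: "cutoff_tilde r0 \<phi> \<in> borel_measurable borel"
  unfolding cutoff_tilde_def by measurable

lemma cutoff_tilde_nonneg: "0 \<le> cutoff_tilde r0 \<phi> z"
  by (simp add: cutoff_tilde_def nonneg)

lemma cutoff_tilde_le_one: "cutoff_tilde r0 \<phi> z \<le> 1"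
  by (simp add: cutoff_tilde_def le_one)

lemma cutoff_tilde_support: "cutoff_tilde r0 \<phi> z \<noteq> 0 \<Longrightarrow> r0 \<le> norm z \<and> norm z \<le> 3 * r0"
  using support[of z] r0 by (auto simp: cutoff_tilde_def split: if_splits)

lemma partition_of_unity:
  assumes z: "r0 \<le> norm z"
  shows "(\<lambda>j. dilate (2 ^ (1 + j)) \<phi> z) sums (1 - cutoff_tilde r0 \<phi> z)"
proof -
  let ?w = "\<lambda>i. dilate (2 ^ i) \<phi> z"
  have zero: "?w i = 0" if "norm z < r0 * 2 ^ i \<or> 3 * r0 * 2 ^ i < norm z" for i
  proof (rule ccontr)
    assume "?w i \<noteq> 0"
    from dilate_support[OF this] that show False by linarith
  qed
  \<comment> \<open>The dyadic index of \<open>z\<close>, with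
    \<open>r0 * 2 ^ m \<le> norm z\<close> and \<open>norm z < r0 * 2 ^ Suc m\<close>. Only the
    scales \<open>m\<close> and \<open>m - 1\<close> can then be non-zero at
    \<open>z\<close>.\<close>
  define m where "m = (LEAST m. norm z < r0 * 2 ^ Suc m)"
  obtain m' where "norm z / r0 < 2 ^ m'"
    using real_arch_pow[of 2 "norm z / r0"] by auto
  then have "norm z < r0 * 2 ^ m'"
    using r0 by (simp add: field_simps)
  also have "\<dots> \<le> r0 * 2 ^ Suc m'"
    using r0 by (intro mult_left_mono power_increasing) auto
  finally have "norm z < r0 * 2 ^ Suc m'" .
  then have m1: "norm z < r0 * 2 ^ Suc m" unfolding m_def by (rule LeastI)
  show ?thesis
  proof (cases m)
    case 0
    have "?w (1 + j) = 0" for j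
    proof (rule zero, rule disjI1)
      have "r0 * 2 ^ Suc m \<le> r0 * 2 ^ (1 + j)"
        using r0 0 by simp
      then show "norm z < r0 * 2 ^ (1 + j)" using m1 by linarith
    qed
    moreover have "cutoff_tilde r0 \<phi> z = 1"
      using z m1 0 eq_one[of z] by (auto simp: cutoff_tilde_def)
    ultimately show ?thesis by simp
  next
    case (Suc m'')
    have m0: "r0 * 2 ^ m \<le> norm z"
    proof -
      have "m'' < m" using Suc by simp
      then have "\<not> norm z < r0 * 2 ^ Suc m''" unfolding m_def by (rule not_less_Least)
      then show ?thesis by (simp add: Suc)
    qed
    let ?s = "z / complex_of_real (2 ^ m)"
    have s2: "z / complex_of_real (2 ^ m'') = 2 * ?s"
      by (simp add: Suc)
    \<comment> \<open>\<open>z / 2 ^ m\<close> lies between the radii \<open>r0\<close> and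
      \<open>2 * r0\<close>, and the previous scale evaluates \<open>\<phi>\<close> at its double:
      this is \<open>dyadic_pair\<close>.\<close>
    have "?w m + ?w m'' = 1"
      unfolding dilate_def s2
      by (rule dyadic_pair) (use m0 m1 in \<open>auto simp: norm_divide norm_power field_simps\<close>)
    moreover have "?w i = 0" if "i \<notin> {m'', m}" for i
    proof (rule zero)
      consider "i \<ge> Suc m" | "m'' \<ge> Suc i" using \<open>i \<notin> {m'', m}\<close> Suc by force
      then show "norm z < r0 * 2 ^ i \<or> 3 * r0 * 2 ^ i < norm z"
      proof cases
        case 1
        then have "r0 * 2 ^ Suc m \<le> r0 * 2 ^ i" using r0 by (intro mult_left_mono power_increasing) auto
        then show ?thesis using m1 by linarith
      next
        case 2
        then have "(2::real) ^ Suc i \<le> 2 ^ m''" by (intro power_increasing) auto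
        then have "4 * (2::real) ^ i \<le> 2 ^ m" by (simp add: Suc)
        then have "r0 * (4 * 2 ^ i) \<le> r0 * 2 ^ m" using r0 by (intro mult_left_mono) auto
        moreover have "3 * r0 * 2 ^ i < r0 * (4 * 2 ^ i)" using r0 by simp
        ultimately show ?thesis using m0 by linarith
      qed
    qed
    then have "?w sums (\<Sum>i\<in>{m'', m}. ?w i)"
      by (intro sums_finite) auto
    ultimately have "?w sums 1" using Suc by (simp add: add.commute)
    then have "(\<lambda>j. ?w (Suc j)) sums (1 - ?w 0)"
      by (subst sums_Suc_iff) simp
    \<comment> \<open>Scale 0 is absent from the series. For \<open>m \<ge> 1\<close> the point lies
      at radius at least \<open>2 * r0\<close>, where \<open>cutoff_tilde\<close> agrees with
      \<open>\<phi>\<close>.\<close>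
    moreover have "?w 0 = cutoff_tilde r0 \<phi> z"
    proof -
      have "r0 * 2 ^ 1 \<le> r0 * 2 ^ m" using r0 Suc by (intro mult_left_mono power_increasing) auto
      with m0 have "r0 * 2 \<le> norm z" by (simp only: power_one_right)
      then have "3 * r0 / 2 < norm z" using r0 by simp
      then show ?thesis by (simp add: dilate_def cutoff_tilde_def)
    qed
    ultimately show ?thesis by simp
  qed
qed

lemma partition_zero:
  assumes "norm z < r0"
  shows "cutoff_tilde r0 \<phi> z = 0" "dilate (2 ^ j) \<phi> z = 0"
proof -
  show "cutoff_tilde r0 \<phi> z = 0" using cutoff_tilde_support[of z] assms by auto
  have "r0 * 1 \<le> r0 * 2 ^ j" using r0 by (intro mult_left_mono) auto
  then show "dilate (2 ^ j) \<phi> z = 0" using dilate_support[of j z] assms by auto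
qed

end

section \<open>First moments of inverse power sums\<close>

text \<open>Adding up the first moments shows the sum of the norms to be integrable, hence finite
  almost surely, which is absolute convergence. The factor 2 bounds \<open>1 / (1 - q)\<close> for
  \<open>q \<le> 1 / 2\<close>.\<close>

lemma (in prob_space) geometric_tail:
  fixes Y :: "nat \<Rightarrow> 'a \<Rightarrow> 'b::{banach, second_countable_topology}"
  assumes Y: "\<And>j. integrable M (Y j)"
    and C: "\<And>j. (\<integral>x. norm (Y j x) \<partial>M) \<le> C * q ^ j" and q: "0 < q" "q \<le> 1 / 2"
  shows "AE x in M. summable (\<lambda>j. norm (Y j x))"
    and "integrable M (\<lambda>x. \<Sum>j. Y (k + j) x)"
    and "(\<integral>x. norm (\<Sum>j. Y (k + j) x) \<partial>M) \<le> 2 * C * q ^ k"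
proof -
  have q1: "norm q < 1" using q by simp
  have sumC: "summable (\<lambda>j. C * q ^ j)"
    by (intro summable_mult summable_geometric q1)
  have "0 \<le> (\<integral>x. norm (Y 0 x) \<partial>M)" by simp
  from order_trans[OF this C[of 0]] have C0: "0 \<le> C" by simp
  have "(\<integral>\<^sup>+x. (\<Sum>j. ennreal (norm (Y j x))) \<partial>M) = (\<Sum>j. \<integral>\<^sup>+x. ennreal (norm (Y j x)) \<partial>M)"
    using Y by (intro nn_integral_suminf) auto
  also have "\<dots> = (\<Sum>j. ennreal (\<integral>x. norm (Y j x) \<partial>M))"
    using Y by (intro suminf_cong nn_integral_eq_integral) auto
  also have "\<dots> \<le> (\<Sum>j. ennreal (C * q ^ j))"
    by (intro suminf_le ennreal_leI C) auto
  also have "\<dots> = ennreal (\<Sum>j. C * q ^ j)"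
    using C0 q by (intro suminf_ennreal2 sumC) auto
  finally have "(\<integral>\<^sup>+x. (\<Sum>j. ennreal (norm (Y j x))) \<partial>M) < \<infinity>"
    by (rule le_less_trans) simp
  then have "(\<integral>\<^sup>+x. (\<Sum>j. ennreal (norm (Y j x))) \<partial>M) \<noteq> \<infinity>" by simp
  then have "AE x in M. (\<Sum>j. ennreal (norm (Y j x))) \<noteq> \<infinity>"
    using Y by (intro nn_integral_PInf_AE) auto
  then show AE: "AE x in M. summable (\<lambda>j. norm (Y j x))"
    by eventually_elim (rule summable_suminf_not_top, simp_all)
  then have AEk: "AE x in M. summable (\<lambda>j. norm (Y (k + j) x))"
  proof eventually_elim
    case (elim x)
    from summable_ignore_initial_segment[OF this, of k] show ?case by (simp add: add.commute)
  qed
  have bound: "(\<integral>x. norm (Y (k + j) x) \<partial>M) \<le> C * q ^ k * q ^ j" for j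
    using C[of "k + j"] by (simp add: power_add mult.assoc)
  have sumk: "summable (\<lambda>j. C * q ^ k * q ^ j)"
    by (intro summable_mult summable_geometric q1)
  have sum: "summable (\<lambda>j. \<integral>x. norm (Y (k + j) x) \<partial>M)"
    by (rule summable_comparison_test[OF _ sumk]) (use bound in auto)
  show int: "integrable M (\<lambda>x. \<Sum>j. Y (k + j) x)"
    by (rule integrable_suminf[OF Y AEk sum])
  have nint: "integrable M (\<lambda>x. \<Sum>j. norm (Y (k + j) x))"
    by (rule integrable_suminf) (use Y AEk sum in auto)
  have "(\<integral>x. norm (\<Sum>j. Y (k + j) x) \<partial>M) \<le> (\<integral>x. (\<Sum>j. norm (Y (k + j) x)) \<partial>M)"
  proof (rule integral_mono_AE)
    show "AE x in M. norm (\<Sum>j. Y (k + j) x) \<le> (\<Sum>j. norm (Y (k + j) x))"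
      using AEk by eventually_elim (rule summable_norm)
  qed (use int nint in auto)
  also have "\<dots> = (\<Sum>j. \<integral>x. norm (Y (k + j) x) \<partial>M)"
    by (rule integral_suminf) (use Y AEk sum in auto)
  also have "\<dots> \<le> (\<Sum>j. C * q ^ k * q ^ j)"
    by (rule suminf_le[OF bound sum sumk])
  also have "\<dots> = C * q ^ k * (1 / (1 - q))"
    by (simp only: suminf_mult[OF summable_geometric[OF q1]] suminf_geometric[OF q1])
  also have "\<dots> \<le> C * q ^ k * 2"
    using q C0 by (intro mult_left_mono) (auto simp: field_simps)
  finally show "(\<integral>x. norm (\<Sum>j. Y (k + j) x) \<partial>M) \<le> 2 * C * q ^ k"
    by (simp add: mult_ac)
qed

text \<open>Cauchy-Schwarz, read off from the non-negativity of the variance of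
  \<open>norm (Y x)\<close>.\<close>

lemma (in prob_space) first_moment_le_second_moment:
  fixes Y :: "'a \<Rightarrow> complex"
  assumes Y: "Y \<in> borel_measurable M" and sq: "integrable M (\<lambda>x. (norm (Y x))\<^sup>2)"
    and c: "(\<integral>x. (norm (Y x))\<^sup>2 \<partial>M) \<le> c\<^sup>2" "0 \<le> c"
  shows "integrable M Y" "(\<integral>x. norm (Y x) \<partial>M) \<le> c"
proof -
  have int: "integrable M (\<lambda>x. norm (Y x))"
    by (rule square_integrable_imp_integrable[OF _ sq]) (use Y in measurable)
  then show "integrable M Y" using Y by (simp add: integrable_norm_iff)
  have "0 \<le> variance (\<lambda>x. norm (Y x))" by (rule variance_positive)
  also have "variance (\<lambda>x. norm (Y x)) = (\<integral>x. (norm (Y x))\<^sup>2 \<partial>M) - (\<integral>x. norm (Y x) \<partial>M)\<^sup>2"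
    by (rule variance_eq[OF int sq])
  finally have "(\<integral>x. norm (Y x) \<partial>M)\<^sup>2 \<le> c\<^sup>2" using c(1) by linarith
  then show "(\<integral>x. norm (Y x) \<partial>M) \<le> c"
    using c(2) by (rule power2_le_imp_le)
qed

text \<open>What the moment bounds use of either ensemble. \<open>variance_le\<close> comes from
  monotonicity in the dimension for the finite ensembles and is an equality for the infinite
  one.\<close>

locale ginibre_process = gaussian_determinantal M X K
  for M :: "'a measure" and X :: "'a \<Rightarrow> complex set" and K :: "complex \<Rightarrow> complex \<Rightarrow> complex" +
  assumes intensity_radial: "norm u = 1 \<Longrightarrow> intensity (u * z) = intensity z"
    and variance_le: "angular_test_function f B R l \<Longrightarrow> kernel_variance K f \<le> kernel_variance exp_kernel f"
begin

text \<open>Each term is at most \<open>1 / a ^ l\<close>, and the mean number of points in the disc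
  of radius \<open>b\<close> is at most its area over \<open>pi\<close>, that is \<open>b^2\<close>.
  No cancellation enters, so the bound serves the absolute sums and the innermost annulus
  alike.\<close>

lemma abs_lin_stat_moment:
  assumes [measurable]: "\<psi> \<in> borel_measurable borel" and \<psi>: "\<And>z. 0 \<le> \<psi> z" "\<And>z. \<psi> z \<le> 1"
    and supp: "\<And>z. \<psi> z \<noteq> 0 \<Longrightarrow> a \<le> norm z \<and> norm z \<le> b" and ab: "0 < a" "0 \<le> b"
  shows "integrable M (\<lambda>x. abs_lin_stat \<psi> l (X x))" "(\<integral>x. \<bar>abs_lin_stat \<psi> l (X x)\<bar> \<partial>M) \<le> b\<^sup>2 / a ^ l"
    and "integrable M (\<lambda>x. lin_stat \<psi> l (X x))" "(\<integral>x. norm (lin_stat \<psi> l (X x)) \<partial>M) \<le> b\<^sup>2 / a ^ l"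
proof -
  let ?B = "cball 0 b :: complex set"
  have [measurable]: "?B \<in> sets borel" by simp
  have zero: "\<psi> z = 0" if "z \<notin> ?B" for z
    using supp[of z] that by auto
  have fin: "finite (X x \<inter> ?B)" if "x \<in> space M" for x
    by (rule point_process_finite[OF process that]) simp
  have a_eq: "abs_lin_stat \<psi> l (X x) = (\<Sum>z\<in>X x \<inter> ?B. \<psi> z / norm z ^ l)" if "x \<in> space M" for x
    unfolding abs_lin_stat_def
    by (rule integral_pts_measure_finite) (use fin[OF that] zero in auto)
  have l_eq: "lin_stat \<psi> l (X x) = (\<Sum>z\<in>X x \<inter> ?B. of_real (\<psi> z) / z ^ l)" if "x \<in> space M" for x
    unfolding lin_stat_def
    by (rule integral_pts_measure_finite) (use fin[OF that] zero in auto)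
  have aM: "(\<lambda>x. abs_lin_stat \<psi> l (X x)) \<in> borel_measurable M"
    unfolding abs_lin_stat_def
    by (rule measurable_integral_pts_measure_real[OF process, where A = ?B]) (use zero in auto)
  have lM: "(\<lambda>x. lin_stat \<psi> l (X x)) \<in> borel_measurable M"
    unfolding lin_stat_def
    by (rule measurable_integral_pts_measure[OF process, where A = ?B]) (use zero in auto)
  have a0: "0 \<le> abs_lin_stat \<psi> l (X x)" for x
    unfolding abs_lin_stat_def using \<psi> by (intro integral_nonneg_AE) auto
  have "(\<integral>\<^sup>+x. ennreal (abs_lin_stat \<psi> l (X x)) \<partial>M)
      = (\<integral>\<^sup>+x. (\<integral>\<^sup>+z. ennreal (\<psi> z / norm z ^ l) \<partial>pts_measure (X x)) \<partial>M)"
  proof (rule nn_integral_cong)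
    fix x assume x: "x \<in> space M"
    have "(\<integral>\<^sup>+z. ennreal (\<psi> z / norm z ^ l) \<partial>pts_measure (X x)) = (\<Sum>z\<in>X x \<inter> ?B. ennreal (\<psi> z / norm z ^ l))"
      by (rule nn_integral_pts_measure_finite) (use fin[OF x] zero in auto)
    then show "ennreal (abs_lin_stat \<psi> l (X x)) = (\<integral>\<^sup>+z. ennreal (\<psi> z / norm z ^ l) \<partial>pts_measure (X x))"
      using \<psi> by (simp add: a_eq[OF x])
  qed
  also have "\<dots> = (\<integral>\<^sup>+z. ennreal (\<psi> z / norm z ^ l) * ennreal (intensity z) \<partial>gaussian_measure)"
    by (rule Campbell) measurable
  also have "\<dots> \<le> (\<integral>\<^sup>+z. ennreal (1 / a ^ l) * (ennreal (intensity z) * indicator ?B z) \<partial>gaussian_measure)"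
  proof (rule nn_integral_mono)
    fix z
    show "ennreal (\<psi> z / norm z ^ l) * ennreal (intensity z)
        \<le> ennreal (1 / a ^ l) * (ennreal (intensity z) * indicator ?B z)"
    proof (cases "\<psi> z = 0")
      case False
      then have z: "a \<le> norm z" "norm z \<le> b" using supp by auto
      have "\<psi> z / norm z ^ l \<le> 1 / a ^ l"
        using z ab \<psi> by (intro frac_le power_mono) auto
      then show ?thesis using z by (auto intro!: mult_right_mono ennreal_leI)
    qed simp
  qed
  also have "\<dots> = ennreal (1 / a ^ l) * (\<integral>\<^sup>+z\<in>?B. ennreal (intensity z) \<partial>gaussian_measure)"
    by (rule nn_integral_cmult) measurable
  also have "\<dots> \<le> ennreal (1 / a ^ l) * (ennreal (1 / pi) * emeasure lborel ?B)"
    by (intro mult_left_mono nn_integral_intensity_le) auto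
  also have "emeasure lborel ?B = ennreal (pi * b\<^sup>2)"
    using ab by (simp add: emeasure_cball eval_unit_ball_vol)
  also have "ennreal (1 / a ^ l) * (ennreal (1 / pi) * ennreal (pi * b\<^sup>2)) = ennreal (b\<^sup>2 / a ^ l)"
    using ab by (simp add: ennreal_mult'[symmetric])
  finally have nn: "(\<integral>\<^sup>+x. ennreal (abs_lin_stat \<psi> l (X x)) \<partial>M) \<le> ennreal (b\<^sup>2 / a ^ l)" .
  show int: "integrable M (\<lambda>x. abs_lin_stat \<psi> l (X x))"
  proof (rule integrableI_nonneg[OF aM])
    show "(\<integral>\<^sup>+x. ennreal (abs_lin_stat \<psi> l (X x)) \<partial>M) < \<infinity>"
      by (rule le_less_trans[OF nn]) simp
  qed (simp add: a0)
  have "ennreal (\<integral>x. abs_lin_stat \<psi> l (X x) \<partial>M) \<le> ennreal (b\<^sup>2 / a ^ l)"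
    using nn_integral_eq_integral[OF int] nn a0 by simp
  then have val: "(\<integral>x. abs_lin_stat \<psi> l (X x) \<partial>M) \<le> b\<^sup>2 / a ^ l"
    using ab by (simp add: ennreal_le_iff)
  then show "(\<integral>x. \<bar>abs_lin_stat \<psi> l (X x)\<bar> \<partial>M) \<le> b\<^sup>2 / a ^ l"
    using a0 by simp
  have le: "norm (lin_stat \<psi> l (X x)) \<le> abs_lin_stat \<psi> l (X x)" if "x \<in> space M" for x
    unfolding a_eq[OF that] l_eq[OF that] using \<psi>
    by (intro sum_norm_le) (simp add: norm_divide norm_power)
  show lint: "integrable M (\<lambda>x. lin_stat \<psi> l (X x))"
    by (rule Bochner_Integration.integrable_bound[OF int lM]) (use le a0 in auto)
  have "(\<integral>x. norm (lin_stat \<psi> l (X x)) \<partial>M) \<le> (\<integral>x. abs_lin_stat \<psi> l (X x) \<partial>M)"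
    by (rule integral_mono) (use lint int le in auto)
  then show "(\<integral>x. norm (lin_stat \<psi> l (X x)) \<partial>M) \<le> b\<^sup>2 / a ^ l"
    using val by linarith
qed

text \<open>Cancellation: the mean vanishes by rotation invariance, and \<open>L ^ l\<close> times the test function at
  scale \<open>L\<close> is the dilation of a fixed Lipschitz function, whose variance is bounded in \<open>L\<close>.\<close>

lemma lin_stat_dilate_moment:
  assumes "cutoff_function r0 \<phi>" and l: "l \<ge> 1" and \<Lambda>: "\<Lambda> \<ge> 0"
    "\<And>z w. norm (complex_of_real (\<phi> z) / z ^ l - complex_of_real (\<phi> w) / w ^ l) \<le> \<Lambda> * norm (z - w)"
  shows "integrable M (\<lambda>x. lin_stat (dilate (2 ^ j) \<phi>) l (X x))"
    and "(\<integral>x. norm (lin_stat (dilate (2 ^ j) \<phi>) l (X x)) \<partial>M) \<le> 3 * r0 * \<Lambda> * ((1 / 2) ^ l) ^ j"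
proof -
  interpret c: cutoff_function r0 \<phi> by fact
  define L :: real where "L = 2 ^ j"
  have L: "L \<ge> 1" by (simp add: L_def)
  define f where "f z = complex_of_real (dilate L \<phi> z) / z ^ l" for z
  \<comment> \<open>The factor \<open>L ^ l\<close> comes from rescaling the values and one more
    \<open>L\<close> from rescaling the argument. Against the support radius \<open>R\<close> of
    order \<open>L\<close>, the bound \<open>\<Lambda>' * R\<close> on the standard deviation decays
    like \<open>L^(-l)\<close>.\<close>
  define \<Lambda>' where "\<Lambda>' = \<Lambda> / L ^ (l + 1)"
  have f_eq: "f z = (complex_of_real (\<phi> (z / L)) / (z / L) ^ l) / L ^ l" for z
    using L by (simp add: f_def dilate_def power_divide)
  have Lip: "norm (f z - f w) \<le> \<Lambda>' * norm (z - w)" for z w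
  proof -
    have "norm (f z - f w) = norm (complex_of_real (\<phi> (z / L)) / (z / L) ^ l - complex_of_real (\<phi> (w / L)) / (w / L) ^ l) / L ^ l"
      unfolding f_eq diff_divide_distrib[symmetric] using L by (simp add: norm_divide norm_power)
    also have "\<dots> \<le> \<Lambda> * norm (z / L - w / L) / L ^ l"
      using L by (intro divide_right_mono \<Lambda>(2)) auto
    also have "norm (z / L - w / L) = norm (z - w) / L"
      unfolding diff_divide_distrib[symmetric] using L by (simp add: norm_divide)
    finally show ?thesis by (simp add: \<Lambda>'_def)
  qed
  have \<Lambda>'0: "0 \<le> \<Lambda>'" using \<Lambda>(1) L by (simp add: \<Lambda>'_def)
  define R where "R = 3 * r0 * L"
  have R0: "0 \<le> R" using c.r0 L by (simp add: R_def)
  have supp: "f z = 0" if "z \<notin> cball 0 R" for z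
    using c.dilate_support[of j z] that by (auto simp: f_def L_def R_def)
  have "angular_test_function f (1 / r0 ^ l) R l"
  proof
    have "\<Lambda>'-lipschitz_on UNIV f"
      by (rule lipschitz_onI) (use Lip \<Lambda>'0 in \<open>auto simp: dist_norm\<close>)
    then show "continuous_on UNIV f" by (rule lipschitz_on_continuous_on)
    show "norm (f z) \<le> 1 / r0 ^ l" for z
    proof (cases "dilate L \<phi> z = 0")
      case False
      then have "r0 * 2 ^ j \<le> norm z" using c.dilate_support[of j z] by (simp add: L_def)
      moreover have "r0 * 1 \<le> r0 * 2 ^ j" using c.r0 by (intro mult_left_mono) auto
      ultimately have "r0 \<le> norm z" by linarith
      then show ?thesis
        using c.r0 c.dilate_nonneg[of L z] c.dilate_le_one[of L z]
        by (auto simp: f_def norm_divide norm_power intro!: frac_le power_mono)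
    qed (use c.r0 in \<open>simp add: f_def\<close>)
    show "f z = 0" if "z \<notin> cball 0 R" for z using supp[OF that] .
    show "1 \<le> l" by (rule l)
    show "f (u * z) = u powi (- int l) * f z" if u: "norm u = 1" for u z
    proof -
      have "dilate L \<phi> (u * z) = dilate L \<phi> z"
        unfolding dilate_def by (rule c.radial) (simp add: norm_divide norm_mult u)
      then show ?thesis
        by (simp add: f_def power_mult_distrib power_int_minus divide_inverse mult_ac)
    qed
  qed
  then interpret f: angular_test_function f "1 / r0 ^ l" R l .
  have lin: "lin_stat (dilate (2 ^ j) \<phi>) l (X x) = (\<integral>z. f z \<partial>pts_measure (X x))" for x
    by (simp add: lin_stat_def f_def L_def)
  note sm = second_moment_angular[OF f.angular_test_function_axioms intensity_radial]
  have "kernel_variance K f \<le> \<Lambda>'\<^sup>2 * R\<^sup>2"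
    using variance_le[OF f.angular_test_function_axioms] f.kernel_variance_exp_le[OF Lip R0] by linarith
  also have "\<dots> = (\<Lambda>' * R)\<^sup>2" by (simp add: power_mult_distrib)
  finally have var: "(\<integral>x. (norm (lin_stat (dilate (2 ^ j) \<phi>) l (X x)))\<^sup>2 \<partial>M) \<le> (\<Lambda>' * R)\<^sup>2"
    by (simp add: lin sm(2))
  have "((1 / 2 :: real) ^ l) ^ j = ((1 / 2) ^ j) ^ l"
    by (simp only: power_mult[symmetric] mult.commute[of l j])
  also have "\<dots> = 1 / L ^ l" by (simp only: L_def power_one_over)
  finally have eq: "\<Lambda>' * R = 3 * r0 * \<Lambda> * ((1 / 2) ^ l) ^ j"
    using L by (simp add: \<Lambda>'_def R_def)
  have meas: "(\<lambda>x. lin_stat (dilate (2 ^ j) \<phi>) l (X x)) \<in> borel_measurable M"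
    unfolding lin
    by (rule measurable_integral_pts_measure[OF process f.f_measurable, where A = "cball 0 R"]) (use supp in auto)
  have sq: "integrable M (\<lambda>x. (norm (lin_stat (dilate (2 ^ j) \<phi>) l (X x)))\<^sup>2)"
    unfolding lin by (rule sm(1))
  note first = determinantal.first_moment_le_second_moment[OF meas sq var mult_nonneg_nonneg[OF \<Lambda>'0 R0], unfolded eq]
  show "integrable M (\<lambda>x. lin_stat (dilate (2 ^ j) \<phi>) l (X x))"
    by (rule first(1))
  show "(\<integral>x. norm (lin_stat (dilate (2 ^ j) \<phi>) l (X x)) \<partial>M) \<le> 3 * r0 * \<Lambda> * ((1 / 2) ^ l) ^ j"
    by (rule first(2))
qed

end

section \<open>Pathwise identities for point configurations\<close>

lemma lin_stat_finite:
  assumes "finite X" "\<psi> \<in> borel_measurable borel"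
  shows "lin_stat \<psi> l X = (\<Sum>z\<in>X. of_real (\<psi> z) / z ^ l)"
  unfolding lin_stat_def
  by (subst integral_pts_measure_finite[where A = UNIV]) (use assms in auto)

lemma abs_lin_stat_finite:
  assumes "finite (X \<inter> A)" "\<psi> \<in> borel_measurable borel" "\<And>z. z \<notin> A \<Longrightarrow> \<psi> z = 0"
  shows "abs_lin_stat \<psi> l X = (\<Sum>z\<in>X \<inter> A. \<psi> z / norm z ^ l)"
  unfolding abs_lin_stat_def
  by (subst integral_pts_measure_finite[where A = A]) (use assms in auto)

context cutoff_function
begin

text \<open>The partition of unity on the whole plane: inside the disc all terms vanish, as does the
  indicator.\<close>

lemma partition_sums:
  "(\<lambda>j. dilate (2 ^ (1 + j)) \<phi> z) sums (indicator (- ball 0 r0) z - cutoff_tilde r0 \<phi> z)"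
proof (cases "norm z < r0")
  case True
  then have "(\<lambda>j. dilate (2 ^ (1 + j)) \<phi> z) = (\<lambda>_. 0)"
    by (intro ext partition_zero(2))
  then show ?thesis using True partition_zero(1)[OF True] by (simp only:) simp
next
  case False
  then show ?thesis using partition_of_unity[of z] by simp
qed

text \<open>For finitely many points the sums over scales and over points can be exchanged, and the
  partition of unity applies at each point.\<close>

lemma inv_power_sum_finite:
  assumes fin: "finite X"
  shows "summable (\<lambda>j. lin_stat (dilate (2 ^ j) \<phi>) l X)"
    and "inv_power_sum r0 \<phi> l X = (\<Sum>w\<in>X \<inter> - ball 0 r0. 1 / w ^ l)"
proof -
  have s: "(\<lambda>j. lin_stat (dilate (2 ^ (1 + j)) \<phi>) l X) sums
      (\<Sum>z\<in>X. of_real (indicator (- ball 0 r0) z - cutoff_tilde r0 \<phi> z) / z ^ l)"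
    unfolding lin_stat_finite[OF fin dilate_measurable]
    by (intro sums_sum sums_divide sums_of_real partition_sums)
  \<comment> \<open>The partition starts at scale 1, the claimed summability at scale 0; one term
    does not affect convergence.\<close>
  then have "summable (\<lambda>j. lin_stat (dilate (2 ^ Suc j) \<phi>) l X)"
    by (simp add: sums_iff)
  then show "summable (\<lambda>j. lin_stat (dilate (2 ^ j) \<phi>) l X)"
    by (subst (asm) summable_Suc_iff)
  have "inv_power_sum r0 \<phi> l X = (\<Sum>z\<in>X. of_real (indicator (- ball 0 r0) z) / z ^ l)"
    unfolding inv_power_sum_def inv_power_tail_def sums_unique[OF s, symmetric]
      lin_stat_finite[OF fin cutoff_tilde_measurable] sum.distrib[symmetric]
    by (simp add: diff_divide_distrib)
  also have "\<dots> = (\<Sum>w\<in>X \<inter> - ball 0 r0. 1 / w ^ l)"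
    using fin by (intro sum.mono_neutral_cong_right) auto
  finally show "inv_power_sum r0 \<phi> l X = (\<Sum>w\<in>X \<inter> - ball 0 r0. 1 / w ^ l)" .
qed

text \<open>For infinite \<open>X\<close> the exchange rests on positivity. The partial sum of the
  first \<open>J\<close> scales weighs each point by \<open>c J z\<close>, which lies between 0 and
  the indicator of the complement of the disc and equals 1 once
  \<open>r0 \<le> norm z < r0 * 2 ^ J\<close>. Partial sums over scales and sums over finite sets of
  points then bound each other.\<close>

lemma abs_inv_power_sum_has_sum:
  assumes fin: "\<And>B. bounded B \<Longrightarrow> finite (X \<inter> B)"
    and sm: "summable (\<lambda>j. abs_lin_stat (dilate (2 ^ j) \<phi>) l X)"
  shows "((\<lambda>w. 1 / norm w ^ l) has_sum abs_inv_power_sum r0 \<phi> l X) (X \<inter> - ball 0 r0)"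
proof -
  let ?Y = "X \<inter> - ball 0 r0"
  let ?u = "\<lambda>w::complex. 1 / norm w ^ l"
  define A where "A j = abs_lin_stat (dilate (2 ^ (1 + j)) \<phi>) l X" for j
  define a where "a = abs_lin_stat (cutoff_tilde r0 \<phi>) l X"
  define c where "c J z = cutoff_tilde r0 \<phi> z + (\<Sum>j<J. dilate (2 ^ (1 + j)) \<phi> z)" for J :: nat and z
  \<comment> \<open>The first \<open>J\<close> scales are all supported within radius
    \<open>3 * r0 * 2 ^ J\<close>, so finitely many points carry the partial sum.\<close>
  define Z where "Z J = X \<inter> cball 0 (3 * r0 * 2 ^ J)" for J :: nat
  have finZ: "finite (Z J)" for J unfolding Z_def by (intro fin) simp
  have mono: "3 * r0 * 2 ^ i \<le> 3 * r0 * 2 ^ J" if "i \<le> J" for i J :: nat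
    using that r0 by (intro mult_left_mono power_increasing) auto
  have A0: "0 \<le> A j" for j
    unfolding A_def abs_lin_stat_def using dilate_nonneg by (intro integral_nonneg_AE) auto
  have smA: "summable A"
    using sm unfolding A_def by (subst (asm) summable_Suc_iff[symmetric]) simp
  have S: "a + (\<Sum>j<J. A j) = (\<Sum>z\<in>Z J. c J z / norm z ^ l)" for J
  proof -
    have "a = (\<Sum>z\<in>Z J. cutoff_tilde r0 \<phi> z / norm z ^ l)"
      unfolding a_def Z_def using cutoff_tilde_support mono[of 0 J] finZ[of J, unfolded Z_def]
      by (intro abs_lin_stat_finite cutoff_tilde_measurable) fastforce+
    moreover have "A j = (\<Sum>z\<in>Z J. dilate (2 ^ (1 + j)) \<phi> z / norm z ^ l)" if "j < J" for j
      unfolding A_def Z_def using dilate_support mono[of "1 + j" J] finZ[of J, unfolded Z_def] that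
      by (intro abs_lin_stat_finite dilate_measurable) fastforce+
    ultimately have "a + (\<Sum>j<J. A j) = (\<Sum>z\<in>Z J. cutoff_tilde r0 \<phi> z / norm z ^ l)
        + (\<Sum>z\<in>Z J. \<Sum>j<J. dilate (2 ^ (1 + j)) \<phi> z / norm z ^ l)"
      by (simp add: sum.swap[of _ "Z J"])
    then show ?thesis
      by (simp only: c_def add_divide_distrib sum_divide_distrib sum.distrib)
  qed
  have c_le: "c J z \<le> indicator (- ball 0 r0) z" for J z
    using sum_le_suminf[OF sums_summable[OF partition_sums[of z]], of "{..<J}"] dilate_nonneg
      sums_unique[OF partition_sums[of z]]
    by (simp add: c_def)
  have c0: "0 \<le> c J z" for J z
    unfolding c_def by (intro add_nonneg_nonneg sum_nonneg cutoff_tilde_nonneg dilate_nonneg)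
  have c_eq: "c J z = 1" if "r0 \<le> norm z" "norm z < r0 * 2 ^ J" for J z
  proof -
    have "dilate (2 ^ (1 + j)) \<phi> z = 0" if "j \<notin> {..<J}" for j
    proof (rule ccontr)
      assume "dilate (2 ^ (1 + j)) \<phi> z \<noteq> 0"
      then have "r0 * 2 ^ (1 + j) \<le> norm z" using dilate_support by blast
      moreover have "r0 * 2 ^ J \<le> r0 * 2 ^ (1 + j)"
        using \<open>j \<notin> {..<J}\<close> r0 by (intro mult_left_mono power_increasing) auto
      ultimately show False using \<open>norm z < r0 * 2 ^ J\<close> by linarith
    qed
    then have "(\<lambda>j. dilate (2 ^ (1 + j)) \<phi> z) sums (\<Sum>j<J. dilate (2 ^ (1 + j)) \<phi> z)"
      by (intro sums_finite) auto
    from sums_unique2[OF this partition_sums[of z]] show ?thesis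
      using \<open>r0 \<le> norm z\<close> by (simp add: c_def)
  qed
  have S_le: "a + (\<Sum>j<J. A j) \<le> a + (\<Sum>j. A j)" for J
    using sum_le_suminf[OF smA, of "{..<J}"] A0 by simp
  have part: "sum ?u F \<le> a + (\<Sum>j. A j)" if F: "finite F" "F \<subseteq> ?Y" for F
  proof -
    obtain D where D: "norm z \<le> D" if "z \<in> F" for z
      using finite_imp_bounded[OF F(1)] by (auto simp: bounded_iff)
    \<comment> \<open>\<open>J\<close> is so large that every point of \<open>F\<close> receives
      weight 1.\<close>
    obtain J where "D / r0 < 2 ^ J" using real_arch_pow[of 2 "D / r0"] by auto
    then have J: "D < r0 * 2 ^ J" using r0 by (simp add: field_simps)
    have FZ: "F \<subseteq> Z J"
    proof
      fix z assume z: "z \<in> F"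
      have "r0 * 2 ^ J \<le> 3 * r0 * 2 ^ J" using r0 by simp
      then show "z \<in> Z J" using D[OF z] J F(2) z unfolding Z_def by auto
    qed
    have "sum ?u F = (\<Sum>z\<in>F. c J z / norm z ^ l)"
    proof (rule sum.cong[OF refl])
      fix z assume z: "z \<in> F"
      then have "r0 \<le> norm z" "norm z < r0 * 2 ^ J" using D[OF z] J F(2) by auto
      then show "?u z = c J z / norm z ^ l" by (simp add: c_eq)
    qed
    also have "\<dots> \<le> (\<Sum>z\<in>Z J. c J z / norm z ^ l)"
      by (rule sum_mono2[OF finZ FZ]) (simp add: c0)
    also have "\<dots> \<le> a + (\<Sum>j. A j)" using S S_le by metis
    finally show ?thesis .
  qed
  have sY: "?u summable_on ?Y"
    by (rule nonneg_bdd_above_summable_on) (auto intro!: bdd_aboveI2 part simp: subset_iff)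
  have "infsum ?u ?Y \<le> a + (\<Sum>j. A j)"
    by (rule infsum_le_finite_sums[OF sY part])
  moreover have "a + (\<Sum>j. A j) \<le> infsum ?u ?Y"
  proof (rule LIMSEQ_le_const2)
    show "(\<lambda>J. a + (\<Sum>j<J. A j)) \<longlonglongrightarrow> a + (\<Sum>j. A j)"
      by (intro tendsto_intros summable_LIMSEQ smA)
    have "a + (\<Sum>j<J. A j) \<le> infsum ?u ?Y" for J
    proof -
      have "a + (\<Sum>j<J. A j) \<le> (\<Sum>z\<in>Z J. indicator (- ball 0 r0) z / norm z ^ l)"
        unfolding S by (intro sum_mono divide_right_mono c_le) simp
      also have "\<dots> = sum ?u (Z J \<inter> - ball 0 r0)"
        using finZ by (intro sum.mono_neutral_cong_right) auto
      also have "\<dots> \<le> infsum ?u ?Y"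
        using finZ[of J] by (intro finite_sum_le_infsum sY) (auto simp: Z_def)
      finally show ?thesis .
    qed
    then show "\<exists>N. \<forall>J\<ge>N. a + (\<Sum>j<J. A j) \<le> infsum ?u ?Y" by blast
  qed
  ultimately have "infsum ?u ?Y = abs_inv_power_sum r0 \<phi> l X"
    by (simp add: abs_inv_power_sum_def abs_inv_power_tail_def a_def A_def)
  then show ?thesis using has_sum_infsum[OF sY] by simp
qed

lemma abs_inv_power_sum_finite:
  assumes fin: "finite X"
  shows "summable (\<lambda>j. abs_lin_stat (dilate (2 ^ j) \<phi>) l X)"
    and "abs_inv_power_sum r0 \<phi> l X = (\<Sum>w\<in>X \<inter> - ball 0 r0. 1 / norm w ^ l)"
proof -
  have e: "abs_lin_stat (dilate (2 ^ j) \<phi>) l X = (\<Sum>z\<in>X. dilate (2 ^ j) \<phi> z / norm z ^ l)" for j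
    using abs_lin_stat_finite[of X UNIV, OF _ dilate_measurable] fin by simp
  have "(\<lambda>j. abs_lin_stat (dilate (2 ^ (1 + j)) \<phi>) l X) sums
      (\<Sum>z\<in>X. (indicator (- ball 0 r0) z - cutoff_tilde r0 \<phi> z) / norm z ^ l)"
    unfolding e by (intro sums_sum sums_divide partition_sums)
  then have "summable (\<lambda>j. abs_lin_stat (dilate (2 ^ Suc j) \<phi>) l X)"
    by (simp add: sums_iff)
  then show sm: "summable (\<lambda>j. abs_lin_stat (dilate (2 ^ j) \<phi>) l X)"
    by (subst (asm) summable_Suc_iff)
  have "((\<lambda>w. 1 / norm w ^ l) has_sum (\<Sum>w\<in>X \<inter> - ball 0 r0. 1 / norm w ^ l)) (X \<inter> - ball 0 r0)"
    using fin by (intro has_sum_finite) auto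
  then show "abs_inv_power_sum r0 \<phi> l X = (\<Sum>w\<in>X \<inter> - ball 0 r0. 1 / norm w ^ l)"
    using abs_inv_power_sum_has_sum[OF _ sm] fin by (intro has_sum_unique) auto
qed

end

section \<open>Moments of the tails and of the full sums\<close>

context ginibre_process
begin

text \<open>The geometric ratio is \<open>(1 / 2) ^ l\<close>, at most \<open>1 / 2\<close> from
  \<open>l = 1\<close> on.\<close>

lemma inv_power_tail_moment:
  assumes c: "cutoff_function r0 \<phi>" and l: "l \<ge> 1" and \<Lambda>: "\<Lambda> \<ge> 0"
    "\<And>z w. norm (complex_of_real (\<phi> z) / z ^ l - complex_of_real (\<phi> w) / w ^ l) \<le> \<Lambda> * norm (z - w)"
  shows "AE x in M. summable (\<lambda>j. lin_stat (dilate (2 ^ j) \<phi>) l (X x))"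
    and "integrable M (\<lambda>x. inv_power_tail \<phi> l k (X x))"
    and "(\<integral>x. norm (inv_power_tail \<phi> l k (X x)) \<partial>M) \<le> 2 * (3 * r0 * \<Lambda>) / 2 ^ (k * l)"
proof -
  have q: "0 < (1 / 2 :: real) ^ l" "(1 / 2 :: real) ^ l \<le> 1 / 2"
    using power_decreasing[OF l, of "1 / 2 :: real"] by auto
  note gt = determinantal.geometric_tail[OF lin_stat_dilate_moment[OF c l \<Lambda>] q]
  show "AE x in M. summable (\<lambda>j. lin_stat (dilate (2 ^ j) \<phi>) l (X x))"
    using gt(1) by eventually_elim (rule summable_norm_cancel)
  show "integrable M (\<lambda>x. inv_power_tail \<phi> l k (X x))"
    unfolding inv_power_tail_def by (rule gt(2))
  have "((1 / 2 :: real) ^ l) ^ k = 1 / 2 ^ (k * l)"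
    by (simp add: power_mult[symmetric] power_one_over mult.commute)
  then show "(\<integral>x. norm (inv_power_tail \<phi> l k (X x)) \<partial>M) \<le> 2 * (3 * r0 * \<Lambda>) / 2 ^ (k * l)"
    using gt(3)[of k] by (simp add: inv_power_tail_def)
qed

text \<open>The mean number of points at scale \<open>2 ^ j\<close> is of order at most
  \<open>4 ^ j\<close>, and each contributes at most the order of \<open>2 ^ (- j * l)\<close>. The
  resulting ratio \<open>(1 / 2) ^ (l - 2)\<close> is at most \<open>1 / 2\<close> precisely from
  \<open>l = 3\<close> on.\<close>

lemma abs_inv_power_tail_moment:
  assumes c: "cutoff_function r0 \<phi>" and l: "l \<ge> 3"
  shows "AE x in M. summable (\<lambda>j. abs_lin_stat (dilate (2 ^ j) \<phi>) l (X x))"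
    and "integrable M (\<lambda>x. abs_inv_power_tail \<phi> l k (X x))"
    and "(\<integral>x. \<bar>abs_inv_power_tail \<phi> l k (X x)\<bar> \<partial>M) \<le> 2 * ((3 * r0)\<^sup>2 / r0 ^ l) / 2 ^ (k * (l - 2))"
proof -
  interpret c: cutoff_function r0 \<phi> by fact
  have q: "0 < (1 / 2 :: real) ^ (l - 2)" "(1 / 2 :: real) ^ (l - 2) \<le> 1 / 2"
    using power_decreasing[of 1 "l - 2" "1 / 2 :: real"] l by auto
  have m: "integrable M (\<lambda>x. abs_lin_stat (dilate (2 ^ j) \<phi>) l (X x))"
    "(\<integral>x. norm (abs_lin_stat (dilate (2 ^ j) \<phi>) l (X x)) \<partial>M) \<le> (3 * r0)\<^sup>2 / r0 ^ l * ((1 / 2) ^ (l - 2)) ^ j" for j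
  proof -
    \<comment> \<open>Splitting the exponent as \<open>2 + (l - 2)\<close> cancels the growth of the
      area; \<open>l \<ge> 3\<close> makes the natural subtraction genuine.\<close>
    have "((2::real) ^ j) ^ (2 + (l - 2)) = (2 ^ j)\<^sup>2 * (2 ^ j) ^ (l - 2)"
      by (rule power_add)
    moreover have "2 + (l - 2) = l" using l by simp
    ultimately have "((2::real) ^ j) ^ l = (2 ^ j)\<^sup>2 * (2 ^ j) ^ (l - 2)"
      by (simp only:)
    moreover have "((1 / 2 :: real) ^ (l - 2)) ^ j = 1 / (2 ^ j) ^ (l - 2)"
      by (simp add: power_one_over power_mult[symmetric] mult.commute)
    ultimately have e: "(3 * r0 * 2 ^ j)\<^sup>2 / (r0 * 2 ^ j) ^ l = (3 * r0)\<^sup>2 / r0 ^ l * ((1 / 2) ^ (l - 2)) ^ j"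
      by (simp add: power_mult_distrib)
    note mom = abs_lin_stat_moment[where \<psi> = "dilate (2 ^ j) \<phi>" and a = "r0 * 2 ^ j" and b = "3 * r0 * 2 ^ j"
        and l = l, OF c.dilate_measurable c.dilate_nonneg c.dilate_le_one c.dilate_support, unfolded e]
    show "integrable M (\<lambda>x. abs_lin_stat (dilate (2 ^ j) \<phi>) l (X x))"
      "(\<integral>x. norm (abs_lin_stat (dilate (2 ^ j) \<phi>) l (X x)) \<partial>M) \<le> (3 * r0)\<^sup>2 / r0 ^ l * ((1 / 2) ^ (l - 2)) ^ j"
      using mom(1,2) c.r0 by auto
  qed
  note gt = determinantal.geometric_tail[OF m q]
  show "AE x in M. summable (\<lambda>j. abs_lin_stat (dilate (2 ^ j) \<phi>) l (X x))"
    using gt(1) by eventually_elim (rule summable_norm_cancel)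
  show "integrable M (\<lambda>x. abs_inv_power_tail \<phi> l k (X x))"
    unfolding abs_inv_power_tail_def by (rule gt(2))
  have "((1 / 2 :: real) ^ (l - 2)) ^ k = 1 / 2 ^ (k * (l - 2))"
    by (simp add: power_mult[symmetric] power_one_over mult.commute)
  then show "(\<integral>x. \<bar>abs_inv_power_tail \<phi> l k (X x)\<bar> \<partial>M) \<le> 2 * ((3 * r0)\<^sup>2 / r0 ^ l) / 2 ^ (k * (l - 2))"
    using gt(3)[of k] by (simp add: abs_inv_power_tail_def)
qed

text \<open>The innermost annulus is bounded by its expected number of points, everything beyond by
  the tail at \<open>k = 1\<close>.\<close>

lemma inv_power_sum_moment:
  assumes c: "cutoff_function r0 \<phi>" and l: "l \<ge> 1" and \<Lambda>: "\<Lambda> \<ge> 0"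
    "\<And>z w. norm (complex_of_real (\<phi> z) / z ^ l - complex_of_real (\<phi> w) / w ^ l) \<le> \<Lambda> * norm (z - w)"
  shows "integrable M (\<lambda>x. inv_power_sum r0 \<phi> l (X x))"
    and "(\<integral>x. norm (inv_power_sum r0 \<phi> l (X x)) \<partial>M) \<le> (3 * r0)\<^sup>2 / r0 ^ l + 2 * (3 * r0 * \<Lambda>) / 2 ^ l"
proof -
  interpret c: cutoff_function r0 \<phi> by fact
  note t = inv_power_tail_moment(2,3)[OF c l \<Lambda>, of 1]
  note s = abs_lin_stat_moment(3,4)[OF c.cutoff_tilde_measurable c.cutoff_tilde_nonneg c.cutoff_tilde_le_one
      c.cutoff_tilde_support, of l]
  show int: "integrable M (\<lambda>x. inv_power_sum r0 \<phi> l (X x))"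
    unfolding inv_power_sum_def using s(1) t(1) c.r0 by simp
  have "(\<integral>x. norm (inv_power_sum r0 \<phi> l (X x)) \<partial>M)
      \<le> (\<integral>x. norm (lin_stat (cutoff_tilde r0 \<phi>) l (X x)) + norm (inv_power_tail \<phi> l 1 (X x)) \<partial>M)"
    using int s(1) t(1) c.r0 by (intro integral_mono) (auto simp: inv_power_sum_def norm_triangle_ineq)
  also have "\<dots> = (\<integral>x. norm (lin_stat (cutoff_tilde r0 \<phi>) l (X x)) \<partial>M) + (\<integral>x. norm (inv_power_tail \<phi> l 1 (X x)) \<partial>M)"
    using s(1) t(1) c.r0 by (intro Bochner_Integration.integral_add) auto
  finally show "(\<integral>x. norm (inv_power_sum r0 \<phi> l (X x)) \<partial>M) \<le> (3 * r0)\<^sup>2 / r0 ^ l + 2 * (3 * r0 * \<Lambda>) / 2 ^ l"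
    using s(2) t(2) c.r0 by simp
qed

lemma abs_inv_power_sum_moment:
  assumes c: "cutoff_function r0 \<phi>" and l: "l \<ge> 3"
  shows "integrable M (\<lambda>x. abs_inv_power_sum r0 \<phi> l (X x))"
    and "(\<integral>x. \<bar>abs_inv_power_sum r0 \<phi> l (X x)\<bar> \<partial>M)
      \<le> (3 * r0)\<^sup>2 / r0 ^ l + 2 * ((3 * r0)\<^sup>2 / r0 ^ l) / 2 ^ (l - 2)"
proof -
  interpret c: cutoff_function r0 \<phi> by fact
  note t = abs_inv_power_tail_moment(2,3)[OF c l, of 1]
  note s = abs_lin_stat_moment(1,2)[OF c.cutoff_tilde_measurable c.cutoff_tilde_nonneg c.cutoff_tilde_le_one
      c.cutoff_tilde_support, of l]
  show int: "integrable M (\<lambda>x. abs_inv_power_sum r0 \<phi> l (X x))"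
    unfolding abs_inv_power_sum_def using s(1) t(1) c.r0 by simp
  have "(\<integral>x. \<bar>abs_inv_power_sum r0 \<phi> l (X x)\<bar> \<partial>M)
      \<le> (\<integral>x. \<bar>abs_lin_stat (cutoff_tilde r0 \<phi>) l (X x)\<bar> + \<bar>abs_inv_power_tail \<phi> l 1 (X x)\<bar> \<partial>M)"
    using int s(1) t(1) c.r0 by (intro integral_mono) (auto simp: abs_inv_power_sum_def abs_triangle_ineq)
  also have "\<dots> = (\<integral>x. \<bar>abs_lin_stat (cutoff_tilde r0 \<phi>) l (X x)\<bar> \<partial>M) + (\<integral>x. \<bar>abs_inv_power_tail \<phi> l 1 (X x)\<bar> \<partial>M)"
    using s(1) t(1) c.r0 by (intro Bochner_Integration.integral_add) auto
  finally show "(\<integral>x. \<bar>abs_inv_power_sum r0 \<phi> l (X x)\<bar> \<partial>M)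
      \<le> (3 * r0)\<^sup>2 / r0 ^ l + 2 * ((3 * r0)\<^sup>2 / r0 ^ l) / 2 ^ (l - 2)"
    using s(2) t(2) c.r0 by simp
qed

end

section \<open>The two ensembles and the final statement\<close>

lemma ginibre_process_finite:
  assumes "ginibre_ensemble n M G"
  shows "ginibre_process M G (ginibre_kernel n)"
proof -
  interpret gaussian_kernel "ginibre_kernel n" by (rule gaussian_kernel_ginibre)
  have d: "determinantal_process M G gaussian_measure (ginibre_kernel n)"
    using assms by (simp add: ginibre_ensemble_def)
  interpret prob_space M
    using d by (auto simp: determinantal_process_def point_process_def)
  show ?thesis
  proof
    show "determinantal_process M G gaussian_measure (ginibre_kernel n)" by (rule d)
    show "intensity (u * z) = intensity z" if "norm u = 1" for u z
      using that by (simp add: intensity_def ginibre_kernel_diag norm_monomial_squared norm_mult)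
    show "kernel_variance (ginibre_kernel n) f \<le> kernel_variance exp_kernel f"
      if "angular_test_function f B R l" for f B R l
      using that by (rule angular_test_function.kernel_variance_ginibre_le)
  qed
qed

lemma ginibre_process_infinite:
  assumes "infinite_ginibre_ensemble M G"
  shows "ginibre_process M G exp_kernel"
proof -
  interpret gaussian_kernel exp_kernel by (rule gaussian_kernel_exp)
  have "exp_kernel = (\<lambda>z w. exp (z * cnj w))"
    by (simp add: fun_eq_iff exp_kernel_def)
  with assms have d: "determinantal_process M G gaussian_measure exp_kernel"
    by (simp add: infinite_ginibre_ensemble_def)
  interpret prob_space M
    using d by (auto simp: determinantal_process_def point_process_def)
  show ?thesis
  proof
    show "determinantal_process M G gaussian_measure exp_kernel" by (rule d)
    show "intensity (u * z) = intensity z" if "norm u = 1" for u z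
      using that by (simp add: intensity_def exp_kernel_diag norm_mult)
  qed simp
qed

text \<open>A point process is by definition only locally finite. The mean of the total count is the
  sum of the squared norms of \<open>n\<close> unit vectors, hence finite, and the identities for
  finite sets become available almost surely.\<close>

lemma ginibre_ensemble_AE_finite:
  assumes "ginibre_ensemble n M G"
  shows "AE x in M. finite (G x)"
proof -
  interpret ginibre_process M G "ginibre_kernel n" by (rule ginibre_process_finite[OF assms])
  have "(\<integral>\<^sup>+x. emeasure (pts_measure (G x)) UNIV \<partial>M) = (\<integral>\<^sup>+z. ennreal (intensity z) \<partial>gaussian_measure)"
    using first_intensity[of UNIV] by simp
  also have "\<dots> = (\<integral>\<^sup>+z. (\<Sum>k<n. ennreal ((norm (monomial k z))\<^sup>2)) \<partial>gaussian_measure)"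
    by (intro nn_integral_cong) (simp add: intensity_def ginibre_kernel_diag sum_ennreal)
  also have "\<dots> = of_nat n"
    by (subst nn_integral_sum) (simp_all add: monomial_normalized)
  finally have "(\<integral>\<^sup>+x. emeasure (pts_measure (G x)) UNIV \<partial>M) \<noteq> \<infinity>" by simp
  then have "AE x in M. emeasure (pts_measure (G x)) UNIV \<noteq> \<infinity>"
    by (intro nn_integral_PInf_AE measurable_emeasure_pts_measure[OF process]) auto
  then show ?thesis
    by eventually_elim (auto simp: emeasure_pts_measure intro: ccontr)
qed

text \<open>All constants are quantified ahead of \<open>n\<close> and of the process, which
  expresses uniformity. The two type variables let the finite and the infinite ensembles live on
  different sample spaces, and sharing \<open>C1\<close> and \<open>C2\<close> is possible because
  both are instances of \<open>ginibre_process\<close>.\<close>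

theorem proposition8p6:
  fixes r0 :: real and \<phi> :: "complex \<Rightarrow> real"
  assumes r0: "r0 > 0" and \<phi>: "cutoff r0 \<phi>"
  shows "\<exists>k0\<ge>1. \<exists>B1 B2 C1 C2 :: nat \<Rightarrow> real.
    (\<forall>n\<ge>1. \<forall>(M :: 'a measure) G. ginibre_ensemble n M G \<longrightarrow>
       (\<forall>l\<ge>1.
          (AE x in M. finite (G x)
             \<and> summable (\<lambda>j. lin_stat (dilate (2 ^ j) \<phi>) l (G x))
             \<and> inv_power_sum r0 \<phi> l (G x) = (\<Sum>w\<in>G x \<inter> - ball 0 r0. 1 / w ^ l))
        \<and> integrable M (\<lambda>x. inv_power_sum r0 \<phi> l (G x))
        \<and> (\<integral>x. norm (inv_power_sum r0 \<phi> l (G x)) \<partial>M) \<le> B1 l)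
     \<and> (\<forall>l\<ge>3.
          (AE x in M. finite (G x)
             \<and> summable (\<lambda>j. abs_lin_stat (dilate (2 ^ j) \<phi>) l (G x))
             \<and> abs_inv_power_sum r0 \<phi> l (G x) = (\<Sum>w\<in>G x \<inter> - ball 0 r0. 1 / norm w ^ l))
        \<and> integrable M (\<lambda>x. abs_inv_power_sum r0 \<phi> l (G x))
        \<and> (\<integral>x. \<bar>abs_inv_power_sum r0 \<phi> l (G x)\<bar> \<partial>M) \<le> B2 l)
     \<and> (\<forall>k\<ge>k0.
          (\<forall>l\<ge>1. integrable M (\<lambda>x. inv_power_tail \<phi> l k (G x))
             \<and> (\<integral>x. norm (inv_power_tail \<phi> l k (G x)) \<partial>M) \<le> C1 l / 2 ^ (k * l))
        \<and> (\<forall>l\<ge>3. integrable M (\<lambda>x. abs_inv_power_tail \<phi> l k (G x))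
             \<and> (\<integral>x. \<bar>abs_inv_power_tail \<phi> l k (G x)\<bar> \<partial>M) \<le> C2 l / 2 ^ (k * (l - 2)))))
  \<and> (\<forall>(M :: 'b measure) G. infinite_ginibre_ensemble M G \<longrightarrow>
       (\<forall>l\<ge>1.
          (AE x in M. summable (\<lambda>j. lin_stat (dilate (2 ^ j) \<phi>) l (G x)))
        \<and> integrable M (\<lambda>x. inv_power_sum r0 \<phi> l (G x)))
     \<and> (\<forall>l\<ge>3.
          (AE x in M. summable (\<lambda>j. abs_lin_stat (dilate (2 ^ j) \<phi>) l (G x))
             \<and> ((\<lambda>w. 1 / norm w ^ l) has_sum abs_inv_power_sum r0 \<phi> l (G x)) (G x \<inter> - ball 0 r0))
        \<and> integrable M (\<lambda>x. abs_inv_power_sum r0 \<phi> l (G x)))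
     \<and> (\<forall>k\<ge>k0.
          (\<forall>l\<ge>1. integrable M (\<lambda>x. inv_power_tail \<phi> l k (G x))
             \<and> (\<integral>x. norm (inv_power_tail \<phi> l k (G x)) \<partial>M) \<le> C1 l / 2 ^ (k * l))
        \<and> (\<forall>l\<ge>3. integrable M (\<lambda>x. abs_inv_power_tail \<phi> l k (G x))
             \<and> (\<integral>x. \<bar>abs_inv_power_tail \<phi> l k (G x)\<bar> \<partial>M) \<le> C2 l / 2 ^ (k * (l - 2)))))"
proof -
  interpret c: cutoff_function r0 \<phi> using r0 \<phi> by unfold_locales
  have "\<forall>l. \<exists>\<Lambda>\<ge>0. \<forall>z w. norm (complex_of_real (\<phi> z) / z ^ l - complex_of_real (\<phi> w) / w ^ l) \<le> \<Lambda> * norm (z - w)"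
    using c.Lipschitz_div_power by blast
  then obtain \<Lambda> where "\<forall>l. \<Lambda> l \<ge> 0 \<and>
      (\<forall>z w. norm (complex_of_real (\<phi> z) / z ^ l - complex_of_real (\<phi> w) / w ^ l) \<le> \<Lambda> l * norm (z - w))"
    by metis
  then have \<Lambda>: "\<Lambda> l \<ge> 0"
      "norm (complex_of_real (\<phi> z) / z ^ l - complex_of_real (\<phi> w) / w ^ l) \<le> \<Lambda> l * norm (z - w)" for l z w
    by blast+
  note c = c.cutoff_function_axioms
  \<comment> \<open>\<open>3 * r0\<close> is the support radius of \<open>\<phi>\<close> before
    dilation, \<open>\<Lambda> l\<close> the Lipschitz constant after division by
    \<open>z ^ l\<close>, and 2 the bound for the geometric series.\<close>
  define C1 where "C1 l = 2 * (3 * r0 * \<Lambda> l)" for l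
  define C2 where "C2 l = 2 * ((3 * r0)\<^sup>2 / r0 ^ l)" for l :: nat
  \<comment> \<open>The innermost annulus, estimated without cancellation, plus the tail at
    \<open>k = 1\<close>.\<close>
  define B1 where "B1 l = (3 * r0)\<^sup>2 / r0 ^ l + C1 l / 2 ^ l" for l
  define B2 where "B2 l = (3 * r0)\<^sup>2 / r0 ^ l + C2 l / 2 ^ (l - 2)" for l
  note bounds = C1_def C2_def B1_def B2_def
  show ?thesis
  proof (rule exI[of _ 1], rule conjI[OF order_refl], rule exI[of _ B1], rule exI[of _ B2],
      rule exI[of _ C1], rule exI[of _ C2], intro conjI allI impI)
    fix n and M :: "'a measure" and G
    assume G: "ginibre_ensemble n M G"
    interpret ginibre_process M G "ginibre_kernel n" by (rule ginibre_process_finite[OF G])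
    note fin = ginibre_ensemble_AE_finite[OF G]
    show "AE x in M. finite (G x)
             \<and> summable (\<lambda>j. lin_stat (dilate (2 ^ j) \<phi>) l (G x))
             \<and> inv_power_sum r0 \<phi> l (G x) = (\<Sum>w\<in>G x \<inter> - ball 0 r0. 1 / w ^ l)" for l
      using fin by eventually_elim (intro conjI c.inv_power_sum_finite)
    show "AE x in M. finite (G x)
             \<and> summable (\<lambda>j. abs_lin_stat (dilate (2 ^ j) \<phi>) l (G x))
             \<and> abs_inv_power_sum r0 \<phi> l (G x) = (\<Sum>w\<in>G x \<inter> - ball 0 r0. 1 / norm w ^ l)" for l
      using fin by eventually_elim (intro conjI c.abs_inv_power_sum_finite)
    fix l k :: nat
    show "integrable M (\<lambda>x. inv_power_sum r0 \<phi> l (G x))"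
      "(\<integral>x. norm (inv_power_sum r0 \<phi> l (G x)) \<partial>M) \<le> B1 l"
      "integrable M (\<lambda>x. inv_power_tail \<phi> l k (G x))"
      "(\<integral>x. norm (inv_power_tail \<phi> l k (G x)) \<partial>M) \<le> C1 l / 2 ^ (k * l)" if "1 \<le> l"
      unfolding bounds
      using inv_power_sum_moment[OF c that \<Lambda>] inv_power_tail_moment(2,3)[OF c that \<Lambda>] by blast+
    show "integrable M (\<lambda>x. abs_inv_power_sum r0 \<phi> l (G x))"
      "(\<integral>x. \<bar>abs_inv_power_sum r0 \<phi> l (G x)\<bar> \<partial>M) \<le> B2 l"
      "integrable M (\<lambda>x. abs_inv_power_tail \<phi> l k (G x))"
      "(\<integral>x. \<bar>abs_inv_power_tail \<phi> l k (G x)\<bar> \<partial>M) \<le> C2 l / 2 ^ (k * (l - 2))" if "3 \<le> l"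
      unfolding bounds
      using abs_inv_power_sum_moment[OF c that] abs_inv_power_tail_moment(2,3)[OF c that] by blast+
  next
    fix M :: "'b measure" and G
    assume G: "infinite_ginibre_ensemble M G"
    interpret ginibre_process M G exp_kernel by (rule ginibre_process_infinite[OF G])
    fix l k :: nat
    show "AE x in M. summable (\<lambda>j. lin_stat (dilate (2 ^ j) \<phi>) l (G x))"
      "integrable M (\<lambda>x. inv_power_sum r0 \<phi> l (G x))"
      "integrable M (\<lambda>x. inv_power_tail \<phi> l k (G x))"
      "(\<integral>x. norm (inv_power_tail \<phi> l k (G x)) \<partial>M) \<le> C1 l / 2 ^ (k * l)" if "1 \<le> l"
      unfolding bounds
      using inv_power_sum_moment(1)[OF c that \<Lambda>] inv_power_tail_moment[OF c that \<Lambda>] by blast+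
    show "AE x in M. summable (\<lambda>j. abs_lin_stat (dilate (2 ^ j) \<phi>) l (G x))
             \<and> ((\<lambda>w. 1 / norm w ^ l) has_sum abs_inv_power_sum r0 \<phi> l (G x)) (G x \<inter> - ball 0 r0)" if "3 \<le> l"
      \<comment> \<open>Local finiteness holds at every point of the sample space;
        \<open>AE_space\<close> supplies the membership in it.\<close>
      using abs_inv_power_tail_moment(1)[OF c that] AE_space
      by eventually_elim (intro conjI c.abs_inv_power_sum_has_sum point_process_finite[OF process])
    show "integrable M (\<lambda>x. abs_inv_power_sum r0 \<phi> l (G x))"
      "integrable M (\<lambda>x. abs_inv_power_tail \<phi> l k (G x))"
      "(\<integral>x. \<bar>abs_inv_power_tail \<phi> l k (G x)\<bar> \<partial>M) \<le> C2 l / 2 ^ (k * (l - 2))" if "3 \<le> l"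
      unfolding bounds
      using abs_inv_power_sum_moment(1)[OF c that] abs_inv_power_tail_moment(2,3)[OF c that] by blast+
  qed
qed

end
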